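(* Let $B$ be a compact, path-connected, locally simply-connected Hausdorff space, let $\mathcal G\to B$ be a bundle of compact Lie groups with representation theoretic finite holonomy, let $H^0,H^1\to B$ be locally trivial bundles of $\mathcal G$-Hilbert spaces, and let $F=(F_b:H^0_b\to H^1_b)_{b\in B}$ be a family of $\mathcal G$-invariant Fredholm operators that is norm-continuous in any trivialization of $H^i\to B$. Then the gauge-equivariant index $$\mathrm{ind}_{\mathcal G}(F):=[\mathrm{KER}]-[\mathrm{COK}]\in K^0_{\mathcal G}(B)$$ is well defined, that is, it depends only on $F$ and not on the choice of the $\mathcal G$-equivariant sub-bundle $\mathrm{KER}$.
   Context: A bundle of compact Lie groups $d:\mathcal G\to B$ with typical fiber a compact Lie group $G$ is a locally trivial fiber bundle with structure group $\operatorname{Aut}(G)$; $\mathcal G\cong\mathcal P\times_{\operatorname{Aut}(G)}G$ for a principal $\operatorname{Aut}(G)$-bundle $\mathcal P$. $\widehat{\mathcal G}=\bigsqcup_b\widehat{\mathcal G_b}=\mathcal P\times_{\operatorname{Aut}(G)}\widehat G$, where $\widehat G$ is the discrete set of equivalence classes of irreducible representations of $G$; $\mathcal G$ has representation theoretic finite holonomy if every $\sigma\in\widehat{\mathcal G}$ is contained in a compact-open subset of $\widehat{\mathcal G}$. A locally trivial bundle of Hilbert spaces over $B$ is a fiber bundle $H\to B$ such that $B$ is covered by open sets $U_\alpha$ with $H|_{U_\alpha}\simeq U_\alpha\times H_0$, $H_0$ a fixed Hilbert space, with norm-continuous transition functions; a locally trivial bundle of $\mathcal G$-Hilbert spaces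 is such a bundle together with a fiber-preserving action of $\mathcal G$ on $H$ that consists of continuous families in any trivialization of $H$. Here $\mathrm{KER}\subset H^0$ is any finite-dimensional $\mathcal G$-invariant vector sub-bundle such that (1) $F_b:(\mathrm{KER}_b)^\perp\to F_b((\mathrm{KER}_b)^\perp)$ is a $\mathcal G_b$-isomorphism for every $b\in B$, and (2) $\mathrm{COK}:=\bigcup_{b\in B}(F_b((\mathrm{KER}_b)^\perp))^\perp\subset H^1$ is a finite-dimensional $\mathcal G$-invariant sub-bundle; the existence of such a sub-bundle is established beforehand. $K^0_{\mathcal G}(B)$ is the group completion of the monoid (under $\oplus$) of isomorphism classes of finite-dimensional $\mathcal G$-equivariant vector bundles over $B$. *)

theory Defs
  imports "HOL-Analysis.Analysis" "HOL-Algebra.Bij"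
begin

section \<open>Compact Lie groups\<close>

text \<open>
  R^n is \<^term>\<open>topspace (Euclidean_space n)\<close>, the sequences vanishing from index n on; n = 0 is
  needed, since finite groups are compact Lie groups.
\<close>

primrec Ck_on :: "nat \<Rightarrow> nat \<Rightarrow> (nat \<Rightarrow> real) set \<Rightarrow> ((nat \<Rightarrow> real) \<Rightarrow> real) \<Rightarrow> bool" where
  "Ck_on 0 n U f \<longleftrightarrow> continuous_map (subtopology (Euclidean_space n) U) euclideanreal f"
| "Ck_on (Suc k) n U f \<longleftrightarrow>
     continuous_map (subtopology (Euclidean_space n) U) euclideanreal f \<and>
     (\<forall>i<n. \<exists>f'. Ck_on k n U f' \<and>
        (\<forall>x\<in>U. ((\<lambda>t. f (x(i := t))) has_real_derivative f' x) (at (x i))))"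

definition smooth_map ::
  "nat \<Rightarrow> nat \<Rightarrow> (nat \<Rightarrow> real) set \<Rightarrow> ((nat \<Rightarrow> real) \<Rightarrow> (nat \<Rightarrow> real)) \<Rightarrow> bool" where
  "smooth_map n m U f \<longleftrightarrow> (\<forall>j<m. \<forall>k. Ck_on k n U (\<lambda>x. f x j))"

definition smooth_atlas :: "nat \<Rightarrow> 'k topology \<Rightarrow> ('k set \<times> ('k \<Rightarrow> nat \<Rightarrow> real)) set \<Rightarrow> bool" where
  "smooth_atlas n T \<A> \<longleftrightarrow>
     (\<Union>(U, \<phi>)\<in>\<A>. U) = topspace T \<and>
     (\<forall>(U, \<phi>)\<in>\<A>. openin T U \<and> openin (Euclidean_space n) (\<phi> ` U) \<and>
        homeomorphic_map (subtopology T U) (subtopology (Euclidean_space n) (\<phi> ` U)) \<phi>) \<and>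
     (\<forall>(U, \<phi>)\<in>\<A>. \<forall>(V, \<psi>)\<in>\<A>. smooth_map n n (\<phi> ` (U \<inter> V)) (\<lambda>x. \<psi> (inv_into U \<phi> x)))"

text \<open>
  Smoothness of the multiplication is expressed in product charts: a point z of R^(n+n) consists
  of its first n coordinates and its last n coordinates.
\<close>

definition compact_lie_group :: "'k monoid \<Rightarrow> 'k topology \<Rightarrow> bool" where
  "compact_lie_group G T \<longleftrightarrow>
     group G \<and> topspace T = carrier G \<and> compact_space T \<and> Hausdorff_space T \<and>
     continuous_map (prod_topology T T) T (\<lambda>(g, h). g \<otimes>\<^bsub>G\<^esub> h) \<and>
     continuous_map T T (\<lambda>g. inv\<^bsub>G\<^esub> g) \<and>
     (\<exists>n \<A>. smooth_atlas n T \<A> \<and>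
        (\<forall>(U, \<phi>)\<in>\<A>. \<forall>(V, \<psi>)\<in>\<A>. \<forall>(W, \<theta>)\<in>\<A>.
           let lo = (\<lambda>z i. if i < n then z i else 0);
               hi = (\<lambda>z i. z (i + n));
               m = (\<lambda>z. inv_into U \<phi> (lo z) \<otimes>\<^bsub>G\<^esub> inv_into V \<psi> (hi z))
           in smooth_map (n + n) n
                {z \<in> topspace (Euclidean_space (n + n)).
                   lo z \<in> \<phi> ` U \<and> hi z \<in> \<psi> ` V \<and> m z \<in> W}
                (\<lambda>z. \<theta> (m z))) \<and>
        (\<forall>(U, \<phi>)\<in>\<A>. \<forall>(V, \<psi>)\<in>\<A>.
           smooth_map n n {x \<in> \<phi> ` U. inv\<^bsub>G\<^esub> (inv_into U \<phi> x) \<in> V}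
             (\<lambda>x. \<psi> (inv\<^bsub>G\<^esub> (inv_into U \<phi> x)))))"

text \<open>
  Aut(G) with the compact-open topology. Continuous automorphisms of a Lie group are smooth, so
  these are the Lie group automorphisms.
\<close>

definition Aut_topology :: "'k monoid \<Rightarrow> 'k topology \<Rightarrow> ('k \<Rightarrow> 'k) topology" where
  "Aut_topology G T = topology_generated_by
     {{f \<in> auto G. homeomorphic_map T T f \<and> f ` K \<subseteq> V} | K V. compactin T K \<and> openin T V}"


section \<open>Bundles of compact Lie groups\<close>

record ('b, 'g) group_family =
  gtotal :: "'g topology"
  gproj :: "'g \<Rightarrow> 'b"
  gfibre :: "'b \<Rightarrow> 'g monoid"

definition group_triv ::
  "'k monoid \<Rightarrow> 'k topology \<Rightarrow> ('b::topological_space, 'g) group_family \<Rightarrow> 'b set \<Rightarrow> ('g \<Rightarrow> 'k) \<Rightarrow> bool"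
  where
  "group_triv G T \<G> U \<phi> \<longleftrightarrow>
     open U \<and>
     homeomorphic_map (subtopology (gtotal \<G>) {g. gproj \<G> g \<in> U}) (prod_topology (top_of_set U) T)
       (\<lambda>g. (gproj \<G> g, \<phi> g)) \<and>
     (\<forall>b\<in>U. \<phi> \<in> iso (gfibre \<G> b) G)"

text \<open>
  The last clause is the structure group condition: the transition functions are continuous maps
  into Aut(G). It is imposed on all fibrewise isomorphic local trivializations at once, i.e. on the
  maximal atlas; as G is compact Hausdorff, this is no restriction compared to a single atlas.
\<close>

definition group_bundle ::
  "'k monoid \<Rightarrow> 'k topology \<Rightarrow> ('b::topological_space, 'g) group_family \<Rightarrow> bool" where
  "group_bundle G T \<G> \<longleftrightarrow>
     continuous_map (gtotal \<G>) euclidean (gproj \<G>) \<and>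
     (\<forall>b. group (gfibre \<G> b) \<and> carrier (gfibre \<G> b) = {g \<in> topspace (gtotal \<G>). gproj \<G> g = b}) \<and>
     (\<forall>b. \<exists>U \<phi>. b \<in> U \<and> group_triv G T \<G> U \<phi>) \<and>
     (\<forall>U \<phi> V \<psi>. group_triv G T \<G> U \<phi> \<and> group_triv G T \<G> V \<psi> \<longrightarrow>
        continuous_map (top_of_set (U \<inter> V)) (Aut_topology G T)
          (\<lambda>b. restrict (\<lambda>k. \<psi> (inv_into (carrier (gfibre \<G> b)) \<phi> k)) (carrier G)))"


section \<open>Irreducible representations and finite holonomy\<close>

text \<open>C^n, as sequences vanishing from index n on.\<close>

definition Cspace :: "nat \<Rightarrow> (nat \<Rightarrow> complex) set" where
  "Cspace n = {x. \<forall>i\<ge>n. x i = 0}"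

definition Clinear :: "nat \<Rightarrow> nat \<Rightarrow> ((nat \<Rightarrow> complex) \<Rightarrow> (nat \<Rightarrow> complex)) \<Rightarrow> bool" where
  "Clinear n m f \<longleftrightarrow>
     (\<forall>x\<in>Cspace n. f x \<in> Cspace m) \<and>
     (\<forall>x\<in>Cspace n. \<forall>y\<in>Cspace n. f (\<lambda>i. x i + y i) = (\<lambda>i. f x i + f y i)) \<and>
     (\<forall>c. \<forall>x\<in>Cspace n. f (\<lambda>i. c * x i) = (\<lambda>i. c * f x i))"

definition Csubspace :: "nat \<Rightarrow> (nat \<Rightarrow> complex) set \<Rightarrow> bool" where
  "Csubspace n W \<longleftrightarrow>
     W \<subseteq> Cspace n \<and> (\<lambda>_. 0) \<in> W \<and>
     (\<forall>x\<in>W. \<forall>y\<in>W. (\<lambda>i. x i + y i) \<in> W) \<and> (\<forall>c. \<forall>x\<in>W. (\<lambda>i. c * x i) \<in> W)"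

text \<open>
  Irreducible representations of a compact group are finite-dimensional, so it suffices to
  consider representations on C^n.
\<close>

type_synonym 'k rep = "'k \<Rightarrow> (nat \<Rightarrow> complex) \<Rightarrow> (nat \<Rightarrow> complex)"

definition representation :: "'k monoid \<Rightarrow> 'k topology \<Rightarrow> nat \<Rightarrow> 'k rep \<Rightarrow> bool" where
  "representation G T n \<rho> \<longleftrightarrow>
     (\<forall>g\<in>carrier G. Clinear n n (\<rho> g)) \<and>
     (\<forall>x\<in>Cspace n. \<rho> \<one>\<^bsub>G\<^esub> x = x) \<and>
     (\<forall>g\<in>carrier G. \<forall>h\<in>carrier G. \<forall>x\<in>Cspace n. \<rho> (g \<otimes>\<^bsub>G\<^esub> h) x = \<rho> g (\<rho> h x)) \<and>
     continuous_map (prod_topology T (top_of_set (Cspace n))) (top_of_set (Cspace n))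
       (\<lambda>(g, x). \<rho> g x)"

definition irreducible_rep :: "'k monoid \<Rightarrow> 'k topology \<Rightarrow> nat \<Rightarrow> 'k rep \<Rightarrow> bool" where
  "irreducible_rep G T n \<rho> \<longleftrightarrow>
     representation G T n \<rho> \<and> n > 0 \<and>
     (\<forall>W. Csubspace n W \<and> (\<forall>g\<in>carrier G. \<rho> g ` W \<subseteq> W) \<longrightarrow> W = {\<lambda>_. 0} \<or> W = Cspace n)"

definition rep_equiv :: "'k monoid \<Rightarrow> nat \<Rightarrow> 'k rep \<Rightarrow> nat \<Rightarrow> 'k rep \<Rightarrow> bool" where
  "rep_equiv G n \<rho> m \<rho>' \<longleftrightarrow>
     (\<exists>f. Clinear n m f \<and> bij_betw f (Cspace n) (Cspace m) \<and>
        (\<forall>g\<in>carrier G. \<forall>x\<in>Cspace n. f (\<rho> g x) = \<rho>' g (f x)))"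

definition irrep_class :: "'k monoid \<Rightarrow> 'k topology \<Rightarrow> nat \<Rightarrow> 'k rep \<Rightarrow> (nat \<times> 'k rep) set" where
  "irrep_class G T n \<rho> = {(m, \<rho>'). irreducible_rep G T m \<rho>' \<and> rep_equiv G n \<rho> m \<rho>'}"

text \<open>
  The topology on the disjoint union of the duals of the fibres: a local trivialization phi of the
  group bundle over U identifies U x (dual of G) with the part over U via
  (b, [rho]) |-> (b, [rho o phi_b]), and the dual of G is discrete. The sets below are the images
  of the basic open sets V x {[rho]}; their union is the set of all (b, [sigma]) with sigma an
  irreducible representation of the fibre over b.
\<close>

definition dual_bundle ::
  "'k monoid \<Rightarrow> 'k topology \<Rightarrow> ('b::topological_space, 'g) group_family \<Rightarrow>
   ('b \<times> (nat \<times> 'g rep) set) topology" where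
  "dual_bundle G T \<G> = topology_generated_by
     {(\<lambda>b. (b, irrep_class (gfibre \<G> b) (subtopology (gtotal \<G>) {g. gproj \<G> g = b}) n
                 (\<lambda>g. \<rho> (\<phi> g)))) ` V
      | U \<phi> V n \<rho>. group_triv G T \<G> U \<phi> \<and> open V \<and> V \<subseteq> U \<and> irreducible_rep G T n \<rho>}"

definition finite_holonomy ::
  "'k monoid \<Rightarrow> 'k topology \<Rightarrow> ('b::topological_space, 'g) group_family \<Rightarrow> bool" where
  "finite_holonomy G T \<G> \<longleftrightarrow>
     (\<forall>\<sigma> \<in> topspace (dual_bundle G T \<G>).
        \<exists>W. compactin (dual_bundle G T \<G>) W \<and> openin (dual_bundle G T \<G>) W \<and> \<sigma> \<in> W)"


section \<open>Equivariant finite-dimensional vector bundles\<close>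

text \<open>
  The operations are only meaningful fibrewise; the vector space axioms of the fibres follow from
  the existence of fibrewise linear local trivializations.
\<close>

record ('b, 'g, 'e) vbundle =
  vtotal :: "'e topology"
  vproj :: "'e \<Rightarrow> 'b"
  vadd :: "'e \<Rightarrow> 'e \<Rightarrow> 'e"
  vscale :: "complex \<Rightarrow> 'e \<Rightarrow> 'e"
  vact :: "'g \<Rightarrow> 'e \<Rightarrow> 'e"

definition vfibre :: "('b, 'g, 'e, 'z) vbundle_scheme \<Rightarrow> 'b \<Rightarrow> 'e set" where
  "vfibre E b = {x \<in> topspace (vtotal E). vproj E x = b}"

definition fibrewise_linear_action ::
  "('b, 'g) group_family \<Rightarrow> ('b, 'g, 'e, 'z) vbundle_scheme \<Rightarrow> bool" where
  "fibrewise_linear_action \<G> E \<longleftrightarrow> (\<forall>b.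
     (\<forall>x\<in>vfibre E b. \<forall>y\<in>vfibre E b. vadd E x y \<in> vfibre E b) \<and>
     (\<forall>c. \<forall>x\<in>vfibre E b. vscale E c x \<in> vfibre E b) \<and>
     (\<forall>g\<in>carrier (gfibre \<G> b). \<forall>x\<in>vfibre E b. vact E g x \<in> vfibre E b) \<and>
     (\<forall>x\<in>vfibre E b. vact E \<one>\<^bsub>gfibre \<G> b\<^esub> x = x) \<and>
     (\<forall>g\<in>carrier (gfibre \<G> b). \<forall>h\<in>carrier (gfibre \<G> b). \<forall>x\<in>vfibre E b.
        vact E (g \<otimes>\<^bsub>gfibre \<G> b\<^esub> h) x = vact E g (vact E h x)) \<and>
     (\<forall>g\<in>carrier (gfibre \<G> b). \<forall>x\<in>vfibre E b. \<forall>y\<in>vfibre E b.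
        vact E g (vadd E x y) = vadd E (vact E g x) (vact E g y)) \<and>
     (\<forall>g\<in>carrier (gfibre \<G> b). \<forall>c. \<forall>x\<in>vfibre E b.
        vact E g (vscale E c x) = vscale E c (vact E g x)))"

definition vtriv ::
  "('b::topological_space, 'g, 'e, 'z) vbundle_scheme \<Rightarrow> nat \<Rightarrow> 'b set \<Rightarrow> ('e \<Rightarrow> nat \<Rightarrow> complex) \<Rightarrow> bool"
  where
  "vtriv E n U \<phi> \<longleftrightarrow>
     open U \<and>
     homeomorphic_map (subtopology (vtotal E) {x. vproj E x \<in> U})
       (prod_topology (top_of_set U) (top_of_set (Cspace n))) (\<lambda>x. (vproj E x, \<phi> x)) \<and>
     (\<forall>b\<in>U. \<forall>x\<in>vfibre E b. \<forall>y\<in>vfibre E b. \<phi> (vadd E x y) = (\<lambda>i. \<phi> x i + \<phi> y i)) \<and>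
     (\<forall>b\<in>U. \<forall>c. \<forall>x\<in>vfibre E b. \<phi> (vscale E c x) = (\<lambda>i. c * \<phi> x i))"

definition equivariant_vbundle ::
  "('b::topological_space, 'g) group_family \<Rightarrow> ('b, 'g, 'e, 'z) vbundle_scheme \<Rightarrow> bool" where
  "equivariant_vbundle \<G> E \<longleftrightarrow>
     continuous_map (vtotal E) euclidean (vproj E) \<and>
     fibrewise_linear_action \<G> E \<and>
     (\<forall>b. \<exists>n U \<phi>. b \<in> U \<and> vtriv E n U \<phi>) \<and>
     continuous_map
       (subtopology (prod_topology (gtotal \<G>) (vtotal E)) {(g, x). gproj \<G> g = vproj E x})
       (vtotal E) (\<lambda>(g, x). vact E g x)"

definition vbundle_iso ::
  "('b, 'g) group_family \<Rightarrow> ('b, 'g, 'e, 'y) vbundle_scheme \<Rightarrow> ('b, 'g, 'f, 'z) vbundle_scheme \<Rightarrow> bool"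
  where
  "vbundle_iso \<G> E E' \<longleftrightarrow> (\<exists>f.
     homeomorphic_map (vtotal E) (vtotal E') f \<and>
     (\<forall>x\<in>topspace (vtotal E). vproj E' (f x) = vproj E x) \<and>
     (\<forall>b. \<forall>x\<in>vfibre E b. \<forall>y\<in>vfibre E b. f (vadd E x y) = vadd E' (f x) (f y)) \<and>
     (\<forall>b c. \<forall>x\<in>vfibre E b. f (vscale E c x) = vscale E' c (f x)) \<and>
     (\<forall>b. \<forall>g\<in>carrier (gfibre \<G> b). \<forall>x\<in>vfibre E b. f (vact E g x) = vact E' g (f x)))"

definition vsum ::
  "('b, 'g, 'e, 'y) vbundle_scheme \<Rightarrow> ('b, 'g, 'f, 'z) vbundle_scheme \<Rightarrow> ('b, 'g, 'e \<times> 'f) vbundle" where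
  "vsum E E' =
     \<lparr>vtotal = subtopology (prod_topology (vtotal E) (vtotal E')) {(x, y). vproj E x = vproj E' y},
      vproj = (\<lambda>(x, y). vproj E x),
      vadd = (\<lambda>(x, y) (x', y'). (vadd E x x', vadd E' y y')),
      vscale = (\<lambda>c (x, y). (vscale E c x, vscale E' c y)),
      vact = (\<lambda>g (x, y). (vact E g x, vact E' g y))\<rparr>"

definition vzero :: "('b::topological_space, 'g, 'b \<times> (nat \<Rightarrow> complex)) vbundle" where
  "vzero =
     \<lparr>vtotal = top_of_set (UNIV \<times> {\<lambda>_. 0}),
      vproj = fst,
      vadd = (\<lambda>x y. x),
      vscale = (\<lambda>c x. x),
      vact = (\<lambda>g x. x)\<rparr>"

definition subbundle ::
  "('b, 'g, 'e, 'z) vbundle_scheme \<Rightarrow> 'e set \<Rightarrow> ('b, 'g, 'e) vbundle" where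
  "subbundle E K =
     \<lparr>vtotal = subtopology (vtotal E) K, vproj = vproj E, vadd = vadd E, vscale = vscale E,
      vact = vact E\<rparr>"

text \<open>Invariance of K under the group bundle is part of \<^const>\<open>equivariant_vbundle\<close>.\<close>

definition invariant_subbundle ::
  "('b::topological_space, 'g) group_family \<Rightarrow> ('b, 'g, 'e, 'z) vbundle_scheme \<Rightarrow> 'e set \<Rightarrow> bool" where
  "invariant_subbundle \<G> E K \<longleftrightarrow>
     K \<subseteq> topspace (vtotal E) \<and> equivariant_vbundle \<G> (subbundle E K)"


section \<open>The gauge-equivariant K-group\<close>

definition completion_rel :: "('a, 'z) monoid_scheme \<Rightarrow> (('a \<times> 'a) \<times> ('a \<times> 'a)) set" where
  "completion_rel M =
     {((a, b), (c, d)). {a, b, c, d} \<subseteq> carrier M \<and>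
        (\<exists>e\<in>carrier M. a \<otimes>\<^bsub>M\<^esub> d \<otimes>\<^bsub>M\<^esub> e = c \<otimes>\<^bsub>M\<^esub> b \<otimes>\<^bsub>M\<^esub> e)}"

definition group_completion :: "('a, 'z) monoid_scheme \<Rightarrow> ('a \<times> 'a) set monoid" where
  "group_completion M =
     \<lparr>carrier = (carrier M \<times> carrier M) // completion_rel M,
      mult = (\<lambda>X Y. \<Union>(a, b)\<in>X. \<Union>(c, d)\<in>Y. completion_rel M `` {(a \<otimes>\<^bsub>M\<^esub> c, b \<otimes>\<^bsub>M\<^esub> d)}),
      one = completion_rel M `` {(\<one>\<^bsub>M\<^esub>, \<one>\<^bsub>M\<^esub>)}\<rparr>"

definition completion_map :: "('a, 'z) monoid_scheme \<Rightarrow> 'a \<Rightarrow> ('a \<times> 'a) set" where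
  "completion_map M a = completion_rel M `` {(a, \<one>\<^bsub>M\<^esub>)}"

text \<open>
  Isomorphism classes need a fixed universe of total spaces. Every finite-dimensional vector bundle
  over 'b, on whatever total space type, is isomorphic to one whose total space is a subset of
  'b \<times> (nat \<Rightarrow> complex) with some topology (choose a basis in every fibre), so the class of E is
  represented by the bundles of this kind isomorphic to E, and no isomorphism class is lost.
\<close>

type_synonym ('b, 'g) std_vbundle = "('b, 'g, 'b \<times> (nat \<Rightarrow> complex)) vbundle"

definition vbundle_class ::
  "('b::topological_space, 'g) group_family \<Rightarrow> ('b, 'g, 'e, 'z) vbundle_scheme \<Rightarrow>
   ('b, 'g) std_vbundle set" where
  "vbundle_class \<G> E = {V. equivariant_vbundle \<G> V \<and> vbundle_iso \<G> V E}"

definition vbundle_monoid ::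
  "('b::topological_space, 'g) group_family \<Rightarrow> ('b, 'g) std_vbundle set monoid" where
  "vbundle_monoid \<G> =
     \<lparr>carrier = {vbundle_class \<G> (V :: ('b, 'g) std_vbundle) | V. equivariant_vbundle \<G> V},
      mult = (\<lambda>X Y. \<Union>V\<in>X. \<Union>W\<in>Y. vbundle_class \<G> (vsum V W)),
      one = vbundle_class \<G> vzero\<rparr>"

definition K0 ::
  "('b::topological_space, 'g) group_family \<Rightarrow>
   (('b, 'g) std_vbundle set \<times> ('b, 'g) std_vbundle set) set monoid" where
  "K0 \<G> = group_completion (vbundle_monoid \<G>)"

definition K0_class ::
  "('b::topological_space, 'g) group_family \<Rightarrow> ('b, 'g, 'e, 'z) vbundle_scheme \<Rightarrow>
   (('b, 'g) std_vbundle set \<times> ('b, 'g) std_vbundle set) set" where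
  "K0_class \<G> E = completion_map (vbundle_monoid \<G>) (vbundle_class \<G> E)"


section \<open>Bundles of Hilbert spaces\<close>

text \<open>
  Complex Hilbert spaces; the inherited real inner product, which carries norm and topology, is the
  real part of the Hermitian one.
\<close>

class complex_hilbert = real_inner + complete_space +
  fixes cscale :: "complex \<Rightarrow> 'a \<Rightarrow> 'a"
    and cinner :: "'a \<Rightarrow> 'a \<Rightarrow> complex"
  assumes cscale_add_right: "cscale c (x + y) = cscale c x + cscale c y"
    and cscale_add_left: "cscale (c + d) x = cscale c x + cscale d x"
    and cscale_cscale: "cscale c (cscale d x) = cscale (c * d) x"
    and cscale_of_real: "cscale (complex_of_real r) x = r *\<^sub>R x"
    and cinner_add_left: "cinner (x + y) z = cinner x z + cinner y z"
    and cinner_cscale_left: "cinner (cscale c x) y = c * cinner x y"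
    and cinner_commute: "cinner x y = cnj (cinner y x)"
    and Re_cinner: "Re (cinner x y) = inner x y"

text \<open>
  The atlas is part of the structure: norm-continuity of transition functions or of families of
  operators is not determined by the topology of the total space.
\<close>

record ('b, 'g, 'e, 'v) hbundle = "('b, 'g, 'e) vbundle" +
  hinner :: "'e \<Rightarrow> 'e \<Rightarrow> complex"
  hatlas :: "('b set \<times> ('e \<Rightarrow> 'v)) set"

definition htriv ::
  "('b::topological_space, 'g, 'e, 'v::complex_hilbert) hbundle \<Rightarrow> 'b set \<Rightarrow> ('e \<Rightarrow> 'v) \<Rightarrow> bool" where
  "htriv H U \<phi> \<longleftrightarrow>
     open U \<and>
     homeomorphic_map (subtopology (vtotal H) {x. vproj H x \<in> U})
       (prod_topology (top_of_set U) euclidean) (\<lambda>x. (vproj H x, \<phi> x)) \<and>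
     (\<forall>b\<in>U. \<forall>x\<in>vfibre H b. \<forall>y\<in>vfibre H b.
        \<phi> (vadd H x y) = \<phi> x + \<phi> y \<and> hinner H x y = cinner (\<phi> x) (\<phi> y)) \<and>
     (\<forall>b\<in>U. \<forall>c. \<forall>x\<in>vfibre H b. \<phi> (vscale H c x) = cscale c (\<phi> x))"

text \<open>
  Norm-continuity refers to the type of bounded linear operators with the operator norm. The action
  is by unitary operators and strongly continuous in the trivializations, as usual for
  representations on Hilbert spaces.
\<close>

definition hilbert_bundle ::
  "'k monoid \<Rightarrow> 'k topology \<Rightarrow> ('b::topological_space, 'g) group_family \<Rightarrow>
   ('b, 'g, 'e, 'v::complex_hilbert) hbundle \<Rightarrow> bool" where
  "hilbert_bundle G T \<G> H \<longleftrightarrow>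
     continuous_map (vtotal H) euclidean (vproj H) \<and>
     (\<forall>(U, \<phi>)\<in>hatlas H. htriv H U \<phi>) \<and>
     (\<Union>(U, \<phi>)\<in>hatlas H. U) = UNIV \<and>
     (\<forall>(U, \<phi>)\<in>hatlas H. \<forall>(V, \<psi>)\<in>hatlas H.
        continuous_on (U \<inter> V) (\<lambda>b. Blinfun (\<lambda>v. \<psi> (inv_into (vfibre H b) \<phi> v)))) \<and>
     fibrewise_linear_action \<G> H \<and>
     (\<forall>b. \<forall>g\<in>carrier (gfibre \<G> b). \<forall>x\<in>vfibre H b. \<forall>y\<in>vfibre H b.
        hinner H (vact H g x) (vact H g y) = hinner H x y) \<and>
     (\<forall>(U, \<phi>)\<in>hatlas H. \<forall>W \<theta>. group_triv G T \<G> W \<theta> \<longrightarrow>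
        continuous_map (prod_topology (top_of_set (U \<inter> W)) (prod_topology T euclidean)) euclidean
          (\<lambda>(b, k, v). \<phi> (vact H (inv_into (carrier (gfibre \<G> b)) \<theta> k) (inv_into (vfibre H b) \<phi> v))))"


section \<open>Families of invariant Fredholm operators and their index\<close>

text \<open>
  A space is finite-dimensional iff it is contained in the real span of a finite set, over the
  reals as well as over the complex numbers.
\<close>

definition fredholm :: "('v::complex_hilbert \<Rightarrow> 'w::complex_hilbert) \<Rightarrow> bool" where
  "fredholm A \<longleftrightarrow>
     bounded_linear A \<and> (\<forall>c v. A (cscale c v) = cscale c (A v)) \<and>
     closed (range A) \<and>
     (\<exists>S. finite S \<and> {v. A v = 0} \<subseteq> span S) \<and>
     (\<exists>S. finite S \<and> (\<forall>w. \<exists>v. \<exists>s\<in>span S. w = A v + s))"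

definition fredholm_family ::
  "('b::topological_space, 'g) group_family \<Rightarrow> ('b, 'g, 'e, 'v::complex_hilbert) hbundle \<Rightarrow>
   ('b, 'g, 'f, 'w::complex_hilbert) hbundle \<Rightarrow> ('e \<Rightarrow> 'f) \<Rightarrow> bool" where
  "fredholm_family \<G> H\<^sub>0 H\<^sub>1 F \<longleftrightarrow>
     (\<forall>b. F ` vfibre H\<^sub>0 b \<subseteq> vfibre H\<^sub>1 b) \<and>
     (\<forall>b. \<forall>g\<in>carrier (gfibre \<G> b). \<forall>x\<in>vfibre H\<^sub>0 b. F (vact H\<^sub>0 g x) = vact H\<^sub>1 g (F x)) \<and>
     (\<forall>(U, \<phi>)\<in>hatlas H\<^sub>0. \<forall>(V, \<psi>)\<in>hatlas H\<^sub>1.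
        (\<forall>b\<in>U \<inter> V. fredholm (\<lambda>v. \<psi> (F (inv_into (vfibre H\<^sub>0 b) \<phi> v)))) \<and>
        continuous_on (U \<inter> V) (\<lambda>b. Blinfun (\<lambda>v. \<psi> (F (inv_into (vfibre H\<^sub>0 b) \<phi> v)))))"

definition fibre_perp :: "('b, 'g, 'e, 'v) hbundle \<Rightarrow> 'b \<Rightarrow> 'e set \<Rightarrow> 'e set" where
  "fibre_perp H b S = {x \<in> vfibre H b. \<forall>y\<in>S. hinner H x y = 0}"

text \<open>f is an isomorphism from the invariant subspace S of E_b onto the invariant subspace S' of E'_b.\<close>

definition fibre_iso ::
  "('b, 'g) group_family \<Rightarrow> ('b, 'g, 'e, 'y) vbundle_scheme \<Rightarrow> ('b, 'g, 'f, 'z) vbundle_scheme \<Rightarrow>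
   'b \<Rightarrow> 'e set \<Rightarrow> 'f set \<Rightarrow> ('e \<Rightarrow> 'f) \<Rightarrow> bool" where
  "fibre_iso \<G> E E' b S S' f \<longleftrightarrow>
     S \<subseteq> vfibre E b \<and> S' \<subseteq> vfibre E' b \<and>
     (\<forall>g\<in>carrier (gfibre \<G> b). vact E g ` S \<subseteq> S \<and> vact E' g ` S' \<subseteq> S') \<and>
     homeomorphic_map (subtopology (vtotal E) S) (subtopology (vtotal E') S') f \<and>
     (\<forall>x\<in>S. \<forall>y\<in>S. f (vadd E x y) = vadd E' (f x) (f y)) \<and>
     (\<forall>c. \<forall>x\<in>S. f (vscale E c x) = vscale E' c (f x)) \<and>
     (\<forall>g\<in>carrier (gfibre \<G> b). \<forall>x\<in>S. f (vact E g x) = vact E' g (f x))"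

definition ker_perp :: "('b, 'g, 'e, 'v) hbundle \<Rightarrow> 'e set \<Rightarrow> 'b \<Rightarrow> 'e set" where
  "ker_perp H K b = fibre_perp H b (K \<inter> vfibre H b)"

definition COK ::
  "('b, 'g, 'e, 'v) hbundle \<Rightarrow> ('b, 'g, 'f, 'w) hbundle \<Rightarrow> ('e \<Rightarrow> 'f) \<Rightarrow> 'e set \<Rightarrow> 'f set" where
  "COK H\<^sub>0 H\<^sub>1 F K = (\<Union>b. fibre_perp H\<^sub>1 b (F ` ker_perp H\<^sub>0 K b))"

definition admissible_KER ::
  "('b::topological_space, 'g) group_family \<Rightarrow> ('b, 'g, 'e, 'v) hbundle \<Rightarrow>
   ('b, 'g, 'f, 'w) hbundle \<Rightarrow> ('e \<Rightarrow> 'f) \<Rightarrow> 'e set \<Rightarrow> bool" where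
  "admissible_KER \<G> H\<^sub>0 H\<^sub>1 F K \<longleftrightarrow>
     invariant_subbundle \<G> H\<^sub>0 K \<and>
     (\<forall>b. fibre_iso \<G> H\<^sub>0 H\<^sub>1 b (ker_perp H\<^sub>0 K b) (F ` ker_perp H\<^sub>0 K b) F) \<and>
     invariant_subbundle \<G> H\<^sub>1 (COK H\<^sub>0 H\<^sub>1 F K)"

definition gauge_index ::
  "('b::topological_space, 'g) group_family \<Rightarrow> ('b, 'g, 'e, 'v) hbundle \<Rightarrow>
   ('b, 'g, 'f, 'w) hbundle \<Rightarrow> ('e \<Rightarrow> 'f) \<Rightarrow> 'e set \<Rightarrow>
   (('b, 'g) std_vbundle set \<times> ('b, 'g) std_vbundle set) set" where
  "gauge_index \<G> H\<^sub>0 H\<^sub>1 F K =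
     K0_class \<G> (subbundle H\<^sub>0 K) \<otimes>\<^bsub>K0 \<G>\<^esub>
     inv\<^bsub>K0 \<G>\<^esub> (K0_class \<G> (subbundle H\<^sub>1 (COK H\<^sub>0 H\<^sub>1 F K)))"

end

theory Submission
  imports Defs
begin

text \<open>
  Let K, K' be two admissible kernel bundles with cokernel bundles C, C'. In every fibre consider the
  space S of triples (x, d, e) with d in C', e in C and F x = d + e. As F maps the orthogonal
  complement of K isomorphically onto the orthogonal complement of C, a triple in S is determined by
  d and the orthogonal projection of x to K, and both can be prescribed: S is isomorphic to the sum of
  K and C'. Exchanging the roles of (K, C) and (K', C'), it is also isomorphic to the sum of K' and C.
  Hence these two sums are isomorphic, which is the equality of the two indices. No bundle containing
  both K and K' is needed. The isomorphism is equivariant, because the action is unitary; it is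
  continuous, because in a trivialization the fibres of a finite-dimensional sub-bundle vary
  continuously, so that F is bounded below on the complements of K locally uniformly.
\<close>

section \<open>Subspaces of inner product spaces\<close>

text \<open>The fibres of K and K' may meet in spaces of varying dimension, so their sum need not be
  a bundle; the triples never refer to the intersection. In coordinates the correspondence is
  triangular. Given k in K and d in C', the vector e is the projection of F k - d to C; then z in
  the complement of K solves F z = d + e - F k; finally k' is the projection of x = k + z to K'.
  Existence, uniqueness and continuity of (k', e) are all obtained through these three equations.
  The sign in F x = d + e, instead of a difference, makes the relation between (k, d) and (k', e)
  symmetric under exchange of K and K'. Hence the inverse map is another instance of the same
  construction, and continuity has to be proved only once. A sub-bundle is given as a subspace of
  the total space with some local trivialization, without any norm estimate. The estimates come from
  one principle: a continuous homogeneous map is bounded. It is applied to the fibre coordinates of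
  K, and to the inverse of F on the complement of K, which is continuous by condition (1).\<close>

definition is_proj :: "'a::real_inner set \<Rightarrow> 'a \<Rightarrow> 'a \<Rightarrow> bool" where
  "is_proj S v p \<longleftrightarrow> p \<in> S \<and> (\<forall>s\<in>S. inner (v - p) s = 0)"

lemma is_proj_unique:
  assumes "subspace S" "is_proj S v p" "is_proj S v q"
  shows "p = q"
proof -
  have pq: "p - q \<in> S"
    using assms by (simp add: is_proj_def subspace_diff)
  have "inner (p - q) (p - q) = inner (v - q) (p - q) - inner (v - p) (p - q)"
    by (simp add: inner_diff_left)
  also have "\<dots> = 0"
    using assms pq by (simp add: is_proj_def)
  finally show ?thesis by simp
qed

text \<open>Gram-Schmidt: the residue \<open>a'\<close> of the new vector is orthogonal to the old
  span, so the projection only gains the component of \<open>v\<close> along \<open>a'\<close>. If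
  the residue vanishes, the span does not grow.\<close>

lemma finite_span_is_proj:
  fixes S :: "'a::real_inner set"
  assumes "finite S"
  shows "\<exists>p. is_proj (span S) v p"
  using assms
proof (induction S arbitrary: v)
  case empty
  then show ?case by (auto simp: is_proj_def)
next
  case (insert a S)
  obtain p where p: "p \<in> span S" "\<And>s. s \<in> span S \<Longrightarrow> inner (v - p) s = 0"
    using insert.IH[of v] unfolding is_proj_def by blast
  obtain q where q: "q \<in> span S" "\<And>s. s \<in> span S \<Longrightarrow> inner (a - q) s = 0"
    using insert.IH[of a] unfolding is_proj_def by blast
  show ?case
  proof (cases "a = q")
    case True
    then have "span (insert a S) = span S"
      using q span_redundant by blast
    then show ?thesis using p unfolding is_proj_def by auto
  next
    case False
    define a' where "a' = a - q"
    define k where "k = inner v a' / inner a' a'"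
    have a'0: "inner a' a' \<noteq> 0" using False by (simp add: a'_def)
    have a'S: "inner a' s = 0" "inner s a' = 0" if "s \<in> span S" for s
      using q(2)[OF that] by (simp_all add: a'_def inner_commute)
    have sub: "span S \<subseteq> span (insert a S)" by (rule span_mono) auto
    have a'in: "a' \<in> span (insert a S)"
      unfolding a'_def using sub q(1) by (auto intro: span_diff span_base)
    have "p + k *\<^sub>R a' \<in> span (insert a S)"
      using sub p(1) a'in by (auto intro: span_add span_scale)
    moreover have "inner (v - (p + k *\<^sub>R a')) s = 0" if sin: "s \<in> span (insert a S)" for s
    proof -
      obtain c where c: "s - c *\<^sub>R a \<in> span S"
        using iffD1[OF span_breakdown_eq sin] by blast
      define t where "t = s - c *\<^sub>R a + c *\<^sub>R q"
      have t: "t \<in> span S" unfolding t_def using c q(1) by (auto intro: span_add span_scale)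
      have s: "s = t + c *\<^sub>R a'" by (simp add: t_def a'_def algebra_simps)
      have "inner (v - (p + k *\<^sub>R a')) t = 0"
        using p(2)[OF t] a'S[OF t] by (simp add: algebra_simps inner_diff_left inner_add_left)
      moreover have "inner (v - (p + k *\<^sub>R a')) a' = 0"
        using a'S[OF p(1)] a'0 by (simp add: inner_diff_left inner_add_left k_def)
      ultimately show ?thesis by (simp add: s inner_add_right)
    qed
    ultimately show ?thesis unfolding is_proj_def by blast
  qed
qed

text \<open>The point of \<open>S\<close> nearest to \<open>v\<close> exists because a minimizing
  sequence is Cauchy by the parallelogram law; minimality along each line in \<open>S\<close> gives
  orthogonality. This version serves the image of F, which has infinite dimension in
  general.\<close>

lemma closed_subspace_is_proj:
  fixes S :: "'a::{real_inner, complete_space} set"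
  assumes S: "subspace S" and cl: "closed S"
  shows "\<exists>p. is_proj S v p"
proof -
  define d where "d = infdist v S"
  have ne: "S \<noteq> {}" using S subspace_0 by blast
  have d0: "d \<ge> 0" by (simp add: d_def infdist_nonneg)
  have dle: "d \<le> norm (v - s)" if "s \<in> S" for s
    using infdist_le[OF that, of v] by (simp add: d_def dist_norm)
  \<comment> \<open>The error is measured on squared norms, the form in which the parallelogram law
    consumes it.\<close>
  have "\<exists>s\<in>S. (norm (v - s))\<^sup>2 < d\<^sup>2 + inverse (real (Suc n))" for n
  proof -
    have "d < sqrt (d\<^sup>2 + inverse (real (Suc n)))"
      using d0 by (intro real_less_rsqrt) simp
    then obtain s where "s \<in> S" "dist v s < sqrt (d\<^sup>2 + inverse (real (Suc n)))"
      using ne cINF_less_iff[of S "dist v"] unfolding d_def infdist_def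
      by (auto simp: bdd_below_def intro: zero_le_dist)
    moreover from this have "(norm (v - s))\<^sup>2 < (sqrt (d\<^sup>2 + inverse (real (Suc n))))\<^sup>2"
      by (intro power_strict_mono) (auto simp: dist_norm)
    ultimately show ?thesis by (auto simp: add_nonneg_nonneg)
  qed
  then obtain s where sS: "\<And>n. s n \<in> S"
    and s: "\<And>n. (norm (v - s n))\<^sup>2 < d\<^sup>2 + inverse (real (Suc n))" by metis
  \<comment> \<open>The midpoint of \<open>s m\<close> and \<open>s n\<close> lies in
    \<open>S\<close>, so its distance from \<open>v\<close> is at least \<open>d\<close>; the terms
    with \<open>d\<close> squared cancel in the parallelogram law.\<close>
  have par: "(norm (s m - s n))\<^sup>2 \<le> 2 * inverse (real (Suc m)) + 2 * inverse (real (Suc n))" for m n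
  proof -
    have "(1/2) *\<^sub>R (s m + s n) \<in> S" using S sS by (intro subspace_scale subspace_add)
    then have "d\<^sup>2 \<le> (norm (v - (1/2) *\<^sub>R (s m + s n)))\<^sup>2"
      using dle d0 by (intro power_mono) auto
    moreover have "(norm (s m - s n))\<^sup>2 = 2 * (norm (v - s m))\<^sup>2 + 2 * (norm (v - s n))\<^sup>2
        - 4 * (norm (v - (1/2) *\<^sub>R (s m + s n)))\<^sup>2"
      by (simp add: power2_norm_eq_inner algebra_simps inner_diff_left inner_diff_right
          inner_add_left inner_add_right inner_commute)
    ultimately show ?thesis using s[of m] s[of n] by linarith
  qed
  have "Cauchy s"
  proof (rule metric_CauchyI)
    fix e :: real assume e: "e > 0"
    obtain N where N: "inverse (real (Suc N)) < e\<^sup>2 / 4"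
      using reals_Archimedean[of "e\<^sup>2 / 4"] e by auto
    have "dist (s m) (s n) < e" if "m \<ge> N" "n \<ge> N" for m n
    proof -
      have "inverse (real (Suc m)) \<le> inverse (real (Suc N))"
        "inverse (real (Suc n)) \<le> inverse (real (Suc N))"
        using that by (auto intro: le_imp_inverse_le)
      then have "(norm (s m - s n))\<^sup>2 < e\<^sup>2" using par[of m n] N by linarith
      then show ?thesis using e by (simp add: dist_norm power_less_imp_less_base)
    qed
    then show "\<exists>N. \<forall>m\<ge>N. \<forall>n\<ge>N. dist (s m) (s n) < e" by blast
  qed
  then obtain p where p: "s \<longlonglongrightarrow> p" using Cauchy_convergent convergent_def by blast
  have pS: "p \<in> S" using cl sS p closed_sequentially by blast
  have "(norm (v - p))\<^sup>2 \<le> d\<^sup>2"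
  proof (rule LIMSEQ_le)
    show "(\<lambda>n. (norm (v - s n))\<^sup>2) \<longlonglongrightarrow> (norm (v - p))\<^sup>2" by (intro tendsto_intros p)
    show "(\<lambda>n. d\<^sup>2 + inverse (real (Suc n))) \<longlonglongrightarrow> d\<^sup>2"
      using tendsto_add[OF tendsto_const LIMSEQ_inverse_real_of_nat] by simp
  qed (use s in \<open>auto intro: less_imp_le\<close>)
  then have pd: "norm (v - p) \<le> norm (v - t)" if "t \<in> S" for t
    using dle[OF that] d0 by (meson order_trans power2_le_imp_le)
  have "inner (v - p) t = 0" if t: "t \<in> S" for t
  proof (cases "t = 0")
    case False
    \<comment> \<open>The minimizer of the quadratic function sending \<open>k\<close> to the
      squared norm of \<open>v - p - k t\<close>.\<close>
    define k where "k = inner (v - p) t / inner t t"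
    have tt: "inner t t > 0" using False by simp
    have "p + k *\<^sub>R t \<in> S" using S pS t by (intro subspace_add subspace_scale)
    from pd[OF this] have "(norm (v - p))\<^sup>2 \<le> (norm (v - p - k *\<^sub>R t))\<^sup>2"
      by (simp add: diff_diff_eq power_mono)
    also have "\<dots> = (norm (v - p))\<^sup>2 - (inner (v - p) t)\<^sup>2 / inner t t"
    proof -
      have "(norm (w - k *\<^sub>R t))\<^sup>2 = (norm w)\<^sup>2 - 2 * k * inner w t + k * k * inner t t" for w
        by (simp add: power2_norm_eq_inner algebra_simps inner_diff_left inner_diff_right inner_commute)
      moreover have kt: "k * inner t t = inner (v - p) t" using tt by (simp add: k_def)
      moreover have "(inner (v - p) t)\<^sup>2 / inner t t = k * inner (v - p) t"
        by (simp add: k_def power2_eq_square)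
      moreover have "k * k * inner t t = k * inner (v - p) t" by (simp only: mult.assoc kt)
      ultimately show ?thesis by simp
    qed
    finally have "(inner (v - p) t)\<^sup>2 / inner t t \<le> 0" by simp
    then show ?thesis using tt by (simp add: divide_le_0_iff)
  qed simp
  then show ?thesis using pS unfolding is_proj_def by blast
qed

text \<open>Continuity at 0 bounds \<open>f\<close> on a small ball, and homogeneity spreads this
  bound over \<open>S\<close>. Additivity does not enter, so the lemma applies to maps built from
  inverse charts as soon as scaling is checked.\<close>

lemma continuous_homogeneous_bound:
  fixes f :: "'a::real_normed_vector \<Rightarrow> 'c::real_normed_vector"
  assumes cont: "continuous_on S f" and S: "subspace S"
    and hom: "\<And>r x. x \<in> S \<Longrightarrow> f (r *\<^sub>R x) = r *\<^sub>R f x"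
  obtains M where "M > 0" "\<And>x. x \<in> S \<Longrightarrow> norm (f x) \<le> M * norm x"
proof -
  have S0: "0 \<in> S" using S subspace_0 by blast
  have f0: "f 0 = 0" using hom[OF S0, of 0] by simp
  obtain \<delta> where \<delta>: "\<delta> > 0" "\<And>x. x \<in> S \<Longrightarrow> norm x < \<delta> \<Longrightarrow> norm (f x) < 1"
    using cont S0 unfolding continuous_on_iff by (metis dist_0_norm dist_commute f0 zero_less_one)
  have "norm (f x) \<le> (2 / \<delta>) * norm x" if x: "x \<in> S" for x
  proof (cases "x = 0")
    case False
    \<comment> \<open>Scales \<open>x\<close> to norm \<open>\<delta> / 2\<close>, strictly inside
      the ball; this is the source of the factor \<open>2 / \<delta>\<close>.\<close>
    define r where "r = \<delta> / (2 * norm x)"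
    have r: "r > 0" using \<delta> False by (simp add: r_def)
    have "norm (r *\<^sub>R x) < \<delta>" using \<delta> False by (simp add: r_def)
    then have "norm (r *\<^sub>R f x) < 1"
      using \<delta>(2)[of "r *\<^sub>R x"] S x hom[OF x] by (simp add: subspace_scale)
    then have "r * norm (f x) < 1" using r by simp
    then show ?thesis using \<delta> False by (simp add: r_def field_simps)
  qed (simp add: f0)
  then show ?thesis using that[of "2 / \<delta>"] \<delta> by simp
qed


section \<open>Continuous families of subspaces\<close>

text \<open>Convergence of \<open>K b\<close> to \<open>K b0\<close> in the gap sense: each of the
  two spaces is approximated by the other with an error relative to the norm. Both directions are
  used, since convergence of projections compares vectors of \<open>K b\<close> and of
  \<open>K b0\<close> with each other. Existence of projections to \<open>K b0\<close> is the trace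
  of finite dimension that survives in this notion.\<close>

definition continuous_subspaces_at ::
  "('b::topological_space \<Rightarrow> 'v::real_inner set) \<Rightarrow> 'b \<Rightarrow> bool" where
  "continuous_subspaces_at K b0 \<longleftrightarrow>
     (\<forall>\<^sub>F b in nhds b0. subspace (K b)) \<and> (\<forall>v. \<exists>p. is_proj (K b0) v p) \<and>
     (\<forall>\<epsilon>>0. \<forall>\<^sub>F b in nhds b0.
        (\<forall>k\<in>K b0. \<exists>k'\<in>K b. norm (k - k') \<le> \<epsilon> * norm k) \<and>
        (\<forall>k'\<in>K b. \<exists>k\<in>K b0. norm (k' - k) \<le> \<epsilon> * norm k'))"

text \<open>Limits will be taken over points of a total space; \<open>\<beta>\<close> is then their
  projection to the base.\<close>

lemma continuous_subspaces_atD: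
  assumes "continuous_subspaces_at K b0" "(\<beta> \<longlongrightarrow> b0) Fl" "\<epsilon> > 0"
  shows "\<forall>\<^sub>F x in Fl. subspace (K (\<beta> x)) \<and>
        (\<forall>k\<in>K b0. \<exists>k'\<in>K (\<beta> x). norm (k - k') \<le> \<epsilon> * norm k) \<and>
        (\<forall>k'\<in>K (\<beta> x). \<exists>k\<in>K b0. norm (k' - k) \<le> \<epsilon> * norm k')"
proof -
  have "\<forall>\<^sub>F b in nhds b0. subspace (K b) \<and>
        (\<forall>k\<in>K b0. \<exists>k'\<in>K b. norm (k - k') \<le> \<epsilon> * norm k) \<and>
        (\<forall>k'\<in>K b. \<exists>k\<in>K b0. norm (k' - k) \<le> \<epsilon> * norm k')"
    using assms(1,3) unfolding continuous_subspaces_at_def by (auto intro: eventually_conj)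
  then show ?thesis using assms(2) by (auto simp: filterlim_iff)
qed

text \<open>The limit \<open>p0\<close> is approximated by some \<open>k'\<close> in the moving
  space, so that \<open>q = p x - k'\<close> lies there and is orthogonal to the residue of
  \<open>v x\<close>. The residue \<open>r\<close> of \<open>v0\<close> is almost orthogonal to
  \<open>q\<close>, because \<open>q\<close> is close to a vector of \<open>K b0\<close>. Hence
  \<open>inner q q\<close> is a small multiple of \<open>norm q\<close>.\<close>

lemma tendsto_is_proj:
  fixes K :: "'b::topological_space \<Rightarrow> 'v::real_inner set"
  assumes K: "continuous_subspaces_at K b0"
    and \<beta>: "(\<beta> \<longlongrightarrow> b0) Fl" and v: "(v \<longlongrightarrow> v0) Fl"
    and p: "\<forall>\<^sub>F x in Fl. is_proj (K (\<beta> x)) (v x) (p x)"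
    and p0: "is_proj (K b0) v0 p0"
  shows "(p \<longlongrightarrow> p0) Fl"
proof (rule tendstoI)
  fix t :: real assume t: "t > 0"
  define r where "r = v0 - p0"
  \<comment> \<open>The total error contains \<open>\<epsilon> * norm p0\<close> twice, once in the
    bound for \<open>q\<close> and once for \<open>p0 - k'\<close>, and
    \<open>\<epsilon> * norm r\<close> once. The summand 1 keeps the denominator positive and the
    final inequality strict.\<close>
  define \<epsilon> where "\<epsilon> = t / (2 * (2 * norm p0 + norm r + 1))"
  have den: "2 * norm p0 + norm r + 1 > 0" by (smt (verit) norm_ge_zero)
  have \<epsilon>: "\<epsilon> > 0" using t den by (simp add: \<epsilon>_def)
  have \<epsilon>le: "2 * \<epsilon> * norm p0 + \<epsilon> * norm r < t / 2"
  proof -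
    have "\<epsilon> * (2 * norm p0 + norm r + 1) = t / 2"
      using den by (simp add: \<epsilon>_def field_simps)
    then show ?thesis using \<epsilon> by (simp add: algebra_simps)
  qed
  have ev: "\<forall>\<^sub>F x in Fl. dist (v x) v0 < t / 2" using v t by (intro tendstoD) auto
  show "\<forall>\<^sub>F x in Fl. dist (p x) p0 < t"
    using continuous_subspaces_atD[OF K \<beta> \<epsilon>] ev p
  proof eventually_elim
    case (elim x)
    have p0K: "p0 \<in> K b0" and px: "p x \<in> K (\<beta> x)"
      using p0 elim(3) by (auto simp: is_proj_def)
    obtain k' where k': "k' \<in> K (\<beta> x)" "norm (p0 - k') \<le> \<epsilon> * norm p0"
      using elim(1) p0K by blast
    define q where "q = p x - k'"
    have qK: "q \<in> K (\<beta> x)" unfolding q_def using elim(1) px k'(1) by (intro subspace_diff) auto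
    obtain q' where q': "q' \<in> K b0" "norm (q - q') \<le> \<epsilon> * norm q" using elim(1) qK by blast
    have rq': "inner r q' = 0" using p0 q'(1) by (simp add: is_proj_def r_def)
    have "inner (v x - p x) q = 0" using elim(3) qK by (simp add: is_proj_def)
    \<comment> \<open>In the first factor \<open>p x\<close> may be replaced by \<open>v x\<close>,
      and \<open>inner r q\<close> equals \<open>inner r (q - q')\<close>.\<close>
    then have "inner q q = inner (v x - v0) q + inner (p0 - k') q + inner r (q - q')"
      using rq' by (simp add: q_def r_def inner_diff_left inner_diff_right inner_add_left)
    also have "\<dots> \<le> norm (v x - v0) * norm q + norm (p0 - k') * norm q + norm r * norm (q - q')"
      by (intro add_mono norm_cauchy_schwarz)
    also have "\<dots> \<le> norm (v x - v0) * norm q + (\<epsilon> * norm p0) * norm q + norm r * (\<epsilon> * norm q)"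
      using k'(2) q'(2) by (intro add_mono mult_right_mono mult_left_mono) auto
    also have "\<dots> = (norm (v x - v0) + \<epsilon> * norm p0 + \<epsilon> * norm r) * norm q"
      by (simp add: algebra_simps)
    finally have qq: "norm q * norm q \<le> (norm (v x - v0) + \<epsilon> * norm p0 + \<epsilon> * norm r) * norm q"
      by (simp add: power2_norm_eq_inner[symmetric] power2_eq_square)
    have "norm q \<le> norm (v x - v0) + \<epsilon> * norm p0 + \<epsilon> * norm r"
      using qq \<epsilon> by (cases "q = 0") auto
    moreover have "norm (p x - p0) \<le> norm q + norm (p0 - k')"
      using norm_triangle_ineq4[of q "p0 - k'"] by (simp add: q_def)
    ultimately show ?case using elim(2) k'(2) \<epsilon>le by (simp add: dist_norm)
  qed
qed

text \<open>Solutions in moving complements converge, although the lower bound for the operator is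
  assumed only at \<open>b0\<close>. The difference \<open>y\<close> of the solutions is in general
  not orthogonal to \<open>K b0\<close>. Its component \<open>k\<close> in \<open>K b0\<close> is
  small since \<open>z x\<close> is orthogonal to a space close to \<open>K b0\<close>; the lower
  bound controls the rest \<open>y'\<close>. Nothing is known about the size of \<open>z x\<close>
  beforehand, so errors proportional to it are absorbed at the end.\<close>

lemma tendsto_solution:
  fixes K :: "'b::topological_space \<Rightarrow> 'v::real_inner set"
    and A :: "'b \<Rightarrow> 'v \<Rightarrow>\<^sub>L 'w::real_normed_vector"
  assumes K: "continuous_subspaces_at K b0"
    and \<beta>: "(\<beta> \<longlongrightarrow> b0) Fl" and A: "((\<lambda>x. A (\<beta> x)) \<longlongrightarrow> A b0) Fl"
    and m: "m > 0" "\<And>y. y \<in> (K b0)\<^sup>\<bottom> \<Longrightarrow> m * norm y \<le> norm (A b0 y)"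
    and z: "\<forall>\<^sub>F x in Fl. z x \<in> (K (\<beta> x))\<^sup>\<bottom>" and z0: "z0 \<in> (K b0)\<^sup>\<bottom>"
    and Az: "((\<lambda>x. A (\<beta> x) (z x)) \<longlongrightarrow> A b0 z0) Fl"
  shows "(z \<longlongrightarrow> z0) Fl"
proof (rule tendstoI)
  fix t :: real assume t: "t > 0"
  define N where "N = norm z0 + 1"
  have N: "N > 0" "norm z0 < N" by (auto simp: N_def add_nonneg_pos)
  \<comment> \<open>The error \<open>\<theta> * norm (z x)\<close> will occur twice, hence the final
    division by 2. With \<open>norm (z x) \<le> norm y + N\<close>, the first bound lets the part
    with \<open>norm y\<close> be absorbed into \<open>m * norm y\<close>, and the second keeps the
    part with \<open>N\<close> below \<open>m * t / 8\<close>.\<close>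
  define \<theta> where "\<theta> = min (m / 4) (m * t / (8 * N)) / 2"
  have \<theta>: "\<theta> > 0" using m t N by (simp add: \<theta>_def)
  have \<theta>1: "2 * \<theta> \<le> m / 4" and \<theta>2: "2 * \<theta> * N \<le> m * t / 8"
  proof -
    show "2 * \<theta> \<le> m / 4" by (simp add: \<theta>_def)
    have "2 * \<theta> \<le> m * t / (8 * N)" by (simp add: \<theta>_def)
    then show "2 * \<theta> * N \<le> m * t / 8" using N by (simp add: field_simps)
  qed
  \<comment> \<open>\<open>norm k\<close> enters the final estimate with the factor
    \<open>m + norm (A b0)\<close>: once as a part of \<open>y\<close>, once through
    \<open>A b0 k\<close>.\<close>
  define \<epsilon> where "\<epsilon> = \<theta> / (m + norm (A b0) + 1)"
  have den: "m + norm (A b0) + 1 > 0" using m by (simp add: add_pos_nonneg)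
  have \<epsilon>: "\<epsilon> > 0" using \<theta> den by (simp add: \<epsilon>_def)
  have \<epsilon>\<theta>: "(m + norm (A b0)) * \<epsilon> \<le> \<theta>"
  proof -
    have "(m + norm (A b0) + 1) * \<epsilon> = \<theta>" using den by (simp add: \<epsilon>_def field_simps)
    then show ?thesis using \<epsilon> by (simp add: algebra_simps)
  qed
  have ev1: "\<forall>\<^sub>F x in Fl. dist (A (\<beta> x)) (A b0) < \<theta>" using A \<theta> by (intro tendstoD) auto
  have ev2: "\<forall>\<^sub>F x in Fl. dist (A (\<beta> x) (z x)) (A b0 z0) < m * t / 8"
    using Az m t by (intro tendstoD) auto
  show "\<forall>\<^sub>F x in Fl. dist (z x) z0 < t"
    using continuous_subspaces_atD[OF K \<beta> \<epsilon>] ev1 ev2 z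
  proof eventually_elim
    case (elim x)
    define y where "y = z x - z0"
    obtain k where k: "k \<in> K b0" and ky: "\<And>s. s \<in> K b0 \<Longrightarrow> inner (y - k) s = 0"
      using K unfolding continuous_subspaces_at_def is_proj_def by blast
    define y' where "y' = y - k"
    have y': "y' \<in> (K b0)\<^sup>\<bottom>" using ky
      by (auto simp: y'_def orthogonal_comp_def orthogonal_def inner_commute)
    obtain k' where k': "k' \<in> K (\<beta> x)" "norm (k - k') \<le> \<epsilon> * norm k" using elim(1) k by blast
    have "inner (z x) k' = 0" "inner z0 k = 0"
      using elim(4) k' k z0 by (auto simp: orthogonal_comp_def orthogonal_def inner_commute)
    \<comment> \<open>As \<open>y - k\<close> is orthogonal to \<open>k\<close>, the left side is
      \<open>inner y k\<close>; \<open>z0\<close> is orthogonal to \<open>k\<close> and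
      \<open>z x\<close> to \<open>k'\<close>.\<close>
    then have "inner k k = inner (z x) (k - k')"
      using ky[OF k] by (simp add: y_def inner_diff_left inner_diff_right)
    also have "\<dots> \<le> norm (z x) * norm (k - k')" by (rule norm_cauchy_schwarz)
    also have "\<dots> \<le> norm (z x) * (\<epsilon> * norm k)" using k'(2) by (intro mult_left_mono) auto
    finally have kk: "norm k * norm k \<le> (\<epsilon> * norm (z x)) * norm k"
      by (simp add: power2_norm_eq_inner[symmetric] power2_eq_square algebra_simps)
    have kz: "norm k \<le> \<epsilon> * norm (z x)" using kk \<epsilon> by (cases "k = 0") auto
    have zN: "norm (z x) \<le> norm y + N"
      using norm_triangle_ineq[of y z0] N by (simp add: y_def)
    have "A b0 y' = (A b0 - A (\<beta> x)) (z x) + (A (\<beta> x) (z x) - A b0 z0) - A b0 k"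
      by (simp add: y'_def y_def blinfun.diff_right blinfun.diff_left)
    then have "norm (A b0 y') \<le> norm ((A b0 - A (\<beta> x)) (z x)) + norm (A (\<beta> x) (z x) - A b0 z0)
        + norm (A b0 k)"
      by (metis norm_triangle_ineq norm_triangle_ineq4 add_right_mono order_trans)
    also have "\<dots> \<le> \<theta> * norm (z x) + m * t / 8 + norm (A b0) * norm k"
    proof (intro add_mono)
      have "norm ((A b0 - A (\<beta> x)) (z x)) \<le> norm (A b0 - A (\<beta> x)) * norm (z x)"
        by (rule norm_blinfun)
      also have "\<dots> \<le> \<theta> * norm (z x)"
        using elim(2) by (intro mult_right_mono) (auto simp: dist_norm norm_minus_commute)
      finally show "norm ((A b0 - A (\<beta> x)) (z x)) \<le> \<theta> * norm (z x)" .
      show "norm (A (\<beta> x) (z x) - A b0 z0) \<le> m * t / 8" using elim(3) by (simp add: dist_norm)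
    qed (rule norm_blinfun)
    finally have Ay': "m * norm y' \<le> \<theta> * norm (z x) + m * t / 8 + norm (A b0) * norm k"
      using m(2)[OF y'] by linarith
    have "m * norm y \<le> m * (norm k + norm y')"
      using m(1) norm_triangle_ineq[of k y'] by (intro mult_left_mono) (auto simp: y'_def)
    also have "\<dots> \<le> (m + norm (A b0)) * norm k + \<theta> * norm (z x) + m * t / 8"
      using Ay' by (simp add: algebra_simps)
    also have "(m + norm (A b0)) * norm k \<le> (m + norm (A b0)) * (\<epsilon> * norm (z x))"
      using kz m(1) by (intro mult_left_mono) auto
    also have "(m + norm (A b0)) * (\<epsilon> * norm (z x)) \<le> \<theta> * norm (z x)"
      using mult_right_mono[OF \<epsilon>\<theta>, of "norm (z x)"] by (simp add: algebra_simps)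
    finally have "m * norm y \<le> 2 * \<theta> * norm (z x) + m * t / 8" by simp
    \<comment> \<open>The absorption: a quarter of \<open>m * norm y\<close> returns on the right,
      leaving three quarters of it below \<open>m * t / 4\<close>.\<close>
    also have "2 * \<theta> * norm (z x) \<le> 2 * \<theta> * (norm y + N)" using zN \<theta> by simp
    also have "2 * \<theta> * (norm y + N) \<le> m / 4 * norm y + m * t / 8"
      using mult_right_mono[OF \<theta>1, of "norm y"] \<theta>2 by (simp add: algebra_simps)
    finally have "3 * (m * norm y) \<le> m * t" by simp
    then have "3 * norm y \<le> t" using m(1)
      by (metis mult.left_commute mult_le_cancel_left_pos)
    then have "norm y < t" using t by linarith
    then show ?case by (simp add: dist_norm y_def)
  qed
qed


section \<open>The group completion of a commutative monoid\<close>

context comm_monoid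
begin

lemma completion_rel_iff:
  "((a, b), (c, d)) \<in> completion_rel G \<longleftrightarrow>
     a \<in> carrier G \<and> b \<in> carrier G \<and> c \<in> carrier G \<and> d \<in> carrier G \<and>
     (\<exists>e\<in>carrier G. a \<otimes> d \<otimes> e = c \<otimes> b \<otimes> e)"
  by (simp add: completion_rel_def)

lemma equiv_completion_rel: "equiv (carrier G \<times> carrier G) (completion_rel G)"
proof (rule equivI)
  show "completion_rel G \<subseteq> (carrier G \<times> carrier G) \<times> carrier G \<times> carrier G"
    by (auto simp: completion_rel_def)
  show "refl_on (carrier G \<times> carrier G) (completion_rel G)"
    by (auto simp: refl_on_def completion_rel_iff)
  show "sym (completion_rel G)"
  proof (rule symI)
    fix p q assume "(p, q) \<in> completion_rel G"
    then show "(q, p) \<in> completion_rel G"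
      by (cases p; cases q) (auto simp: completion_rel_iff intro: sym)
  qed
  show "trans (completion_rel G)"
  proof (rule transI)
    fix p q r assume pq: "(p, q) \<in> completion_rel G" and qr: "(q, r) \<in> completion_rel G"
    obtain a b c d x y where p: "p = (a, b)" "q = (c, d)" "r = (x, y)"
      by (cases p; cases q; cases r) auto
    from pq obtain e where e: "e \<in> carrier G" "a \<otimes> d \<otimes> e = c \<otimes> b \<otimes> e"
      and car: "a \<in> carrier G" "b \<in> carrier G" "c \<in> carrier G" "d \<in> carrier G"
      unfolding p completion_rel_iff by blast
    from qr obtain f where f: "f \<in> carrier G" "c \<otimes> y \<otimes> f = x \<otimes> d \<otimes> f"
      and car': "x \<in> carrier G" "y \<in> carrier G"
      unfolding p completion_rel_iff by blast
    \<comment> \<open>The monoid need not be cancellative, so the middle element \<open>d\<close> is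
      moved into the witness together with \<open>e\<close> and \<open>f\<close>.\<close>
    have "a \<otimes> y \<otimes> (d \<otimes> e \<otimes> f) = (a \<otimes> d \<otimes> e) \<otimes> (y \<otimes> f)"
      using e(1) f(1) car car' by (simp add: m_ac)
    also have "\<dots> = (c \<otimes> b \<otimes> e) \<otimes> (y \<otimes> f)" by (simp only: e(2))
    also have "\<dots> = (c \<otimes> y \<otimes> f) \<otimes> (b \<otimes> e)"
      using e(1) f(1) car car' by (simp add: m_ac)
    also have "\<dots> = (x \<otimes> d \<otimes> f) \<otimes> (b \<otimes> e)" by (simp only: f(2))
    also have "\<dots> = x \<otimes> b \<otimes> (d \<otimes> e \<otimes> f)"
      using e(1) f(1) car car' by (simp add: m_ac)
    finally show "(p, r) \<in> completion_rel G"
      unfolding p completion_rel_iff using e(1) f(1) car car' by auto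
  qed
qed

definition diff_class :: "'a \<Rightarrow> 'a \<Rightarrow> ('a \<times> 'a) set" where
  "diff_class a b = completion_rel G `` {(a, b)}"

lemma diff_class_eq_iff:
  assumes "a \<in> carrier G" "b \<in> carrier G" "c \<in> carrier G" "d \<in> carrier G"
  shows "diff_class a b = diff_class c d \<longleftrightarrow> (\<exists>e\<in>carrier G. a \<otimes> d \<otimes> e = c \<otimes> b \<otimes> e)"
  using assms eq_equiv_class_iff[OF equiv_completion_rel, of "(a, b)" "(c, d)"]
  by (simp add: diff_class_def completion_rel_iff)

lemma diff_class_eqI:
  assumes "a \<in> carrier G" "b \<in> carrier G" "c \<in> carrier G" "d \<in> carrier G"
    and "a \<otimes> d = c \<otimes> b"
  shows "diff_class a b = diff_class c d"
  using assms by (auto simp: diff_class_eq_iff)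

lemma carrier_group_completion:
  "carrier (group_completion G) = {diff_class a b | a b. a \<in> carrier G \<and> b \<in> carrier G}"
  by (auto simp: group_completion_def quotient_def diff_class_def)

text \<open>The product is defined as a union over all pairs of representatives. Independence of the
  representatives (with witness \<open>e \<otimes> f\<close>) makes all members of the union
  equal.\<close>

lemma mult_diff_class:
  assumes "a \<in> carrier G" "b \<in> carrier G" "c \<in> carrier G" "d \<in> carrier G"
  shows "diff_class a b \<otimes>\<^bsub>group_completion G\<^esub> diff_class c d = diff_class (a \<otimes> c) (b \<otimes> d)"
proof -
  have *: "diff_class (a' \<otimes> c') (b' \<otimes> d') = diff_class (a \<otimes> c) (b \<otimes> d)"
    if "((a, b), (a', b')) \<in> completion_rel G" "((c, d), (c', d')) \<in> completion_rel G" for a' b' c' d'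
  proof -
    from that obtain e f where car: "a' \<in> carrier G" "b' \<in> carrier G" "c' \<in> carrier G" "d' \<in> carrier G"
      and e: "e \<in> carrier G" "a \<otimes> b' \<otimes> e = a' \<otimes> b \<otimes> e"
      and f: "f \<in> carrier G" "c \<otimes> d' \<otimes> f = c' \<otimes> d \<otimes> f"
      unfolding completion_rel_iff by blast
    have "a' \<otimes> c' \<otimes> (b \<otimes> d) \<otimes> (e \<otimes> f) = (a' \<otimes> b \<otimes> e) \<otimes> (c' \<otimes> d \<otimes> f)"
      using e(1) f(1) car assms by (simp add: m_ac)
    also have "\<dots> = (a \<otimes> b' \<otimes> e) \<otimes> (c \<otimes> d' \<otimes> f)" by (simp only: e f)
    also have "\<dots> = a \<otimes> c \<otimes> (b' \<otimes> d') \<otimes> (e \<otimes> f)"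
      using e(1) f(1) car assms by (simp add: m_ac)
    finally show ?thesis using car assms e(1) f(1) by (subst diff_class_eq_iff) auto
  qed
  \<comment> \<open>The union over equal sets collapses only if the index sets are
    inhabited.\<close>
  have self: "(a, b) \<in> diff_class a b" "(c, d) \<in> diff_class c d"
    using assms by (auto simp: diff_class_def completion_rel_iff)
  have "diff_class a b \<otimes>\<^bsub>group_completion G\<^esub> diff_class c d =
      (\<Union>p\<in>diff_class a b. \<Union>q\<in>diff_class c d. diff_class (fst p \<otimes> fst q) (snd p \<otimes> snd q))"
    by (simp add: group_completion_def diff_class_def case_prod_unfold)
  also have "\<dots> = (\<Union>p\<in>diff_class a b. \<Union>q\<in>diff_class c d. diff_class (a \<otimes> c) (b \<otimes> d))"
    using * by (intro SUP_cong refl) (auto simp: diff_class_def)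
  also have "\<dots> = diff_class (a \<otimes> c) (b \<otimes> d)" using self by auto
  finally show ?thesis .
qed

lemma one_group_completion: "\<one>\<^bsub>group_completion G\<^esub> = diff_class \<one> \<one>"
  by (simp add: group_completion_def diff_class_def)

lemma group_group_completion: "group (group_completion G)"
proof (rule groupI)
  show "\<one>\<^bsub>group_completion G\<^esub> \<in> carrier (group_completion G)"
    unfolding one_group_completion carrier_group_completion by blast
next
  fix x y assume "x \<in> carrier (group_completion G)" "y \<in> carrier (group_completion G)"
  then show "x \<otimes>\<^bsub>group_completion G\<^esub> y \<in> carrier (group_completion G)"
    unfolding carrier_group_completion by (auto simp: mult_diff_class) blast
next
  fix x y z assume "x \<in> carrier (group_completion G)" "y \<in> carrier (group_completion G)"
    "z \<in> carrier (group_completion G)"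
  then show "x \<otimes>\<^bsub>group_completion G\<^esub> y \<otimes>\<^bsub>group_completion G\<^esub> z =
      x \<otimes>\<^bsub>group_completion G\<^esub> (y \<otimes>\<^bsub>group_completion G\<^esub> z)"
    unfolding carrier_group_completion by (auto simp: mult_diff_class m_assoc)
next
  fix x assume "x \<in> carrier (group_completion G)"
  then show "\<one>\<^bsub>group_completion G\<^esub> \<otimes>\<^bsub>group_completion G\<^esub> x = x"
    unfolding carrier_group_completion one_group_completion by (auto simp: mult_diff_class)
next
  fix x assume "x \<in> carrier (group_completion G)"
  then obtain a b where x: "x = diff_class a b" "a \<in> carrier G" "b \<in> carrier G"
    unfolding carrier_group_completion by blast
  have "diff_class b a \<otimes>\<^bsub>group_completion G\<^esub> x = \<one>\<^bsub>group_completion G\<^esub>"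
    unfolding one_group_completion x(1) using x(2,3)
    by (simp add: mult_diff_class) (rule diff_class_eqI, auto simp: m_comm)
  moreover have "diff_class b a \<in> carrier (group_completion G)"
    unfolding carrier_group_completion using x by blast
  ultimately show "\<exists>y\<in>carrier (group_completion G). y \<otimes>\<^bsub>group_completion G\<^esub> x = \<one>\<^bsub>group_completion G\<^esub>"
    by blast
qed

lemma completion_map_diff:
  assumes a: "a \<in> carrier G" and b: "b \<in> carrier G"
  shows "completion_map G a \<otimes>\<^bsub>group_completion G\<^esub> inv\<^bsub>group_completion G\<^esub> (completion_map G b)
    = diff_class a b"
proof -
  have "diff_class \<one> b \<otimes>\<^bsub>group_completion G\<^esub> diff_class b \<one> = \<one>\<^bsub>group_completion G\<^esub>"
    using b unfolding one_group_completion
    by (simp add: mult_diff_class) (rule diff_class_eqI, auto)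
  moreover have "diff_class b \<one> \<in> carrier (group_completion G)"
    "diff_class \<one> b \<in> carrier (group_completion G)"
    unfolding carrier_group_completion using b by blast+
  ultimately have "inv\<^bsub>group_completion G\<^esub> (diff_class b \<one>) = diff_class \<one> b"
    using group.inv_equality[OF group_group_completion] by blast
  then show ?thesis
    using a b by (simp add: completion_map_def mult_diff_class flip: diff_class_def)
qed

end


section \<open>Equivariant vector bundles\<close>

lemma fibrewise_linear_actionD:
  assumes "fibrewise_linear_action \<G> E" "x \<in> vfibre E b"
  shows "y \<in> vfibre E b \<Longrightarrow> vadd E x y \<in> vfibre E b"
    and "vscale E c x \<in> vfibre E b"
    and "g \<in> carrier (gfibre \<G> b) \<Longrightarrow> vact E g x \<in> vfibre E b"
    and "vact E \<one>\<^bsub>gfibre \<G> b\<^esub> x = x"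
    and "g \<in> carrier (gfibre \<G> b) \<Longrightarrow> h \<in> carrier (gfibre \<G> b) \<Longrightarrow>
      vact E (g \<otimes>\<^bsub>gfibre \<G> b\<^esub> h) x = vact E g (vact E h x)"
    and "g \<in> carrier (gfibre \<G> b) \<Longrightarrow> y \<in> vfibre E b \<Longrightarrow>
      vact E g (vadd E x y) = vadd E (vact E g x) (vact E g y)"
    and "g \<in> carrier (gfibre \<G> b) \<Longrightarrow> vact E g (vscale E c x) = vscale E c (vact E g x)"
  using assms by (simp_all add: fibrewise_linear_action_def)

section \<open>Isomorphism of equivariant bundles as an equivalence relation\<close>

lemma vbundle_isoI:
  assumes "homeomorphic_maps (vtotal E) (vtotal E') f g"
    and "\<And>x. x \<in> topspace (vtotal E) \<Longrightarrow> vproj E' (f x) = vproj E x"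
    and "\<And>b x y. x \<in> vfibre E b \<Longrightarrow> y \<in> vfibre E b \<Longrightarrow> f (vadd E x y) = vadd E' (f x) (f y)"
    and "\<And>b c x. x \<in> vfibre E b \<Longrightarrow> f (vscale E c x) = vscale E' c (f x)"
    and "\<And>b g x. g \<in> carrier (gfibre \<G> b) \<Longrightarrow> x \<in> vfibre E b \<Longrightarrow> f (vact E g x) = vact E' g (f x)"
  shows "vbundle_iso \<G> E E'"
  unfolding vbundle_iso_def using assms homeomorphic_maps_imp_map by blast

lemma vbundle_isoE:
  assumes "vbundle_iso \<G> E E'"
  obtains f g where "homeomorphic_maps (vtotal E) (vtotal E') f g"
    and "\<And>x. x \<in> topspace (vtotal E) \<Longrightarrow> vproj E' (f x) = vproj E x"
    and "\<And>b x y. x \<in> vfibre E b \<Longrightarrow> y \<in> vfibre E b \<Longrightarrow> f (vadd E x y) = vadd E' (f x) (f y)"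
    and "\<And>b c x. x \<in> vfibre E b \<Longrightarrow> f (vscale E c x) = vscale E' c (f x)"
    and "\<And>b g x. g \<in> carrier (gfibre \<G> b) \<Longrightarrow> x \<in> vfibre E b \<Longrightarrow> f (vact E g x) = vact E' g (f x)"
proof -
  obtain f where f: "homeomorphic_map (vtotal E) (vtotal E') f \<and>
     (\<forall>x\<in>topspace (vtotal E). vproj E' (f x) = vproj E x) \<and>
     (\<forall>b. \<forall>x\<in>vfibre E b. \<forall>y\<in>vfibre E b. f (vadd E x y) = vadd E' (f x) (f y)) \<and>
     (\<forall>b c. \<forall>x\<in>vfibre E b. f (vscale E c x) = vscale E' c (f x)) \<and>
     (\<forall>b. \<forall>g\<in>carrier (gfibre \<G> b). \<forall>x\<in>vfibre E b. f (vact E g x) = vact E' g (f x))"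
    using assms unfolding vbundle_iso_def ..
  then have "homeomorphic_map (vtotal E) (vtotal E') f" by (rule conjunct1)
  then obtain g where "homeomorphic_maps (vtotal E) (vtotal E') f g"
    unfolding homeomorphic_map_maps by blast
  then show ?thesis by (rule that) (use f in auto)
qed

text \<open>Linearity of the inverse follows by applying \<open>f\<close>. Closure of the fibres of
  \<open>E\<close> under the operations guarantees that the results lie where \<open>g\<close>
  inverts \<open>f\<close>; closure on the side of \<open>E'\<close> is inherited through
  \<open>f\<close>.\<close>

lemma vbundle_iso_sym:
  assumes E: "fibrewise_linear_action \<G> E" and "vbundle_iso \<G> E E'"
  shows "vbundle_iso \<G> E' E"
proof -
  obtain f g where g: "homeomorphic_maps (vtotal E) (vtotal E') f g"
    and pr: "\<And>x. x \<in> topspace (vtotal E) \<Longrightarrow> vproj E' (f x) = vproj E x"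
    and add: "\<And>b x y. x \<in> vfibre E b \<Longrightarrow> y \<in> vfibre E b \<Longrightarrow> f (vadd E x y) = vadd E' (f x) (f y)"
    and scale: "\<And>b c x. x \<in> vfibre E b \<Longrightarrow> f (vscale E c x) = vscale E' c (f x)"
    and act: "\<And>b g x. g \<in> carrier (gfibre \<G> b) \<Longrightarrow> x \<in> vfibre E b \<Longrightarrow> f (vact E g x) = vact E' g (f x)"
    by (rule vbundle_isoE[OF assms(2)]) (rule that)
  from g have gf: "\<And>x. x \<in> topspace (vtotal E) \<Longrightarrow> g (f x) = x"
    and fg: "\<And>y. y \<in> topspace (vtotal E') \<Longrightarrow> f (g y) = y"
    and gt: "\<And>y. y \<in> topspace (vtotal E') \<Longrightarrow> g y \<in> topspace (vtotal E)"
    by (auto simp: homeomorphic_maps_def continuous_map_def)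
  have prg: "vproj E (g y) = vproj E' y" if "y \<in> topspace (vtotal E')" for y
    using pr[OF gt[OF that]] fg[OF that] by simp
  have gfib: "g y \<in> vfibre E b" "f (g y) = y" if "y \<in> vfibre E' b" for y b
    using that gt prg fg by (auto simp: vfibre_def)
  have gfE: "g (f x) = x" if "x \<in> vfibre E b" for x b
    using gf that by (auto simp: vfibre_def)
  have cl: "vadd E x y \<in> vfibre E b" "vscale E c x \<in> vfibre E b"
    if "x \<in> vfibre E b" "y \<in> vfibre E b" for x y b c
    using fibrewise_linear_actionD[OF E] that by blast+
  have cla: "vact E h x \<in> vfibre E b" if "h \<in> carrier (gfibre \<G> b)" "x \<in> vfibre E b" for x h b
    using fibrewise_linear_actionD[OF E] that by blast
  show ?thesis
  proof (rule vbundle_isoI)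
    show "homeomorphic_maps (vtotal E') (vtotal E) g f" using g homeomorphic_maps_sym by blast
  next
    fix b x y assume "x \<in> vfibre E' b" "y \<in> vfibre E' b"
    then show "g (vadd E' x y) = vadd E (g x) (g y)"
      using add[of "g x" b "g y"] gfib gfE cl(1) by metis
  next
    fix b c x assume "x \<in> vfibre E' b"
    then show "g (vscale E' c x) = vscale E c (g x)"
      using scale[of "g x" b c] gfib gfE cl(2) by metis
  next
    fix b h x assume "h \<in> carrier (gfibre \<G> b)" "x \<in> vfibre E' b"
    then show "g (vact E' h x) = vact E h (g x)"
      using act[of h b "g x"] gfib gfE cla by metis
  qed (rule prg)
qed

lemma vbundle_iso_trans:
  assumes "vbundle_iso \<G> E E'" "vbundle_iso \<G> E' E''"
  shows "vbundle_iso \<G> E E''"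
proof -
  obtain f f' where f': "homeomorphic_maps (vtotal E) (vtotal E') f f'"
    and f1: "\<And>x. x \<in> topspace (vtotal E) \<Longrightarrow> vproj E' (f x) = vproj E x"
    and f2: "\<And>b x y. x \<in> vfibre E b \<Longrightarrow> y \<in> vfibre E b \<Longrightarrow> f (vadd E x y) = vadd E' (f x) (f y)"
    and f3: "\<And>b c x. x \<in> vfibre E b \<Longrightarrow> f (vscale E c x) = vscale E' c (f x)"
    and f4: "\<And>b g x. g \<in> carrier (gfibre \<G> b) \<Longrightarrow> x \<in> vfibre E b \<Longrightarrow> f (vact E g x) = vact E' g (f x)"
    by (rule vbundle_isoE[OF assms(1)]) (rule that)
  obtain h h' where h': "homeomorphic_maps (vtotal E') (vtotal E'') h h'"
    and h1: "\<And>x. x \<in> topspace (vtotal E') \<Longrightarrow> vproj E'' (h x) = vproj E' x"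
    and h2: "\<And>b x y. x \<in> vfibre E' b \<Longrightarrow> y \<in> vfibre E' b \<Longrightarrow> h (vadd E' x y) = vadd E'' (h x) (h y)"
    and h3: "\<And>b c x. x \<in> vfibre E' b \<Longrightarrow> h (vscale E' c x) = vscale E'' c (h x)"
    and h4: "\<And>b g x. g \<in> carrier (gfibre \<G> b) \<Longrightarrow> x \<in> vfibre E' b \<Longrightarrow> h (vact E' g x) = vact E'' g (h x)"
    by (rule vbundle_isoE[OF assms(2)]) (rule that)
  have ft: "f x \<in> topspace (vtotal E')" if "x \<in> topspace (vtotal E)" for x
    using f' that by (auto simp: homeomorphic_maps_def continuous_map_def)
  have ff: "f x \<in> vfibre E' b" if "x \<in> vfibre E b" for x b
    using ft f1 that by (auto simp: vfibre_def)
  show ?thesis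
  proof (rule vbundle_isoI)
    show "homeomorphic_maps (vtotal E) (vtotal E'') (h \<circ> f) (f' \<circ> h')"
      using f' h' homeomorphic_maps_compose by blast
  qed (auto simp: f1 f2 f3 f4 h1 ft h2[OF ff ff] h3[OF ff] h4[OF _ ff])
qed

lemma vbundle_class_eq:
  assumes "fibrewise_linear_action \<G> E" "vbundle_iso \<G> E E'"
  shows "vbundle_class \<G> E = vbundle_class \<G> E'"
  using vbundle_iso_trans[OF _ assms(2)] vbundle_iso_trans[OF _ vbundle_iso_sym[OF assms]]
  unfolding vbundle_class_def by blast

section \<open>Local trivializations and their inverses\<close>

text \<open>A trivialization as a pair of mutually inverse continuous maps: fibre coordinates
  \<open>\<phi>\<close> and a moving frame \<open>s b\<close>. In this form, unlike as a
  homeomorphism to a product, trivializations are easily summed, transported and restricted to a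
  fibre; \<open>vtrivI\<close> reassembles them.\<close>

lemma vtrivE:
  fixes E :: "('b::topological_space, 'g, 'e, 'z) vbundle_scheme"
  assumes "vtriv E n U \<phi>"
  obtains s where
    "continuous_map (prod_topology (top_of_set U) (top_of_set (Cspace n))) (vtotal E) (\<lambda>(b, z). s b z)"
    "continuous_map (subtopology (vtotal E) {x. vproj E x \<in> U}) euclidean \<phi>"
    "\<And>b z. b \<in> U \<Longrightarrow> z \<in> Cspace n \<Longrightarrow> s b z \<in> vfibre E b \<and> \<phi> (s b z) = z"
    "\<And>b x. b \<in> U \<Longrightarrow> x \<in> vfibre E b \<Longrightarrow> \<phi> x \<in> Cspace n \<and> s b (\<phi> x) = x"
    "open U"
proof -
  have U: "open U" using assms by (simp add: vtriv_def)
  let ?P = "prod_topology (top_of_set U) (top_of_set (Cspace n))"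
  let ?S = "subtopology (vtotal E) {x. vproj E x \<in> U}"
  obtain g where g: "homeomorphic_maps ?S ?P (\<lambda>x. (vproj E x, \<phi> x)) g"
    using assms unfolding vtriv_def homeomorphic_map_maps by blast
  have c1: "continuous_map ?S ?P (\<lambda>x. (vproj E x, \<phi> x))" and c2: "continuous_map ?P ?S g"
    and gf: "\<And>x. x \<in> topspace ?S \<Longrightarrow> g (vproj E x, \<phi> x) = x"
    and fg: "\<And>p. p \<in> topspace ?P \<Longrightarrow> (vproj E (g p), \<phi> (g p)) = p"
    using g unfolding homeomorphic_maps_def by auto
  have gt: "g p \<in> topspace ?S" if "p \<in> topspace ?P" for p
    using c2 that by (auto simp: continuous_map_def)
  have ft: "(vproj E x, \<phi> x) \<in> topspace ?P" if "x \<in> topspace ?S" for x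
    using c1 that by (auto simp: continuous_map_def)
  show ?thesis
  proof (rule that[of "\<lambda>b z. g (b, z)"])
    show "continuous_map ?P (vtotal E) (\<lambda>(b, z). g (b, z))"
      using c2 by (simp add: continuous_map_in_subtopology)
    have "continuous_map ?S (top_of_set (Cspace n)) \<phi>"
      using c1 unfolding continuous_map_paired by blast
    then show "continuous_map ?S euclidean \<phi>" by (simp add: continuous_map_in_subtopology)
  next
    fix b z assume "b \<in> U" "z \<in> Cspace n"
    then show "g (b, z) \<in> vfibre E b \<and> \<phi> (g (b, z)) = z"
      using gt[of "(b, z)"] fg[of "(b, z)"] by (auto simp: vfibre_def)
  next
    fix b x assume "b \<in> U" "x \<in> vfibre E b"
    then show "\<phi> x \<in> Cspace n \<and> g (b, \<phi> x) = x"
      using ft[of x] gf[of x] by (auto simp: vfibre_def)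
  qed (rule U)
qed

lemma vtrivI:
  fixes E :: "('b::topological_space, 'g, 'e, 'z) vbundle_scheme"
  assumes U: "open U" and pr: "continuous_map (vtotal E) euclidean (vproj E)"
    and cs: "continuous_map (prod_topology (top_of_set U) (top_of_set (Cspace n))) (vtotal E) (\<lambda>(b, z). s b z)"
    and c\<phi>: "continuous_map (subtopology (vtotal E) {x. vproj E x \<in> U}) euclidean \<phi>"
    and s: "\<And>b z. b \<in> U \<Longrightarrow> z \<in> Cspace n \<Longrightarrow> s b z \<in> vfibre E b \<and> \<phi> (s b z) = z"
    and \<phi>: "\<And>b x. b \<in> U \<Longrightarrow> x \<in> vfibre E b \<Longrightarrow> \<phi> x \<in> Cspace n \<and> s b (\<phi> x) = x"
    and "\<And>b x y. b \<in> U \<Longrightarrow> x \<in> vfibre E b \<Longrightarrow> y \<in> vfibre E b \<Longrightarrow> \<phi> (vadd E x y) = (\<lambda>i. \<phi> x i + \<phi> y i)"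
    and "\<And>b c x. b \<in> U \<Longrightarrow> x \<in> vfibre E b \<Longrightarrow> \<phi> (vscale E c x) = (\<lambda>i. c * \<phi> x i)"
  shows "vtriv E n U \<phi>"
proof -
  have "homeomorphic_maps (subtopology (vtotal E) {x. vproj E x \<in> U})
     (prod_topology (top_of_set U) (top_of_set (Cspace n))) (\<lambda>x. (vproj E x, \<phi> x)) (\<lambda>(b, z). s b z)"
    unfolding homeomorphic_maps_def
  proof (intro conjI ballI)
    show "continuous_map (subtopology (vtotal E) {x. vproj E x \<in> U})
        (prod_topology (top_of_set U) (top_of_set (Cspace n))) (\<lambda>x. (vproj E x, \<phi> x))"
      unfolding continuous_map_paired
      using pr c\<phi> \<phi> by (auto simp: continuous_map_in_subtopology vfibre_def
          intro: continuous_map_from_subtopology)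
    show "continuous_map (prod_topology (top_of_set U) (top_of_set (Cspace n)))
        (subtopology (vtotal E) {x. vproj E x \<in> U}) (\<lambda>(b, z). s b z)"
      using cs s by (auto simp: continuous_map_in_subtopology vfibre_def)
  qed (use s \<phi> in \<open>auto simp: vfibre_def\<close>)
  then show ?thesis
    unfolding vtriv_def using assms homeomorphic_maps_imp_map by blast
qed

lemma continuous_map_euclidean_fun:
  "continuous_map X euclidean (f :: 'x \<Rightarrow> 'i \<Rightarrow> 'c::topological_space) \<longleftrightarrow>
     (\<forall>i. continuous_map X euclidean (\<lambda>x. f x i))"
  unfolding euclidean_product_topology[symmetric] continuous_map_componentwise_UNIV ..

text \<open>A property of \<open>\<G>\<close> alone, free of the typical fibre, so that the monoid
  and the K-group can be treated without fixing \<open>G\<close> and \<open>T\<close>.\<close>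

definition fibred_groups :: "('b, 'g) group_family \<Rightarrow> bool" where
  "fibred_groups \<G> \<longleftrightarrow>
     (\<forall>b. group (gfibre \<G> b) \<and> carrier (gfibre \<G> b) = {g \<in> topspace (gtotal \<G>). gproj \<G> g = b})"

subsection \<open>Direct sums\<close>

lemma vsum_simps [simp]:
  "vtotal (vsum E E') = subtopology (prod_topology (vtotal E) (vtotal E')) {(x, y). vproj E x = vproj E' y}"
  "vproj (vsum E E') p = vproj E (fst p)"
  "vadd (vsum E E') p q = (vadd E (fst p) (fst q), vadd E' (snd p) (snd q))"
  "vscale (vsum E E') c p = (vscale E c (fst p), vscale E' c (snd p))"
  "vact (vsum E E') g p = (vact E g (fst p), vact E' g (snd p))"
  by (auto simp: vsum_def case_prod_unfold)

lemma vfibre_vsum [simp]: "vfibre (vsum E E') b = vfibre E b \<times> vfibre E' b"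
  by (auto simp: vfibre_def)

lemma continuous_map_vsum:
  "continuous_map X (vtotal (vsum E E')) f \<longleftrightarrow>
     continuous_map X (vtotal E) (\<lambda>x. fst (f x)) \<and> continuous_map X (vtotal E') (\<lambda>x. snd (f x)) \<and>
     (\<forall>x\<in>topspace X. vproj E (fst (f x)) = vproj E' (snd (f x)))"
  by (auto simp: continuous_map_in_subtopology continuous_map_pairwise comp_def case_prod_unfold)

lemma continuous_map_vsum_fst: "continuous_map (vtotal (vsum E E')) (vtotal E) fst"
  and continuous_map_vsum_snd: "continuous_map (vtotal (vsum E E')) (vtotal E') snd"
  by (auto intro!: continuous_map_from_subtopology continuous_map_fst continuous_map_snd)

lemma fibrewise_linear_action_vsum:
  assumes "fibrewise_linear_action \<G> E" "fibrewise_linear_action \<G> E'"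
  shows "fibrewise_linear_action \<G> (vsum E E')"
  using assms unfolding fibrewise_linear_action_def by auto

lemma vsum_iso_cong:
  assumes "vbundle_iso \<G> E1 E2" "vbundle_iso \<G> E1' E2'"
  shows "vbundle_iso \<G> (vsum E1 E1') (vsum E2 E2')"
proof -
  obtain f f' where f': "homeomorphic_maps (vtotal E1) (vtotal E2) f f'"
    and f1: "\<And>x. x \<in> topspace (vtotal E1) \<Longrightarrow> vproj E2 (f x) = vproj E1 x"
    and f2: "\<And>b x y. x \<in> vfibre E1 b \<Longrightarrow> y \<in> vfibre E1 b \<Longrightarrow> f (vadd E1 x y) = vadd E2 (f x) (f y)"
    and f3: "\<And>b c x. x \<in> vfibre E1 b \<Longrightarrow> f (vscale E1 c x) = vscale E2 c (f x)"
    and f4: "\<And>b g x. g \<in> carrier (gfibre \<G> b) \<Longrightarrow> x \<in> vfibre E1 b \<Longrightarrow> f (vact E1 g x) = vact E2 g (f x)"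
    by (rule vbundle_isoE[OF assms(1)]) (rule that)
  obtain h h' where h': "homeomorphic_maps (vtotal E1') (vtotal E2') h h'"
    and h1: "\<And>x. x \<in> topspace (vtotal E1') \<Longrightarrow> vproj E2' (h x) = vproj E1' x"
    and h2: "\<And>b x y. x \<in> vfibre E1' b \<Longrightarrow> y \<in> vfibre E1' b \<Longrightarrow> h (vadd E1' x y) = vadd E2' (h x) (h y)"
    and h3: "\<And>b c x. x \<in> vfibre E1' b \<Longrightarrow> h (vscale E1' c x) = vscale E2' c (h x)"
    and h4: "\<And>b g x. g \<in> carrier (gfibre \<G> b) \<Longrightarrow> x \<in> vfibre E1' b \<Longrightarrow> h (vact E1' g x) = vact E2' g (h x)"
    by (rule vbundle_isoE[OF assms(2)]) (rule that)
  have f'1: "vproj E1 (f' y) = vproj E2 y" if "y \<in> topspace (vtotal E2)" for y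
    using f' f1[of "f' y"] that by (auto simp: homeomorphic_maps_def continuous_map_def Pi_iff)
  have h'1: "vproj E1' (h' y) = vproj E2' y" if "y \<in> topspace (vtotal E2')" for y
    using h' h1[of "h' y"] that by (auto simp: homeomorphic_maps_def continuous_map_def Pi_iff)
  show ?thesis
  proof (rule vbundle_isoI)
    show "homeomorphic_maps (vtotal (vsum E1 E1')) (vtotal (vsum E2 E2'))
      (\<lambda>p. (f (fst p), h (snd p))) (\<lambda>p. (f' (fst p), h' (snd p)))"
      unfolding homeomorphic_maps_def
    proof (intro conjI ballI)
      have c: "continuous_map (vtotal E1) (vtotal E2) f" "continuous_map (vtotal E1') (vtotal E2') h"
        "continuous_map (vtotal E2) (vtotal E1) f'" "continuous_map (vtotal E2') (vtotal E1') h'"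
        using f' h' by (auto simp: homeomorphic_maps_def)
      show "continuous_map (vtotal (vsum E1 E1')) (vtotal (vsum E2 E2')) (\<lambda>p. (f (fst p), h (snd p)))"
        unfolding continuous_map_vsum
        using continuous_map_compose[OF continuous_map_vsum_fst c(1)]
          continuous_map_compose[OF continuous_map_vsum_snd c(2)] f1 h1 by (auto simp: comp_def)
      show "continuous_map (vtotal (vsum E2 E2')) (vtotal (vsum E1 E1')) (\<lambda>p. (f' (fst p), h' (snd p)))"
        unfolding continuous_map_vsum
        using continuous_map_compose[OF continuous_map_vsum_fst c(3)]
          continuous_map_compose[OF continuous_map_vsum_snd c(4)] f'1 h'1 by (auto simp: comp_def)
    qed (use f' h' in \<open>auto simp: homeomorphic_maps_def\<close>)
  qed (use f1 f2 f3 f4 h2 h3 h4 in auto)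
qed

lemma vsum_comm: "vbundle_iso \<G> (vsum E E') (vsum E' E)"
proof (rule vbundle_isoI)
  show "homeomorphic_maps (vtotal (vsum E E')) (vtotal (vsum E' E)) (\<lambda>p. (snd p, fst p)) (\<lambda>p. (snd p, fst p))"
    unfolding homeomorphic_maps_def continuous_map_vsum
    using continuous_map_vsum_fst[of E E'] continuous_map_vsum_snd[of E E']
      continuous_map_vsum_fst[of E' E] continuous_map_vsum_snd[of E' E] by auto
qed auto

lemma vsum_assoc: "vbundle_iso \<G> (vsum (vsum E1 E2) E3) (vsum E1 (vsum E2 E3))"
proof (rule vbundle_isoI)
  show "homeomorphic_maps (vtotal (vsum (vsum E1 E2) E3)) (vtotal (vsum E1 (vsum E2 E3)))
     (\<lambda>p. (fst (fst p), snd (fst p), snd p)) (\<lambda>p. ((fst p, fst (snd p)), snd (snd p)))"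
    unfolding homeomorphic_maps_def continuous_map_vsum
    using continuous_map_compose[OF continuous_map_vsum_fst[of "vsum E1 E2" E3] continuous_map_vsum_fst]
      continuous_map_compose[OF continuous_map_vsum_fst[of "vsum E1 E2" E3] continuous_map_vsum_snd]
      continuous_map_compose[OF continuous_map_vsum_snd[of E1 "vsum E2 E3"] continuous_map_vsum_fst]
      continuous_map_compose[OF continuous_map_vsum_snd[of E1 "vsum E2 E3"] continuous_map_vsum_snd]
      continuous_map_vsum_fst[of E1 "vsum E2 E3"] continuous_map_vsum_snd[of "vsum E1 E2" E3]
    by (auto simp: comp_def simp del: vsum_simps(1)) (auto)
qed auto

lemma vfibre_vzero: "vfibre vzero b = {(b, \<lambda>_. 0)}"
  by (auto simp: vfibre_def vzero_def)

lemma vsum_vzero: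
  fixes E :: "('b::topological_space, 'g, 'e, 'z) vbundle_scheme"
  assumes "continuous_map (vtotal E) euclidean (vproj E)"
  shows "vbundle_iso \<G> (vsum vzero E) E"
proof (rule vbundle_isoI)
  have "continuous_map (vtotal E) (top_of_set (UNIV \<times> {\<lambda>_. 0})) (\<lambda>x. (vproj E x, \<lambda>_. 0))"
    using assms by (auto simp: continuous_map_in_subtopology continuous_map_pairwise comp_def
        simp flip: euclidean_product_topology prod_topology_euclidean)
  then show "homeomorphic_maps (vtotal (vsum vzero E)) (vtotal E) snd (\<lambda>x. ((vproj E x, \<lambda>_. 0), x))"
    using continuous_map_vsum_snd[of vzero E] unfolding homeomorphic_maps_def continuous_map_vsum
    by (auto simp: vzero_def)
qed (auto simp: vzero_def)

lemma equivariant_vzero: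
  fixes \<G> :: "('b::topological_space, 'g) group_family"
  shows "equivariant_vbundle \<G> vzero"
  unfolding equivariant_vbundle_def
proof (intro conjI allI)
  show pr: "continuous_map (vtotal vzero) euclidean (vproj vzero)"
    by (auto simp: vzero_def continuous_on_fst)
  show "fibrewise_linear_action \<G> vzero"
    unfolding fibrewise_linear_action_def by (auto simp: vfibre_vzero) (auto simp: vzero_def)
  show "continuous_map (subtopology (prod_topology (gtotal \<G>) (vtotal vzero))
      {(g, x). gproj \<G> g = vproj vzero x}) (vtotal vzero) (\<lambda>(g, x). vact vzero g x)"
    by (auto simp: vzero_def case_prod_unfold intro!: continuous_map_from_subtopology continuous_map_snd)
  fix b :: 'b
  have "vtriv (vzero :: ('b, 'g, 'b \<times> (nat \<Rightarrow> complex)) vbundle) 0 UNIV (\<lambda>x _. 0)"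
  proof (rule vtrivI[OF _ pr, where s="\<lambda>b z. (b, \<lambda>_. 0)"])
    show "continuous_map (prod_topology (top_of_set UNIV) (top_of_set (Cspace 0)))
       (vtotal (vzero :: ('b, 'g, 'b \<times> (nat \<Rightarrow> complex)) vbundle)) (\<lambda>(b, z). (b, \<lambda>_. 0))"
      by (auto simp: vzero_def continuous_map_in_subtopology case_prod_unfold simp flip: prod_topology_euclidean
          intro!: continuous_map_pairedI continuous_map_fst)
  qed (auto simp: vfibre_vzero Cspace_def)
  then show "\<exists>n U \<phi>. b \<in> U \<and> vtriv (vzero :: ('b, 'g, 'b \<times> (nat \<Rightarrow> complex)) vbundle) n U \<phi>"
    by blast
qed

text \<open>Coordinates are concatenated: those of the first summand occupy the indices below
  \<open>n\<close>, those of the second are shifted by \<open>n\<close>.\<close>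

lemma vtriv_vsum:
  fixes E :: "('b::topological_space, 'g, 'e, 'y) vbundle_scheme"
    and E' :: "('b, 'g, 'f, 'z) vbundle_scheme"
  assumes pr: "continuous_map (vtotal (vsum E E')) euclidean (vproj (vsum E E'))"
    and t: "vtriv E n U \<phi>" and t': "vtriv E' m V \<psi>"
  shows "vtriv (vsum E E') (n + m) (U \<inter> V) (\<lambda>p i. if i < n then \<phi> (fst p) i else \<psi> (snd p) (i - n))"
proof -
  obtain s where s:
    "continuous_map (prod_topology (top_of_set U) (top_of_set (Cspace n))) (vtotal E) (\<lambda>(b, z). s b z)"
    "continuous_map (subtopology (vtotal E) {x. vproj E x \<in> U}) euclidean \<phi>"
    "\<And>b z. b \<in> U \<Longrightarrow> z \<in> Cspace n \<Longrightarrow> s b z \<in> vfibre E b \<and> \<phi> (s b z) = z"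
    "\<And>b x. b \<in> U \<Longrightarrow> x \<in> vfibre E b \<Longrightarrow> \<phi> x \<in> Cspace n \<and> s b (\<phi> x) = x"
    "open U"
    by (rule vtrivE[OF t]) (rule that)
  obtain s' where s':
    "continuous_map (prod_topology (top_of_set V) (top_of_set (Cspace m))) (vtotal E') (\<lambda>(b, z). s' b z)"
    "continuous_map (subtopology (vtotal E') {x. vproj E' x \<in> V}) euclidean \<psi>"
    "\<And>b z. b \<in> V \<Longrightarrow> z \<in> Cspace m \<Longrightarrow> s' b z \<in> vfibre E' b \<and> \<psi> (s' b z) = z"
    "\<And>b x. b \<in> V \<Longrightarrow> x \<in> vfibre E' b \<Longrightarrow> \<psi> x \<in> Cspace m \<and> s' b (\<psi> x) = x"
    "open V"
    by (rule vtrivE[OF t']) (rule that)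
  \<comment> \<open>\<open>lo\<close> must cut off at \<open>n\<close> in order to land in
    \<open>Cspace n\<close>, whereas \<open>hi\<close> needs no cut: a sequence vanishing from
    \<open>n + m\<close> on, shifted by \<open>n\<close>, vanishes from \<open>m\<close> on.\<close>
  define lo hi where "lo = (\<lambda>z i. if i < n then z i else (0::complex))" and "hi = (\<lambda>z i. z (i + n) :: complex)"
  have lohi: "lo z \<in> Cspace n" "hi z \<in> Cspace m" if "z \<in> Cspace (n + m)" for z
    using that by (auto simp: lo_def hi_def Cspace_def)
  have comb: "(\<lambda>i. if i < n then z i else w (i - n)) \<in> Cspace (n + m)" if "w \<in> Cspace m" for z w
    using that by (auto simp: Cspace_def)
  have lo_comb: "lo (\<lambda>i. if i < n then z i else w (i - n)) = z" if "z \<in> Cspace n" for z w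
    using that by (auto simp: lo_def Cspace_def)
  have hi_comb: "hi (\<lambda>i. if i < n then z i else w (i - n)) = w" for z w
    by (auto simp: hi_def)
  have comb_lohi: "(\<lambda>i. if i < n then lo z i else hi z (i - n)) = z" for z
    by (auto simp: lo_def hi_def)
  let ?P = "prod_topology (top_of_set (U \<inter> V)) (top_of_set (Cspace (n + m)))"
  have c1: "continuous_map ?P euclidean fst"
    using continuous_map_fst[of "top_of_set (U \<inter> V)" "top_of_set (Cspace (n + m))"]
    by (simp add: continuous_map_in_subtopology)
  have "continuous_map ?P euclidean snd"
    using continuous_map_snd[of "top_of_set (U \<inter> V)" "top_of_set (Cspace (n + m))"]
    by (simp add: continuous_map_in_subtopology)
  then have c2: "continuous_map ?P euclidean (\<lambda>p. snd p i)" for i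
    by (simp add: continuous_map_euclidean_fun)
  have c3: "continuous_map ?P euclidean (\<lambda>p. lo (snd p) i)" "continuous_map ?P euclidean (\<lambda>p. hi (snd p) i)" for i
    unfolding lo_def hi_def using c2 by (cases "i < n"; simp)+
  have L: "continuous_map ?P (prod_topology (top_of_set U) (top_of_set (Cspace n))) (\<lambda>p. (fst p, lo (snd p)))"
    unfolding continuous_map_paired using c1 c3(1) lohi
    by (auto simp: continuous_map_in_subtopology continuous_map_euclidean_fun)
  have R: "continuous_map ?P (prod_topology (top_of_set V) (top_of_set (Cspace m))) (\<lambda>p. (fst p, hi (snd p)))"
    unfolding continuous_map_paired using c1 c3(2) lohi
    by (auto simp: continuous_map_in_subtopology continuous_map_euclidean_fun)
  let ?S = "subtopology (vtotal (vsum E E')) {p. vproj (vsum E E') p \<in> U \<inter> V}"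
  have S1: "continuous_map ?S (subtopology (vtotal E) {x. vproj E x \<in> U}) fst"
    using continuous_map_from_subtopology[OF continuous_map_vsum_fst]
    by (auto simp: continuous_map_in_subtopology)
  have S2: "continuous_map ?S (subtopology (vtotal E') {x. vproj E' x \<in> V}) snd"
    using continuous_map_from_subtopology[OF continuous_map_vsum_snd]
    by (auto simp: continuous_map_in_subtopology)
  have S1': "continuous_map ?S euclidean (\<lambda>p. \<phi> (fst p) i)" for i
    using continuous_map_compose[OF S1 s(2)] by (simp add: comp_def continuous_map_euclidean_fun)
  have S2': "continuous_map ?S euclidean (\<lambda>p. \<psi> (snd p) i)" for i
    using continuous_map_compose[OF S2 s'(2)] by (simp add: comp_def continuous_map_euclidean_fun)
  show ?thesis
  proof (rule vtrivI[OF _ pr, where s="\<lambda>b z. (s b (lo z), s' b (hi z))"])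
    show "open (U \<inter> V)" using s(5) s'(5) by blast
    show "continuous_map ?P (vtotal (vsum E E')) (\<lambda>(b, z). (s b (lo z), s' b (hi z)))"
      unfolding continuous_map_vsum
      using continuous_map_compose[OF L s(1)] continuous_map_compose[OF R s'(1)] s(3) s'(3) lohi
      by (auto simp: comp_def case_prod_unfold vfibre_def)
    show "continuous_map ?S euclidean (\<lambda>p i. if i < n then \<phi> (fst p) i else \<psi> (snd p) (i - n))"
      unfolding continuous_map_euclidean_fun
    proof
      fix i show "continuous_map ?S euclidean (\<lambda>p. if i < n then \<phi> (fst p) i else \<psi> (snd p) (i - n))"
        using S1'[of i] S2'[of "i - n"] by (cases "i < n") simp_all
    qed
  next
    fix b z assume b: "b \<in> U \<inter> V" "z \<in> Cspace (n + m)"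
    then show "(s b (lo z), s' b (hi z)) \<in> vfibre (vsum E E') b \<and>
        (\<lambda>i. if i < n then \<phi> (fst (s b (lo z), s' b (hi z))) i else \<psi> (snd (s b (lo z), s' b (hi z))) (i - n)) = z"
      using s(3)[of b "lo z"] s'(3)[of b "hi z"] lohi[of z] comb_lohi[of z] by (simp cong: if_cong)
  next
    fix b p assume "b \<in> U \<inter> V" "p \<in> vfibre (vsum E E') b"
    then show "(\<lambda>i. if i < n then \<phi> (fst p) i else \<psi> (snd p) (i - n)) \<in> Cspace (n + m) \<and>
        (s b (lo (\<lambda>i. if i < n then \<phi> (fst p) i else \<psi> (snd p) (i - n))),
         s' b (hi (\<lambda>i. if i < n then \<phi> (fst p) i else \<psi> (snd p) (i - n)))) = p"
      using s(4)[of b "fst p"] s'(4)[of b "snd p"] by (auto simp: comb lo_comb hi_comb)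
  qed (use t t' in \<open>auto simp: vtriv_def fun_eq_iff\<close>)
qed

lemma equivariant_vsum:
  fixes E :: "('b::topological_space, 'g, 'e, 'y) vbundle_scheme"
    and E' :: "('b, 'g, 'f, 'z) vbundle_scheme"
  assumes car: "fibred_groups \<G>"
    and E: "equivariant_vbundle \<G> E" and E': "equivariant_vbundle \<G> E'"
  shows "equivariant_vbundle \<G> (vsum E E')"
  unfolding equivariant_vbundle_def
proof (intro conjI allI)
  have prE: "continuous_map (vtotal E) euclidean (vproj E)"
    using E by (simp add: equivariant_vbundle_def)
  show pr: "continuous_map (vtotal (vsum E E')) euclidean (vproj (vsum E E'))"
    using continuous_map_compose[OF continuous_map_vsum_fst prE, of E'] by (simp add: comp_def ext[OF vsum_simps(2)])
  show "fibrewise_linear_action \<G> (vsum E E')"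
    using E E' by (simp add: equivariant_vbundle_def fibrewise_linear_action_vsum)
  let ?X = "subtopology (prod_topology (gtotal \<G>) (vtotal (vsum E E'))) {(g, x). gproj \<G> g = vproj (vsum E E') x}"
  have cg: "continuous_map ?X (gtotal \<G>) fst" and cx: "continuous_map ?X (vtotal (vsum E E')) snd"
    by (auto intro: continuous_map_from_subtopology continuous_map_fst continuous_map_snd simp del: vsum_simps)
  have c1: "continuous_map ?X (vtotal E) (\<lambda>p. fst (snd p))"
    and c2: "continuous_map ?X (vtotal E') (\<lambda>p. snd (snd p))"
    using continuous_map_compose[OF cx continuous_map_vsum_fst]
      continuous_map_compose[OF cx continuous_map_vsum_snd] by (simp_all add: comp_def)
  let ?Y = "subtopology (prod_topology (gtotal \<G>) (vtotal E)) {(g, x). gproj \<G> g = vproj E x}"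
  let ?Y' = "subtopology (prod_topology (gtotal \<G>) (vtotal E')) {(g, x). gproj \<G> g = vproj E' x}"
  have d1: "continuous_map ?X ?Y (\<lambda>p. (fst p, fst (snd p)))"
    using cg c1 by (auto simp: continuous_map_in_subtopology continuous_map_pairwise comp_def)
  have d2: "continuous_map ?X ?Y' (\<lambda>p. (fst p, snd (snd p)))"
    using cg c2 by (auto simp: continuous_map_in_subtopology continuous_map_pairwise comp_def)
  have a1: "continuous_map ?Y (vtotal E) (\<lambda>(g, x). vact E g x)"
    and a2: "continuous_map ?Y' (vtotal E') (\<lambda>(g, x). vact E' g x)"
    using E E' by (auto simp: equivariant_vbundle_def)
  have fl: "fibrewise_linear_action \<G> E" "fibrewise_linear_action \<G> E'"
    using E E' by (auto simp: equivariant_vbundle_def)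
  show "continuous_map ?X (vtotal (vsum E E')) (\<lambda>(g, x). vact (vsum E E') g x)"
    unfolding continuous_map_vsum
  proof (intro conjI ballI)
    show "continuous_map ?X (vtotal E) (\<lambda>x. fst (case x of (g, x) \<Rightarrow> vact (vsum E E') g x))"
      using continuous_map_compose[OF d1 a1] by (simp add: comp_def case_prod_unfold)
    show "continuous_map ?X (vtotal E') (\<lambda>x. snd (case x of (g, x) \<Rightarrow> vact (vsum E E') g x))"
      using continuous_map_compose[OF d2 a2] by (simp add: comp_def case_prod_unfold)
    fix p assume p: "p \<in> topspace ?X"
    obtain g x y where pg: "p = (g, x, y)" by (cases p) auto
    have g: "g \<in> carrier (gfibre \<G> (vproj E x))" "x \<in> vfibre E (vproj E x)" "y \<in> vfibre E' (vproj E x)"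
      using p car by (auto simp: pg fibred_groups_def vfibre_def)
    then have "vact E g x \<in> vfibre E (vproj E x)" "vact E' g y \<in> vfibre E' (vproj E x)"
      using fibrewise_linear_actionD(3)[OF fl(1)] fibrewise_linear_actionD(3)[OF fl(2)] by auto
    then show "vproj E (fst (case p of (g, x) \<Rightarrow> vact (vsum E E') g x)) =
        vproj E' (snd (case p of (g, x) \<Rightarrow> vact (vsum E E') g x))"
      by (simp add: pg vfibre_def)
  qed
  fix b :: 'b
  obtain n U \<phi> where t: "b \<in> U" "vtriv E n U \<phi>" using E unfolding equivariant_vbundle_def by blast
  obtain m V \<psi> where t': "b \<in> V" "vtriv E' m V \<psi>" using E' unfolding equivariant_vbundle_def by blast
  show "\<exists>n U \<phi>. b \<in> U \<and> vtriv (vsum E E') n U \<phi>"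
    using vtriv_vsum[OF pr t(2) t'(2)] t(1) t'(1) by blast
qed


subsection \<open>Representatives in the fixed universe\<close>

text \<open>Transport of structure along a homeomorphism. The operations of \<open>E'\<close> are
  prescribed only on fibres, as their values elsewhere carry no meaning. The compatibility of the
  action with sums and scalars is verified after applying \<open>f\<close>, which is injective on
  each fibre.\<close>

lemma equivariant_transport:
  fixes E :: "('b::topological_space, 'g, 'e, 'y) vbundle_scheme"
    and E' :: "('b, 'g, 'f, 'z) vbundle_scheme"
  assumes car: "fibred_groups \<G>" and E: "equivariant_vbundle \<G> E"
    and hm: "homeomorphic_maps (vtotal E') (vtotal E) f g"
    and pr: "\<And>x. x \<in> topspace (vtotal E') \<Longrightarrow> vproj E' x = vproj E (f x)"
    and add: "\<And>b x y. x \<in> vfibre E' b \<Longrightarrow> y \<in> vfibre E' b \<Longrightarrow> vadd E' x y = g (vadd E (f x) (f y))"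
    and scale: "\<And>b c x. x \<in> vfibre E' b \<Longrightarrow> vscale E' c x = g (vscale E c (f x))"
    and act: "\<And>b h x. h \<in> carrier (gfibre \<G> b) \<Longrightarrow> x \<in> vfibre E' b \<Longrightarrow> vact E' h x = g (vact E h (f x))"
  shows "equivariant_vbundle \<G> E'" and "vbundle_iso \<G> E' E"
proof -
  have cf: "continuous_map (vtotal E') (vtotal E) f" and cg: "continuous_map (vtotal E) (vtotal E') g"
    and gf: "\<And>x. x \<in> topspace (vtotal E') \<Longrightarrow> g (f x) = x"
    and fg: "\<And>y. y \<in> topspace (vtotal E) \<Longrightarrow> f (g y) = y"
    using hm by (auto simp: homeomorphic_maps_def)
  have ff: "f x \<in> vfibre E b" and gfx: "g (f x) = x" if "x \<in> vfibre E' b" for x b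
    using that cf pr gf by (auto simp: vfibre_def continuous_map_def)
  have gg: "g y \<in> vfibre E' b" and fgy: "f (g y) = y" if "y \<in> vfibre E b" for y b
    using that cg pr[of "g y"] fg by (auto simp: vfibre_def continuous_map_def)
  have fla: "fibrewise_linear_action \<G> E" and cpr: "continuous_map (vtotal E) euclidean (vproj E)"
    using E by (simp_all add: equivariant_vbundle_def)
  have cl: "vadd E x y \<in> vfibre E b" "vscale E c x \<in> vfibre E b"
    if "x \<in> vfibre E b" "y \<in> vfibre E b" for x y b c
    using fibrewise_linear_actionD[OF fla] that by blast+
  have cla: "vact E h x \<in> vfibre E b" if "h \<in> carrier (gfibre \<G> b)" "x \<in> vfibre E b" for x h b
    using fibrewise_linear_actionD[OF fla] that by blast
  have fvadd: "f (vadd E' x y) = vadd E (f x) (f y)" if "x \<in> vfibre E' b" "y \<in> vfibre E' b" for x y b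
    using add[OF that] fgy[OF cl(1)[OF ff[OF that(1)] ff[OF that(2)]]] by simp
  have fvscale: "f (vscale E' c x) = vscale E c (f x)" if "x \<in> vfibre E' b" for x b c
    using scale[OF that] fgy[OF cl(2)[OF ff[OF that] ff[OF that]]] by simp
  have fvact: "f (vact E' h x) = vact E h (f x)" if "h \<in> carrier (gfibre \<G> b)" "x \<in> vfibre E' b" for x b h
    using act[OF that] fgy[OF cla[OF that(1) ff[OF that(2)]]] by simp
  show "vbundle_iso \<G> E' E"
    by (rule vbundle_isoI[OF hm]) (use pr fvadd fvscale fvact in auto)
  have cpr': "continuous_map (vtotal E') euclidean (vproj E')"
    using continuous_map_compose[OF cf cpr] by (rule continuous_map_eq) (simp add: pr)
  have cl': "vadd E' x y \<in> vfibre E' b" "vscale E' c x \<in> vfibre E' b"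
    if "x \<in> vfibre E' b" "y \<in> vfibre E' b" for x y b c
    using add[OF that] scale[OF that(1)] gg[OF cl(1)[OF ff[OF that(1)] ff[OF that(2)]]]
      gg[OF cl(2)[OF ff[OF that(1)] ff[OF that(1)]]] by simp_all
  have cla': "vact E' h x \<in> vfibre E' b" if "h \<in> carrier (gfibre \<G> b)" "x \<in> vfibre E' b" for x h b
    using act[OF that] gg[OF cla[OF that(1) ff[OF that(2)]]] by simp
  have inj: "x = y" if "f x = f y" "x \<in> vfibre E' b" "y \<in> vfibre E' b" for x y b
    using that gfx by metis
  have grp: "group (gfibre \<G> b)" for b using car by (simp add: fibred_groups_def)
  have fla': "fibrewise_linear_action \<G> E'"
    unfolding fibrewise_linear_action_def
  proof (intro allI conjI ballI)
    fix b x assume x: "x \<in> vfibre E' b"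
    have "\<one>\<^bsub>gfibre \<G> b\<^esub> \<in> carrier (gfibre \<G> b)"
      using grp by (intro monoid.one_closed group.is_monoid)
    moreover have "vact E \<one>\<^bsub>gfibre \<G> b\<^esub> (f x) = f x"
      using fibrewise_linear_actionD(4)[OF fla ff[OF x]] .
    ultimately show "vact E' \<one>\<^bsub>gfibre \<G> b\<^esub> x = x"
      using act[OF _ x] gfx[OF x] by simp
  next
    fix b h k x assume a: "h \<in> carrier (gfibre \<G> b)" "k \<in> carrier (gfibre \<G> b)" "x \<in> vfibre E' b"
    have hk: "h \<otimes>\<^bsub>gfibre \<G> b\<^esub> k \<in> carrier (gfibre \<G> b)"
      using a grp by (intro monoid.m_closed group.is_monoid)
    have "vact E (h \<otimes>\<^bsub>gfibre \<G> b\<^esub> k) (f x) = vact E h (vact E k (f x))"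
      using fibrewise_linear_actionD(5)[OF fla ff[OF a(3)] a(1,2)] .
    then show "vact E' (h \<otimes>\<^bsub>gfibre \<G> b\<^esub> k) x = vact E' h (vact E' k x)"
      using act[OF hk a(3)] act[OF a(1) cla'[OF a(2,3)]] fvact[OF a(2,3)] by simp
  next
    fix b h x y assume a: "h \<in> carrier (gfibre \<G> b)" "x \<in> vfibre E' b" "y \<in> vfibre E' b"
    have "f (vact E' h (vadd E' x y)) = f (vadd E' (vact E' h x) (vact E' h y))"
      using fibrewise_linear_actionD(6)[OF fla ff[OF a(2)] a(1) ff[OF a(3)]]
      by (simp add: fvact[OF a(1) cl'(1)[OF a(2,3)]] fvadd[OF a(2,3)] fvact[OF a(1,2)] fvact[OF a(1,3)]
          fvadd[OF cla'[OF a(1,2)] cla'[OF a(1,3)]])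
    then show "vact E' h (vadd E' x y) = vadd E' (vact E' h x) (vact E' h y)"
      by (rule inj[OF _ cla'[OF a(1) cl'(1)[OF a(2,3)]] cl'(1)[OF cla'[OF a(1,2)] cla'[OF a(1,3)]]])
  next
    fix b h c x assume a: "h \<in> carrier (gfibre \<G> b)" "x \<in> vfibre E' b"
    have "f (vact E' h (vscale E' c x)) = f (vscale E' c (vact E' h x))"
      using fibrewise_linear_actionD(7)[OF fla ff[OF a(2)] a(1)]
      by (simp add: fvact[OF a(1) cl'(2)[OF a(2,2)]] fvscale[OF a(2)] fvact[OF a]
          fvscale[OF cla'[OF a]])
    then show "vact E' h (vscale E' c x) = vscale E' c (vact E' h x)"
      by (rule inj[OF _ cla'[OF a(1) cl'(2)[OF a(2,2)]] cl'(2)[OF cla'[OF a] cla'[OF a]]])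
  qed (use cl' cla' in blast)+
  show "equivariant_vbundle \<G> E'"
    unfolding equivariant_vbundle_def
  proof (intro conjI allI)
    show "\<exists>n U \<phi>. b \<in> U \<and> vtriv E' n U \<phi>" for b
    proof -
      obtain n U \<phi> where b: "b \<in> U" and t: "vtriv E n U \<phi>" using E unfolding equivariant_vbundle_def by blast
      obtain s where s:
        "continuous_map (prod_topology (top_of_set U) (top_of_set (Cspace n))) (vtotal E) (\<lambda>(b, z). s b z)"
        "continuous_map (subtopology (vtotal E) {x. vproj E x \<in> U}) euclidean \<phi>"
        "\<And>b z. b \<in> U \<Longrightarrow> z \<in> Cspace n \<Longrightarrow> s b z \<in> vfibre E b \<and> \<phi> (s b z) = z"
        "\<And>b x. b \<in> U \<Longrightarrow> x \<in> vfibre E b \<Longrightarrow> \<phi> x \<in> Cspace n \<and> s b (\<phi> x) = x"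
        "open U"
        by (rule vtrivE[OF t]) (rule that)
      have "vtriv E' n U (\<lambda>x. \<phi> (f x))"
      proof (rule vtrivI[OF s(5) cpr', where s="\<lambda>b z. g (s b z)"])
        show "continuous_map (prod_topology (top_of_set U) (top_of_set (Cspace n))) (vtotal E') (\<lambda>(b, z). g (s b z))"
          using continuous_map_compose[OF s(1) cg] by (simp add: comp_def case_prod_unfold)
        have "continuous_map (subtopology (vtotal E') {x. vproj E' x \<in> U})
            (subtopology (vtotal E) {x. vproj E x \<in> U}) f"
          using continuous_map_from_subtopology[OF cf] pr by (auto simp: continuous_map_in_subtopology)
        from continuous_map_compose[OF this s(2)]
        show "continuous_map (subtopology (vtotal E') {x. vproj E' x \<in> U}) euclidean (\<lambda>x. \<phi> (f x))"
          by (simp add: comp_def)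
      next
        fix b z assume b: "b \<in> U" "z \<in> Cspace n"
        show "g (s b z) \<in> vfibre E' b \<and> \<phi> (f (g (s b z))) = z"
          using s(3)[OF b] gg fgy[of "s b z" b] by simp
      next
        fix b x y assume x: "b \<in> U" "x \<in> vfibre E' b" "y \<in> vfibre E' b"
        show "\<phi> (f (vadd E' x y)) = (\<lambda>i. \<phi> (f x) i + \<phi> (f y) i)"
          using t x(1) ff[OF x(2)] ff[OF x(3)] fvadd[OF x(2,3)] by (simp add: vtriv_def)
      next
        fix b c x assume x: "b \<in> U" "x \<in> vfibre E' b"
        show "\<phi> (f (vscale E' c x)) = (\<lambda>i. c * \<phi> (f x) i)"
          using t x(1) ff[OF x(2)] fvscale[OF x(2)] by (simp add: vtriv_def)
      qed (use s ff gg fgy gfx in auto)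
      then show ?thesis using b by blast
    qed
    let ?X = "subtopology (prod_topology (gtotal \<G>) (vtotal E')) {(g, x). gproj \<G> g = vproj E' x}"
    let ?Y = "subtopology (prod_topology (gtotal \<G>) (vtotal E)) {(g, x). gproj \<G> g = vproj E x}"
    have c1: "continuous_map ?X (gtotal \<G>) fst" and c2: "continuous_map ?X (vtotal E') snd"
      by (auto intro: continuous_map_from_subtopology continuous_map_fst continuous_map_snd)
    have d1: "continuous_map ?X ?Y (\<lambda>p. (fst p, f (snd p)))"
      using c1 continuous_map_compose[OF c2 cf] pr
      by (auto simp: continuous_map_in_subtopology continuous_map_paired comp_def)
    have d2: "continuous_map ?Y (vtotal E) (\<lambda>(g, x). vact E g x)"
      using E by (simp add: equivariant_vbundle_def)
    have "continuous_map ?X (vtotal E') (g \<circ> ((\<lambda>(g, x). vact E g x) \<circ> (\<lambda>p. (fst p, f (snd p)))))"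
      by (rule continuous_map_compose[OF continuous_map_compose[OF d1 d2] cg])
    then show "continuous_map ?X (vtotal E') (\<lambda>(g, x). vact E' g x)"
    proof (rule continuous_map_eq)
      fix p assume p: "p \<in> topspace ?X"
      obtain h x where pq: "p = (h, x)" by (cases p) auto
      have "h \<in> carrier (gfibre \<G> (vproj E' x))" "x \<in> vfibre E' (vproj E' x)"
        using p car by (auto simp: pq fibred_groups_def vfibre_def)
      then show "(g \<circ> ((\<lambda>(g, x). vact E g x) \<circ> (\<lambda>p. (fst p, f (snd p))))) p = (\<lambda>(g, x). vact E' g x) p"
        using act by (auto simp: pq)
    qed
  qed (rule cpr' fla')+
qed

text \<open>Any fibrewise injective choice of coordinates, however discontinuous in b, will do.\<close>

lemma ex_std_vbundle:
  fixes E :: "('b::topological_space, 'g, 'e, 'y) vbundle_scheme"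
  assumes car: "fibred_groups \<G>" and E: "equivariant_vbundle \<G> E"
  obtains V :: "('b, 'g) std_vbundle" where "equivariant_vbundle \<G> V" "vbundle_iso \<G> V E"
proof -
  have "\<forall>b. \<exists>\<phi> :: 'e \<Rightarrow> nat \<Rightarrow> complex. inj_on \<phi> (vfibre E b)"
  proof
    fix b
    obtain n U \<phi> where b: "b \<in> U" and t: "vtriv E n U \<phi>" using E unfolding equivariant_vbundle_def by blast
    then obtain s where "\<And>b x. b \<in> U \<Longrightarrow> x \<in> vfibre E b \<Longrightarrow> \<phi> x \<in> Cspace n \<and> s b (\<phi> x) = x"
      using vtrivE[OF t] by metis
    then have "inj_on \<phi> (vfibre E b)" using b by (intro inj_on_inverseI[where g="s b"]) blast
    then show "\<exists>\<phi> :: 'e \<Rightarrow> nat \<Rightarrow> complex. inj_on \<phi> (vfibre E b)" by blast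
  qed
  then obtain \<phi> :: "'b \<Rightarrow> 'e \<Rightarrow> nat \<Rightarrow> complex" where \<phi>: "\<And>b. inj_on (\<phi> b) (vfibre E b)" by metis
  \<comment> \<open>The base point is recorded, so injectivity within each fibre already makes
    \<open>j\<close> injective on the whole total space.\<close>
  define j where "j x = (vproj E x, \<phi> (vproj E x) x)" for x
  define f where "f = inv_into (topspace (vtotal E)) j"
  define J where "J = j ` topspace (vtotal E)"
  have inj: "inj_on j (topspace (vtotal E))"
    using \<phi> by (auto simp: inj_on_def j_def vfibre_def)
  have fj: "f (j x) = x" if "x \<in> topspace (vtotal E)" for x
    unfolding f_def using inj that by (rule inv_into_f_f)
  have jf: "j (f p) = p" "f p \<in> topspace (vtotal E)" if "p \<in> J" for p
    using that fj by (auto simp: J_def)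
  \<comment> \<open>The topology is pulled back along \<open>f\<close> and is in general not the
    subspace topology of the product; this is what tolerates discontinuous coordinates.\<close>
  define V :: "('b, 'g) std_vbundle" where
    "V = \<lparr>vtotal = pullback_topology J f (vtotal E), vproj = fst,
       vadd = (\<lambda>p q. j (vadd E (f p) (f q))), vscale = (\<lambda>c p. j (vscale E c (f p))),
       vact = (\<lambda>g p. j (vact E g (f p)))\<rparr>"
  have top: "topspace (vtotal V) = J"
    using jf by (auto simp: V_def topspace_pullback_topology)
  have hm: "homeomorphic_maps (vtotal V) (vtotal E) f j"
    unfolding homeomorphic_maps_def
  proof (intro conjI ballI)
    show "continuous_map (vtotal V) (vtotal E) f"
      using continuous_map_pullback[OF continuous_map_id, of J f "vtotal E"] by (simp add: V_def)
    have "continuous_map (vtotal E) (vtotal E) (f \<circ> j)"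
      by (rule continuous_map_eq[OF continuous_map_id]) (simp add: fj)
    then show "continuous_map (vtotal E) (vtotal V) j"
      unfolding V_def by (auto simp: J_def intro!: continuous_map_pullback')
  qed (use fj jf top in auto)
  have pr: "vproj V p = vproj E (f p)" if "p \<in> topspace (vtotal V)" for p
    using jf(1)[of p] that top by (auto simp: V_def j_def) (metis fst_conv)
  show ?thesis
    by (rule that[of V]; rule equivariant_transport[OF car E hm pr]) (simp_all add: V_def)
qed


subsection \<open>The monoid of isomorphism classes\<close>

text \<open>Kernel and cokernel bundles live on the total space types of the Hilbert bundles;
  replacing them by standard representatives brings their classes into the monoid.\<close>

lemma vbundle_class_in_carrier:
  fixes E :: "('b::topological_space, 'g, 'e, 'y) vbundle_scheme"
  assumes car: "fibred_groups \<G>" and E: "equivariant_vbundle \<G> E"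
  shows "vbundle_class \<G> E \<in> carrier (vbundle_monoid \<G>)"
proof -
  obtain V :: "('b, 'g) std_vbundle" where "equivariant_vbundle \<G> V" "vbundle_iso \<G> V E"
    by (rule ex_std_vbundle[OF car E]) (rule that)
  moreover from this have "vbundle_class \<G> V = vbundle_class \<G> E"
    by (intro vbundle_class_eq) (auto simp: equivariant_vbundle_def)
  ultimately show ?thesis unfolding vbundle_monoid_def by auto
qed

text \<open>Sums of isomorphic bundles are isomorphic, so the union defining the product consists of
  equal sets; \<open>ex_std_vbundle\<close> shows that it is not an empty union.\<close>

lemma mult_vbundle_class:
  fixes E :: "('b::topological_space, 'g, 'e, 'y) vbundle_scheme"
    and E' :: "('b, 'g, 'f, 'z) vbundle_scheme"
  assumes car: "fibred_groups \<G>" and E: "equivariant_vbundle \<G> E" and E': "equivariant_vbundle \<G> E'"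
  shows "vbundle_class \<G> E \<otimes>\<^bsub>vbundle_monoid \<G>\<^esub> vbundle_class \<G> E' = vbundle_class \<G> (vsum E E')"
proof -
  have *: "vbundle_class \<G> (vsum V W) = vbundle_class \<G> (vsum E E')"
    if "V \<in> vbundle_class \<G> E" "W \<in> vbundle_class \<G> E'" for V W
    using that by (intro vbundle_class_eq vsum_iso_cong fibrewise_linear_action_vsum)
      (auto simp: vbundle_class_def equivariant_vbundle_def)
  have ne: "vbundle_class \<G> E \<noteq> {}"
    by (rule ex_std_vbundle[OF car E]) (auto simp: vbundle_class_def)
  have ne': "vbundle_class \<G> E' \<noteq> {}"
    by (rule ex_std_vbundle[OF car E']) (auto simp: vbundle_class_def)
  have "vbundle_class \<G> E \<otimes>\<^bsub>vbundle_monoid \<G>\<^esub> vbundle_class \<G> E' =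
      (\<Union>V\<in>vbundle_class \<G> E. \<Union>W\<in>vbundle_class \<G> E'. vbundle_class \<G> (vsum V W))"
    by (simp add: vbundle_monoid_def)
  also have "\<dots> = (\<Union>V\<in>vbundle_class \<G> E. \<Union>W\<in>vbundle_class \<G> E'. vbundle_class \<G> (vsum E E'))"
    by (intro SUP_cong refl) (simp add: *)
  also have "\<dots> = vbundle_class \<G> (vsum E E')" using ne ne' by auto
  finally show ?thesis .
qed

lemma comm_monoid_vbundle_monoid:
  fixes \<G> :: "('b::topological_space, 'g) group_family"
  assumes car: "fibred_groups \<G>"
  shows "comm_monoid (vbundle_monoid \<G>)"
proof -
  have carE: "\<exists>V :: ('b, 'g) std_vbundle. X = vbundle_class \<G> V \<and> equivariant_vbundle \<G> V"
    if "X \<in> carrier (vbundle_monoid \<G>)" for X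
    using that by (auto simp: vbundle_monoid_def)
  have fla: "fibrewise_linear_action \<G> E" if "equivariant_vbundle \<G> E" for E :: "('b, 'g, 'x, 'y) vbundle_scheme"
    using that by (simp add: equivariant_vbundle_def)
  have one: "\<one>\<^bsub>vbundle_monoid \<G>\<^esub> = vbundle_class \<G> vzero" by (simp add: vbundle_monoid_def)
  show ?thesis
  proof (rule comm_monoidI)
    show "\<one>\<^bsub>vbundle_monoid \<G>\<^esub> \<in> carrier (vbundle_monoid \<G>)"
      unfolding one using car equivariant_vzero by (rule vbundle_class_in_carrier)
  next
    fix X Y assume "X \<in> carrier (vbundle_monoid \<G>)" "Y \<in> carrier (vbundle_monoid \<G>)"
    then obtain V W :: "('b, 'g) std_vbundle" where X: "X = vbundle_class \<G> V" "equivariant_vbundle \<G> V"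
      and Y: "Y = vbundle_class \<G> W" "equivariant_vbundle \<G> W"
      using carE by metis
    show "X \<otimes>\<^bsub>vbundle_monoid \<G>\<^esub> Y \<in> carrier (vbundle_monoid \<G>)"
      using car X Y by (simp add: mult_vbundle_class vbundle_class_in_carrier equivariant_vsum)
    show "X \<otimes>\<^bsub>vbundle_monoid \<G>\<^esub> Y = Y \<otimes>\<^bsub>vbundle_monoid \<G>\<^esub> X"
      using vbundle_class_eq[OF fla vsum_comm, of "V" W] car X Y
      by (simp add: mult_vbundle_class equivariant_vsum)
  next
    fix X Y Z assume "X \<in> carrier (vbundle_monoid \<G>)" "Y \<in> carrier (vbundle_monoid \<G>)"
      "Z \<in> carrier (vbundle_monoid \<G>)"
    then obtain V W U :: "('b, 'g) std_vbundle" where X: "X = vbundle_class \<G> V" "equivariant_vbundle \<G> V"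
      and Y: "Y = vbundle_class \<G> W" "equivariant_vbundle \<G> W"
      and Z: "Z = vbundle_class \<G> U" "equivariant_vbundle \<G> U"
      using carE by metis
    show "X \<otimes>\<^bsub>vbundle_monoid \<G>\<^esub> Y \<otimes>\<^bsub>vbundle_monoid \<G>\<^esub> Z = X \<otimes>\<^bsub>vbundle_monoid \<G>\<^esub> (Y \<otimes>\<^bsub>vbundle_monoid \<G>\<^esub> Z)"
      using vbundle_class_eq[OF fla vsum_assoc, of "V" W U] car X Y Z
      by (simp add: mult_vbundle_class equivariant_vsum)
  next
    fix X assume "X \<in> carrier (vbundle_monoid \<G>)"
    then obtain V :: "('b, 'g) std_vbundle" where X: "X = vbundle_class \<G> V" "equivariant_vbundle \<G> V"
      using carE by metis
    have "vbundle_iso \<G> (vsum vzero V) V"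
      using X(2) by (intro vsum_vzero) (simp add: equivariant_vbundle_def)
    then have "vbundle_class \<G> (vsum vzero V) = vbundle_class \<G> V"
      using X(2) equivariant_vzero
      by (intro vbundle_class_eq fibrewise_linear_action_vsum) (auto simp: equivariant_vbundle_def)
    then show "\<one>\<^bsub>vbundle_monoid \<G>\<^esub> \<otimes>\<^bsub>vbundle_monoid \<G>\<^esub> X = X"
      using car X unfolding one by (simp add: mult_vbundle_class equivariant_vzero)
  qed
qed


section \<open>Complex Hilbert spaces\<close>

lemma cinner_cscale_right: "cinner (x::'v::complex_hilbert) (cscale c y) = cnj c * cinner x y"
  by (metis cinner_commute cinner_cscale_left complex_cnj_mult)

lemma norm_cscale: "norm (cscale c (x::'v::complex_hilbert)) = cmod c * norm x"
proof -
  have "cinner (cscale c x) (cscale c x) = complex_of_real ((cmod c)\<^sup>2) * cinner x x"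
    unfolding complex_norm_square by (simp add: cinner_cscale_left cinner_cscale_right mult.assoc)
  then have "Re (cinner (cscale c x) (cscale c x)) = (cmod c)\<^sup>2 * Re (cinner x x)"
    by (simp del: of_real_power)
  then have "(norm (cscale c x))\<^sup>2 = (cmod c * norm x)\<^sup>2"
    unfolding Re_cinner power_mult_distrib by (simp only: power2_norm_eq_inner)
  then show ?thesis by (simp add: power2_eq_iff_nonneg)
qed

lemma cscale_zero [simp]: "cscale c (0::'v::complex_hilbert) = 0"
  using cscale_add_right[of c "0::'v" 0] by simp

lemma cscale_0_left [simp]: "cscale 0 (x::'v::complex_hilbert) = 0"
  using cscale_of_real[of 0 x] by simp

lemma cscale_minus_right: "cscale c (- x :: 'v::complex_hilbert) = - cscale c x"
  using cscale_add_right[of c x "- x"] by (simp add: minus_unique)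

lemma cscale_diff_right: "cscale c (x - y :: 'v::complex_hilbert) = cscale c x - cscale c y"
  using cscale_add_right[of c x "- y"] by (simp add: cscale_minus_right)

lemma scaleR_cscale: "r *\<^sub>R cscale c (x::'v::complex_hilbert) = cscale (complex_of_real r * c) x"
  by (metis cscale_cscale cscale_of_real)

lemma cscale_1 [simp]: "cscale 1 (x::'v::complex_hilbert) = x"
  using cscale_of_real[of 1 x] by simp

text \<open>The imaginary part of \<open>cinner x y\<close> is the real inner product of
  \<open>x\<close> with \<open>cscale \<i> y\<close>. Thus Hermitian orthogonality to a set closed
  under complex scalars is real orthogonality, and the real theory of projections suffices.\<close>

lemma cinner_eq_0_iff_inner:
  fixes x :: "'v::complex_hilbert"
  assumes "\<And>c y. y \<in> S \<Longrightarrow> cscale c y \<in> S"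
  shows "(\<forall>y\<in>S. cinner x y = 0) \<longleftrightarrow> (\<forall>y\<in>S. inner x y = 0)"
proof safe
  fix y assume "\<forall>y\<in>S. cinner x y = 0" "y \<in> S"
  then show "inner x y = 0" by (simp flip: Re_cinner)
next
  fix y assume a: "\<forall>y\<in>S. inner x y = 0" "y \<in> S"
  then have "inner x y = 0" "inner x (cscale \<i> y) = 0" using assms by auto
  then show "cinner x y = 0"
    by (simp add: cinner_cscale_right complex_eq_iff flip: Re_cinner)
qed

text \<open>\<open>M\<close> expresses the linear independence of the frame at \<open>b0\<close>
  quantitatively. Moving the frame vectors by \<open>\<delta>\<close> moves a combination by at most
  \<open>n * M * \<delta>\<close> times its norm at \<open>b0\<close>, so the same coefficients
  provide the approximating vector in both directions.\<close>

lemma continuous_subspaces_at_basis: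
  fixes e :: "nat \<Rightarrow> 'b::topological_space \<Rightarrow> 'v::complex_hilbert"
  assumes lim: "\<And>i. i < n \<Longrightarrow> (e i \<longlongrightarrow> e i b0) (nhds b0)"
    and K: "\<forall>\<^sub>F b in nhds b0. K b = range (\<lambda>c. \<Sum>i<n. cscale (c i) (e i b))"
    and M: "M > 0" "\<And>c i. i < n \<Longrightarrow> cmod (c i) \<le> M * norm (\<Sum>i<n. cscale (c i) (e i b0))"
  shows "continuous_subspaces_at K b0"
proof -
  define comb where "comb b c = (\<Sum>i<n. cscale (c i) (e i b))" for b c
  have K': "\<forall>\<^sub>F b in nhds b0. K b = range (comb b)" using K by (simp add: comb_def[abs_def])
  then have K0: "K b0 = range (comb b0)" by (rule eventually_nhds_x_imp_x)
  have sub: "subspace (range (comb b))" for b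
  proof (rule subspaceI)
    have "comb b (\<lambda>_. 0) = 0" by (simp add: comb_def)
    then show "0 \<in> range (comb b)" by (metis rangeI)
  next
    fix x y assume "x \<in> range (comb b)" "y \<in> range (comb b)"
    then obtain c d where "x = comb b c" "y = comb b d" by blast
    then have "x + y = comb b (\<lambda>i. c i + d i)"
      by (simp add: comb_def cscale_add_left sum.distrib)
    then show "x + y \<in> range (comb b)" by blast
  next
    fix r x assume "x \<in> range (comb b)"
    then obtain c where "x = comb b c" by blast
    then have "r *\<^sub>R x = comb b (\<lambda>i. complex_of_real r * c i)"
      by (simp add: comb_def scaleR_sum_right scaleR_cscale)
    then show "r *\<^sub>R x \<in> range (comb b)" by blast
  qed
  \<comment> \<open>The complex span is written as the real span of the frame and its multiples by
    \<open>\<i>\<close>, so that projections exist by \<open>finite_span_is_proj\<close>.\<close>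
  have "range (comb b0) = span ((\<lambda>i. e i b0) ` {..<n} \<union> (\<lambda>i. cscale \<i> (e i b0)) ` {..<n})" (is "_ = span ?R")
  proof
    have "cscale c (e i b0) \<in> span ?R" if "i < n" for c i
    proof -
      have "cscale c (e i b0) = cscale (complex_of_real (Re c) + complex_of_real (Im c) * \<i>) (e i b0)"
        using complex_eq[of c] by (simp only: mult.commute)
      also have "\<dots> = Re c *\<^sub>R e i b0 + Im c *\<^sub>R cscale \<i> (e i b0)"
        by (simp only: cscale_add_left cscale_of_real scaleR_cscale)
      also have "\<dots> \<in> span ?R"
        using that by (intro span_add span_scale span_base) auto
      finally show ?thesis .
    qed
    then show "range (comb b0) \<subseteq> span ?R" by (auto simp: comb_def intro!: span_sum)
    have "cscale a (e i b0) \<in> range (comb b0)" if "i < n" for i a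
    proof -
      have "comb b0 (\<lambda>j. if j = i then a else 0) = (\<Sum>j<n. if j = i then cscale a (e i b0) else 0)"
        unfolding comb_def by (intro sum.cong) auto
      also have "\<dots> = cscale a (e i b0)" using that by simp
      finally show ?thesis by (metis rangeI)
    qed
    from this[where a=1] this[where a=\<i>] show "span ?R \<subseteq> range (comb b0)"
      by (intro span_minimal sub) auto
  qed
  then have proj: "\<exists>p. is_proj (K b0) v p" for v
    unfolding K0 using finite_span_is_proj[of ?R v] by simp
  have close: "\<forall>\<^sub>F b in nhds b0. \<forall>c. norm (comb b c - comb b0 c) \<le> \<eta> * norm (comb b0 c)" if \<eta>: "\<eta> > 0" for \<eta>
  proof -
    \<comment> \<open>Chosen so that \<open>n * M * \<delta> \<le> \<eta>\<close>; the summand 1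
      covers \<open>n = 0\<close>.\<close>
    define \<delta> where "\<delta> = \<eta> / (real n * M + 1)"
    have den: "real n * M + 1 > 0" using M(1) by (simp add: add_nonneg_pos)
    have \<delta>: "\<delta> > 0" using \<eta> den by (simp add: \<delta>_def)
    have n\<delta>: "real n * M * \<delta> \<le> \<eta>"
    proof -
      have "(real n * M + 1) * \<delta> = \<eta>" using den by (simp add: \<delta>_def)
      then show ?thesis using \<delta> by (simp add: algebra_simps)
    qed
    have "\<forall>\<^sub>F b in nhds b0. \<forall>i\<in>{..<n}. dist (e i b) (e i b0) < \<delta>"
      using lim \<delta> by (intro eventually_ball_finite) (auto intro: tendstoD)
    then show ?thesis
    proof eventually_elim
      case (elim b)
      show ?case
      proof
        fix c
        have "norm (comb b c - comb b0 c) = norm (\<Sum>i<n. cscale (c i) (e i b - e i b0))"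
          by (simp add: comb_def cscale_diff_right sum_subtractf)
        also have "\<dots> \<le> (\<Sum>i<n. norm (cscale (c i) (e i b - e i b0)))" by (rule norm_sum)
        also have "\<dots> \<le> (\<Sum>i<n. (M * norm (comb b0 c)) * \<delta>)"
        proof (rule sum_mono)
          fix i assume "i \<in> {..<n}"
          then show "norm (cscale (c i) (e i b - e i b0)) \<le> (M * norm (comb b0 c)) * \<delta>"
            using elim M(2)[of i c] M(1) \<delta> unfolding norm_cscale
            by (intro mult_mono) (auto simp: comb_def dist_norm less_imp_le)
        qed
        also have "\<dots> = (real n * M * \<delta>) * norm (comb b0 c)" by simp
        also have "\<dots> \<le> \<eta> * norm (comb b0 c)" using n\<delta> by (intro mult_right_mono) auto
        finally show "norm (comb b c - comb b0 c) \<le> \<eta> * norm (comb b0 c)" .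
      qed
    qed
  qed
  show ?thesis
    unfolding continuous_subspaces_at_def
  proof (intro conjI allI impI)
    show "\<forall>\<^sub>F b in nhds b0. subspace (K b)"
      using K' by eventually_elim (simp add: sub)
    show "\<exists>p. is_proj (K b0) v p" for v by (rule proj)
    fix \<epsilon> :: real assume \<epsilon>: "\<epsilon> > 0"
    \<comment> \<open>The bound 1/2 gives \<open>norm (comb b0 c) \<le> 2 * norm (comb b c)\<close>,
      which turns an error relative to the fibre at \<open>b0\<close> into one relative to the fibre
      at \<open>b\<close>; the bound \<open>\<epsilon> / 2\<close> pays for this factor 2.\<close>
    define \<eta> where "\<eta> = min (\<epsilon> / 2) (1 / 2)"
    have \<eta>: "\<eta> > 0" "\<eta> \<le> \<epsilon> / 2" "\<eta> \<le> 1 / 2" using \<epsilon> by (auto simp: \<eta>_def)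
    show "\<forall>\<^sub>F b in nhds b0. (\<forall>k\<in>K b0. \<exists>k'\<in>K b. norm (k - k') \<le> \<epsilon> * norm k) \<and>
        (\<forall>k'\<in>K b. \<exists>k\<in>K b0. norm (k' - k) \<le> \<epsilon> * norm k')"
      using close[OF \<eta>(1)] K'
    proof eventually_elim
      case (elim b)
      have 1: "norm (comb b0 c - comb b c) \<le> \<epsilon> * norm (comb b0 c)" for c
      proof -
        have "\<eta> * norm (comb b0 c) \<le> \<epsilon> * norm (comb b0 c)"
          using \<eta> \<epsilon> by (intro mult_right_mono) auto
        then show ?thesis using elim(1)[rule_format, of c] by (simp add: norm_minus_commute)
      qed
      have 2: "norm (comb b c - comb b0 c) \<le> \<epsilon> * norm (comb b c)" for c
      proof -
        have a: "norm (comb b c - comb b0 c) \<le> \<eta> * norm (comb b0 c)" using elim(1) by blast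
        have "\<eta> * norm (comb b0 c) \<le> 1 / 2 * norm (comb b0 c)"
          using \<eta> by (intro mult_right_mono) auto
        then have "norm (comb b0 c) \<le> 2 * norm (comb b c)"
          using a norm_triangle_ineq2[of "comb b0 c" "comb b c"] by (simp add: norm_minus_commute)
        then have "\<eta> * norm (comb b0 c) \<le> \<epsilon> / 2 * (2 * norm (comb b c))"
          using \<eta> \<epsilon> by (intro mult_mono) auto
        then show ?thesis using a by simp
      qed
      show ?case unfolding elim(2) K0 using 1 2 by blast
    qed
  qed
qed

text \<open>\<open>L\<close> is linear only on \<open>Cspace n\<close>, so \<open>z\<close> is built
  up from its truncations, all of which stay in \<open>Cspace n\<close>.\<close>

lemma Cspace_expand:
  fixes L :: "(nat \<Rightarrow> complex) \<Rightarrow> 'v::complex_hilbert"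
  assumes add: "\<And>x y. x \<in> Cspace n \<Longrightarrow> y \<in> Cspace n \<Longrightarrow> L (\<lambda>i. x i + y i) = L x + L y"
    and scale: "\<And>c x. x \<in> Cspace n \<Longrightarrow> L (\<lambda>i. c * x i) = cscale c (L x)"
    and z: "z \<in> Cspace n"
  shows "L z = (\<Sum>i<n. cscale (z i) (L (\<lambda>j. if j = i then 1 else 0)))"
proof -
  have "L (\<lambda>i. if i < m then z i else 0) = (\<Sum>i<m. cscale (z i) (L (\<lambda>j. if j = i then 1 else 0)))"
    if "m \<le> n" for m
    using that
  proof (induction m)
    case 0
    have "L (\<lambda>i. 0 * z i) = cscale 0 (L z)" using scale[OF z] .
    then show ?case by simp
  next
    case (Suc m)
    have d: "(\<lambda>j. if j = m then 1 else 0) \<in> Cspace n" using Suc.prems by (auto simp: Cspace_def)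
    have d': "(\<lambda>j. z m * (if j = m then 1 else 0)) \<in> Cspace n" using Suc.prems by (auto simp: Cspace_def)
    have z': "(\<lambda>i. if i < m then z i else 0) \<in> Cspace n" using z by (auto simp: Cspace_def)
    have "(\<lambda>i. if i < Suc m then z i else 0) =
        (\<lambda>i. (if i < m then z i else 0) + z m * (if i = m then 1 else 0))"
      by (auto simp: fun_eq_iff less_Suc_eq)
    then show ?case using Suc add[OF z' d'] scale[OF d, of "z m"] by simp
  qed
  from this[of n] have "L (\<lambda>i. if i < n then z i else 0) = (\<Sum>i<n. cscale (z i) (L (\<lambda>j. if j = i then 1 else 0)))"
    by simp
  moreover have "(\<lambda>i. if i < n then z i else 0) = z" using z by (auto simp: Cspace_def fun_eq_iff)
  ultimately show ?thesis by simp
qed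

section \<open>Trivializations of Hilbert bundles\<close>

text \<open>The inverse chart is given as \<open>inv_into\<close> on a fibre, because this is how
  \<open>hilbert_bundle\<close> and \<open>fredholm_family\<close> express families in a
  trivialization.\<close>

lemma htriv_inv_into:
  fixes H :: "('b::topological_space, 'g, 'e, 'v::complex_hilbert) hbundle"
  assumes "htriv H U \<phi>"
  shows "open U"
    and "b \<in> U \<Longrightarrow> inv_into (vfibre H b) \<phi> v \<in> vfibre H b"
    and "b \<in> U \<Longrightarrow> \<phi> (inv_into (vfibre H b) \<phi> v) = v"
    and "b \<in> U \<Longrightarrow> x \<in> vfibre H b \<Longrightarrow> inv_into (vfibre H b) \<phi> (\<phi> x) = x"
    and "continuous_map (prod_topology (top_of_set U) euclidean) (vtotal H)
           (\<lambda>(b, v). inv_into (vfibre H b) \<phi> v)"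
    and "continuous_map (subtopology (vtotal H) {x. vproj H x \<in> U}) euclidean \<phi>"
proof -
  show "open U" using assms by (simp add: htriv_def)
  let ?P = "prod_topology (top_of_set U) (euclidean :: 'v topology)"
  let ?S = "subtopology (vtotal H) {x. vproj H x \<in> U}"
  obtain g where g: "homeomorphic_maps ?S ?P (\<lambda>x. (vproj H x, \<phi> x)) g"
    using assms unfolding htriv_def homeomorphic_map_maps by blast
  have c1: "continuous_map ?S ?P (\<lambda>x. (vproj H x, \<phi> x))" and c2: "continuous_map ?P ?S g"
    and gf: "\<And>x. x \<in> topspace ?S \<Longrightarrow> g (vproj H x, \<phi> x) = x"
    and fg: "\<And>p. p \<in> topspace ?P \<Longrightarrow> (vproj H (g p), \<phi> (g p)) = p"
    using g unfolding homeomorphic_maps_def by auto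
  have gt: "g p \<in> topspace ?S" if "p \<in> topspace ?P" for p
    using c2 that by (auto simp: continuous_map_def)
  have gb: "g (b, v) \<in> vfibre H b" "\<phi> (g (b, v)) = v" if "b \<in> U" for b v
    using gt[of "(b, v)"] fg[of "(b, v)"] that by (auto simp: vfibre_def)
  have gx: "g (b, \<phi> x) = x" if "b \<in> U" "x \<in> vfibre H b" for b x
    using gf[of x] that by (auto simp: vfibre_def)
  have inj: "inj_on \<phi> (vfibre H b)" if "b \<in> U" for b
    using gx[OF that] by (rule inj_on_inverseI)
  have inv: "inv_into (vfibre H b) \<phi> v = g (b, v)" if "b \<in> U" for b v
    using inv_into_f_f[OF inj[OF that] gb(1)[OF that]] gb(2)[OF that] by metis
  show "b \<in> U \<Longrightarrow> inv_into (vfibre H b) \<phi> v \<in> vfibre H b"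
    and "b \<in> U \<Longrightarrow> \<phi> (inv_into (vfibre H b) \<phi> v) = v"
    and "b \<in> U \<Longrightarrow> x \<in> vfibre H b \<Longrightarrow> inv_into (vfibre H b) \<phi> (\<phi> x) = x"
    by (simp_all add: inv gb gx)
  have "continuous_map ?P (vtotal H) g" using c2 by (simp add: continuous_map_in_subtopology)
  then show "continuous_map ?P (vtotal H) (\<lambda>(b, v). inv_into (vfibre H b) \<phi> v)"
    by (rule continuous_map_eq) (auto simp: inv)
  show "continuous_map ?S euclidean \<phi>" using c1 unfolding continuous_map_paired by blast
qed

lemma htriv_inj: "htriv H U \<phi> \<Longrightarrow> b \<in> U \<Longrightarrow> x \<in> vfibre H b \<Longrightarrow> y \<in> vfibre H b \<Longrightarrow> \<phi> x = \<phi> y \<Longrightarrow> x = y"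
  by (metis htriv_inv_into(4))

lemma htriv_linear:
  assumes "htriv H U \<phi>" "b \<in> U" "x \<in> vfibre H b"
  shows "y \<in> vfibre H b \<Longrightarrow> \<phi> (vadd H x y) = \<phi> x + \<phi> y"
    and "y \<in> vfibre H b \<Longrightarrow> hinner H x y = cinner (\<phi> x) (\<phi> y)"
    and "\<phi> (vscale H c x) = cscale c (\<phi> x)"
  using assms by (simp_all add: htriv_def)

text \<open>Convergence in the total space is tested in one chart, on base points and Hilbert space
  coordinates; \<open>htriv_tendsto\<close> is the converse. Total spaces are abstract topologies,
  hence \<open>limitin\<close>, while the coordinates allow norm estimates.\<close>

lemma limitin_htrivI:
  fixes H :: "('b::topological_space, 'g, 'e, 'v::complex_hilbert) hbundle"
  assumes t: "htriv H U \<phi>" and b0: "b0 \<in> U" and l: "l \<in> vfibre H b0"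
    and \<beta>: "(\<beta> \<longlongrightarrow> b0) Fl" and y: "((\<lambda>p. \<phi> (y p)) \<longlongrightarrow> \<phi> l) Fl"
    and fib: "\<forall>\<^sub>F p in Fl. y p \<in> vfibre H (\<beta> p)"
  shows "limitin (vtotal H) y l Fl"
proof -
  have ev: "\<forall>\<^sub>F p in Fl. \<beta> p \<in> U"
    by (rule topological_tendstoD[OF \<beta> htriv_inv_into(1)[OF t] b0])
  have "limitin (prod_topology (top_of_set U) euclidean) (\<lambda>p. (\<beta> p, \<phi> (y p))) (b0, \<phi> l) Fl"
    unfolding limitin_pairwise using \<beta> b0 ev y by (simp add: limitin_subtopology comp_def)
  from continuous_map_limit[OF htriv_inv_into(5)[OF t] this]
  have "limitin (vtotal H) ((\<lambda>(b, v). inv_into (vfibre H b) \<phi> v) \<circ> (\<lambda>p. (\<beta> p, \<phi> (y p)))) l Fl"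
    using htriv_inv_into(4)[OF t b0 l] by simp
  moreover have "\<forall>\<^sub>F p in Fl. ((\<lambda>(b, v). inv_into (vfibre H b) \<phi> v) \<circ> (\<lambda>p. (\<beta> p, \<phi> (y p)))) p = y p"
    using ev fib by eventually_elim (simp add: htriv_inv_into(4)[OF t])
  ultimately show ?thesis by (rule limitin_transform_eventually[rotated])
qed

lemma htriv_tendsto:
  fixes H :: "('b::topological_space, 'g, 'e, 'v::complex_hilbert) hbundle"
  assumes t: "htriv H U \<phi>" and pr: "continuous_map (vtotal H) euclidean (vproj H)"
    and lim: "limitin (vtotal H) y l Fl" and l: "vproj H l \<in> U"
  shows "((\<lambda>p. \<phi> (y p)) \<longlongrightarrow> \<phi> l) Fl"
proof -
  have \<beta>: "((\<lambda>p. vproj H (y p)) \<longlongrightarrow> vproj H l) Fl"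
    using continuous_map_limit[OF pr lim] by (simp add: comp_def)
  have "\<forall>\<^sub>F p in Fl. vproj H (y p) \<in> U"
    by (rule topological_tendstoD[OF \<beta> htriv_inv_into(1)[OF t] l])
  then have "limitin (subtopology (vtotal H) {x. vproj H x \<in> U}) y l Fl"
    using lim l by (simp add: limitin_subtopology)
  from continuous_map_limit[OF htriv_inv_into(6)[OF t] this]
  show ?thesis by (simp add: comp_def)
qed

lemma subbundle_simps [simp]:
  "vtotal (subbundle H K) = subtopology (vtotal H) K" "vproj (subbundle H K) = vproj H"
  "vadd (subbundle H K) = vadd H" "vscale (subbundle H K) = vscale H" "vact (subbundle H K) = vact H"
  "vfibre (subbundle H K) b = K \<inter> vfibre H b"
  by (auto simp: subbundle_def vfibre_def)

lemma invariant_subbundle_closed: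
  assumes "invariant_subbundle \<G> H K" "x \<in> K \<inter> vfibre H b"
  shows "y \<in> K \<inter> vfibre H b \<Longrightarrow> vadd H x y \<in> K \<inter> vfibre H b"
    and "vscale H c x \<in> K \<inter> vfibre H b"
    and "g \<in> carrier (gfibre \<G> b) \<Longrightarrow> vact H g x \<in> K \<inter> vfibre H b"
  using fibrewise_linear_actionD(1-3)[of \<G> "subbundle H K" x b] assms
  by (simp_all add: invariant_subbundle_def equivariant_vbundle_def)

text \<open>The link from the topology of a sub-bundle to norm estimates. A local frame of
  \<open>K\<close>, read in a Hilbert chart, is norm-continuous. Its independence at
  \<open>b0\<close> is quantitative because the coordinates on the fibre are continuous and
  homogeneous, hence bounded.\<close>

lemma continuous_subspaces_at_subbundle:
  fixes H :: "('b::topological_space, 'g, 'e, 'v::complex_hilbert) hbundle"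
  assumes t: "htriv H U \<phi>" and K: "invariant_subbundle \<G> H K" and b0: "b0 \<in> U"
  shows "continuous_subspaces_at (\<lambda>b. \<phi> ` (K \<inter> vfibre H b)) b0"
proof -
  let ?E = "subbundle H K"
  obtain n V \<tau> where b0V: "b0 \<in> V" and tr: "vtriv ?E n V \<tau>"
    using K unfolding invariant_subbundle_def equivariant_vbundle_def by blast
  obtain s where s0:
    "continuous_map (prod_topology (top_of_set V) (top_of_set (Cspace n))) (vtotal ?E) (\<lambda>(b, z). s b z)"
    "continuous_map (subtopology (vtotal ?E) {x. vproj ?E x \<in> V}) euclidean \<tau>"
    "\<And>b z. b \<in> V \<Longrightarrow> z \<in> Cspace n \<Longrightarrow> s b z \<in> vfibre ?E b \<and> \<tau> (s b z) = z"
    "\<And>b x. b \<in> V \<Longrightarrow> x \<in> vfibre ?E b \<Longrightarrow> \<tau> x \<in> Cspace n \<and> s b (\<tau> x) = x"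
    "open V"
    by (rule vtrivE[OF tr]) (rule that)
  have sK: "s b z \<in> K \<inter> vfibre H b" "s b z \<in> vfibre H b" "\<tau> (s b z) = z" if "b \<in> V" "z \<in> Cspace n" for b z
    using s0(3)[OF that] by auto
  have s\<tau>: "\<tau> x \<in> Cspace n" "s b (\<tau> x) = x" if "b \<in> V" "x \<in> K \<inter> vfibre H b" for b x
    using s0(4)[of b x] that by auto
  have \<tau>add: "\<tau> (vadd H x y) = (\<lambda>i. \<tau> x i + \<tau> y i)" if "b \<in> V" "x \<in> K \<inter> vfibre H b" "y \<in> K \<inter> vfibre H b" for b x y
    using tr that by (simp add: vtriv_def)
  have \<tau>scale: "\<tau> (vscale H c x) = (\<lambda>i. c * \<tau> x i)" if "b \<in> V" "x \<in> K \<inter> vfibre H b" for b x c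
    using tr that by (simp add: vtriv_def)
  define \<delta> :: "nat \<Rightarrow> nat \<Rightarrow> complex" where "\<delta> i = (\<lambda>j. if j = i then 1 else 0)" for i
  have \<delta>: "\<delta> i \<in> Cspace n" if "i < n" for i using that by (auto simp: \<delta>_def Cspace_def)
  define e where "e i b = \<phi> (s b (\<delta> i))" for i b
  have lin: "\<phi> (s b z) = (\<Sum>i<n. cscale (z i) (e i b))" if b: "b \<in> U" "b \<in> V" and z: "z \<in> Cspace n" for b z
    unfolding e_def \<delta>_def
  proof (rule Cspace_expand[OF _ _ z])
    fix x y assume x: "x \<in> Cspace n" and y: "y \<in> Cspace n"
    have "s b (\<lambda>i. x i + y i) = vadd H (s b x) (s b y)"
      using s\<tau>(2)[OF b(2) invariant_subbundle_closed(1)[OF K sK(1)[OF b(2) x] sK(1)[OF b(2) y]]]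
        \<tau>add[OF b(2) sK(1)[OF b(2) x] sK(1)[OF b(2) y]] sK(3)[OF b(2) x] sK(3)[OF b(2) y] by simp
    then show "\<phi> (s b (\<lambda>i. x i + y i)) = \<phi> (s b x) + \<phi> (s b y)"
      using htriv_linear(1)[OF t b(1) sK(2)[OF b(2) x] sK(2)[OF b(2) y]] by simp
  next
    fix c x assume x: "x \<in> Cspace n"
    have "s b (\<lambda>i. c * x i) = vscale H c (s b x)"
      using s\<tau>(2)[OF b(2) invariant_subbundle_closed(2)[OF K sK(1)[OF b(2) x]]]
        \<tau>scale[OF b(2) sK(1)[OF b(2) x]] sK(3)[OF b(2) x] by metis
    then show "\<phi> (s b (\<lambda>i. c * x i)) = cscale c (\<phi> (s b x))"
      using htriv_linear(3)[OF t b(1) sK(2)[OF b(2) x]] by simp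
  qed
  have rng: "\<phi> ` (K \<inter> vfibre H b) = range (\<lambda>c. \<Sum>i<n. cscale (c i) (e i b))" if b: "b \<in> U" "b \<in> V" for b
  proof
    show "\<phi> ` (K \<inter> vfibre H b) \<subseteq> range (\<lambda>c. \<Sum>i<n. cscale (c i) (e i b))"
    proof safe
      fix x assume "x \<in> K" "x \<in> vfibre H b"
      then have "\<phi> x = (\<Sum>i<n. cscale (\<tau> x i) (e i b))"
        using lin[OF b, of "\<tau> x"] s\<tau>[OF b(2), of x] by simp
      then show "\<phi> x \<in> range (\<lambda>c. \<Sum>i<n. cscale (c i) (e i b))" by blast
    qed
    show "range (\<lambda>c. \<Sum>i<n. cscale (c i) (e i b)) \<subseteq> \<phi> ` (K \<inter> vfibre H b)"
    proof safe
      fix c :: "nat \<Rightarrow> complex"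
      let ?z = "\<lambda>i. if i < n then c i else 0"
      have z: "?z \<in> Cspace n" by (auto simp: Cspace_def)
      have "(\<Sum>i<n. cscale (c i) (e i b)) = \<phi> (s b ?z)" using lin[OF b z] by simp
      then show "(\<Sum>i<n. cscale (c i) (e i b)) \<in> \<phi> ` (K \<inter> vfibre H b)"
        using sK(1)[OF b(2) z] by blast
    qed
  qed
  have UV: "open (U \<inter> V)" using s0(5) htriv_inv_into(1)[OF t] by blast
  have lim: "(e i \<longlongrightarrow> e i b0) (nhds b0)" if i: "i < n" for i
  proof -
    have "continuous_map (top_of_set (U \<inter> V)) (prod_topology (top_of_set V) (top_of_set (Cspace n))) (\<lambda>b. (b, \<delta> i))"
      using \<delta>[OF i] unfolding continuous_map_paired by (auto simp: continuous_map_in_subtopology)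
    from continuous_map_compose[OF this s0(1)]
    have "continuous_map (top_of_set (U \<inter> V)) (vtotal ?E) (\<lambda>b. s b (\<delta> i))"
      by (simp only: comp_def prod.case)
    then have "continuous_map (top_of_set (U \<inter> V)) (vtotal H) (\<lambda>b. s b (\<delta> i))"
      by (simp add: continuous_map_in_subtopology)
    moreover have "vproj H (s b (\<delta> i)) \<in> U" if "b \<in> U \<inter> V" for b
      using sK(2)[OF _ \<delta>[OF i], of b] that by (simp add: vfibre_def)
    ultimately have "continuous_map (top_of_set (U \<inter> V)) (subtopology (vtotal H) {x. vproj H x \<in> U}) (\<lambda>b. s b (\<delta> i))"
      by (auto simp: continuous_map_in_subtopology)
    from continuous_map_compose[OF this htriv_inv_into(6)[OF t]]
    have "continuous_on (U \<inter> V) (e i)" by (simp add: comp_def e_def[abs_def])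
    then have "(e i \<longlongrightarrow> e i b0) (at b0 within U \<inter> V)" using b0 b0V by (simp add: continuous_on_def)
    moreover have "at b0 within U \<inter> V = at b0" using UV b0 b0V by (intro at_within_open) auto
    ultimately have "(e i \<longlongrightarrow> e i b0) (at b0)" by (simp only:)
    then show ?thesis by (simp add: tendsto_at_iff_tendsto_nhds)
  qed
  let ?\<kappa> = "inv_into (vfibre H b0) \<phi>"
  let ?S = "\<phi> ` (K \<inter> vfibre H b0)"
  have \<kappa>S: "?\<kappa> v \<in> K \<inter> vfibre H b0" "\<phi> (?\<kappa> v) = v" if "v \<in> ?S" for v
    using that htriv_inv_into(4)[OF t b0] by auto
  have subS: "subspace ?S"
  proof (rule subspaceI)
    have "0 = \<phi> (s b0 (\<lambda>_. 0))" using lin[OF b0 b0V, of "\<lambda>_. 0"] by (simp add: Cspace_def)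
    then show "0 \<in> ?S" using sK(1)[OF b0V, of "\<lambda>_. 0"] by (auto simp: Cspace_def)
  next
    fix x y assume "x \<in> ?S" "y \<in> ?S"
    then obtain x' y' where x': "x = \<phi> x'" "x' \<in> K \<inter> vfibre H b0" "y = \<phi> y'" "y' \<in> K \<inter> vfibre H b0" by blast
    then have "x + y = \<phi> (vadd H x' y')" using htriv_linear(1)[OF t b0, of x' y'] by simp
    then show "x + y \<in> ?S" using invariant_subbundle_closed(1)[OF K x'(2,4)] by blast
  next
    fix r x assume "x \<in> ?S"
    then obtain x' where x': "x = \<phi> x'" "x' \<in> K \<inter> vfibre H b0" by blast
    then have "r *\<^sub>R x = \<phi> (vscale H (complex_of_real r) x')"
      using htriv_linear(3)[OF t b0, of x'] by (simp add: cscale_of_real)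
    then show "r *\<^sub>R x \<in> ?S" using invariant_subbundle_closed(2)[OF K x'(2)] by blast
  qed
  \<comment> \<open>\<open>K\<close> carries the subspace topology, so the inverse Hilbert chart
    followed by the \<open>i\<close>-th coordinate of \<open>\<tau>\<close> is continuous for the
    norm on the fibre.\<close>
  have "\<exists>M>0. \<forall>v\<in>?S. norm (\<tau> (?\<kappa> v) i) \<le> M * norm v" for i
  proof -
    have "continuous_map (top_of_set ?S) (prod_topology (top_of_set U) euclidean) (\<lambda>v. (b0, v))"
      using b0 unfolding continuous_map_paired by (auto simp: continuous_map_in_subtopology)
    from continuous_map_compose[OF this htriv_inv_into(5)[OF t]]
    have "continuous_map (top_of_set ?S) (vtotal H) ?\<kappa>" by (simp only: comp_def prod.case)
    moreover have "?\<kappa> v \<in> K" "vproj H (?\<kappa> v) \<in> V" if "v \<in> ?S" for v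
      using \<kappa>S(1)[OF that] b0V by (simp_all add: vfibre_def)
    ultimately have "continuous_map (top_of_set ?S) (subtopology (vtotal ?E) {x. vproj ?E x \<in> V}) ?\<kappa>"
      by (auto simp add: continuous_map_in_subtopology)
    from continuous_map_compose[OF this s0(2)]
    have "continuous_map (top_of_set ?S) euclidean (\<lambda>v. \<tau> (?\<kappa> v))" by (simp only: comp_def)
    then have "continuous_map (top_of_set ?S) euclidean (\<lambda>v. \<tau> (?\<kappa> v) i)"
      unfolding continuous_map_euclidean_fun by blast
    then have cont: "continuous_on ?S (\<lambda>v. \<tau> (?\<kappa> v) i)" by simp
    have hom: "\<tau> (?\<kappa> (r *\<^sub>R v)) i = r *\<^sub>R \<tau> (?\<kappa> v) i" if "v \<in> ?S" for r v
    proof -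
      have "?\<kappa> (r *\<^sub>R v) = vscale H (complex_of_real r) (?\<kappa> v)"
      proof (rule htriv_inj[OF t b0])
        show "vscale H (complex_of_real r) (?\<kappa> v) \<in> vfibre H b0"
          using invariant_subbundle_closed(2)[OF K \<kappa>S(1)[OF that]] by blast
        show "\<phi> (?\<kappa> (r *\<^sub>R v)) = \<phi> (vscale H (complex_of_real r) (?\<kappa> v))"
          using \<kappa>S[OF that] htriv_linear(3)[OF t b0, of "?\<kappa> v"] htriv_inv_into(3)[OF t b0]
          by (simp add: cscale_of_real)
      qed (rule htriv_inv_into(2)[OF t b0])
      then show ?thesis using \<tau>scale[OF b0V \<kappa>S(1)[OF that]] by (simp add: scaleR_conv_of_real)
    qed
    show ?thesis using continuous_homogeneous_bound[OF cont subS hom] by metis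
  qed
  then obtain M where M: "\<And>i. M i > 0" "\<And>i v. v \<in> ?S \<Longrightarrow> norm (\<tau> (?\<kappa> v) i) \<le> M i * norm v" by metis
  show ?thesis
  proof (rule continuous_subspaces_at_basis[OF lim])
    have "\<forall>\<^sub>F b in nhds b0. b \<in> U \<inter> V" using UV b0 b0V by (intro eventually_nhds_in_open) auto
    then show "\<forall>\<^sub>F b in nhds b0. \<phi> ` (K \<inter> vfibre H b) = range (\<lambda>c. \<Sum>i<n. cscale (c i) (e i b))"
      by eventually_elim (use rng in blast)
    \<comment> \<open>One constant for all coordinates; the summand 1 makes it positive for the zero
      bundle as well.\<close>
    show "(\<Sum>i<n. M i) + 1 > 0" using M(1) by (intro add_nonneg_pos sum_nonneg) (auto simp: less_imp_le)
    fix c :: "nat \<Rightarrow> complex" and i assume i: "i < n"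
    let ?z = "\<lambda>i. if i < n then c i else 0"
    have z: "?z \<in> Cspace n" by (auto simp: Cspace_def)
    let ?v = "\<Sum>i<n. cscale (c i) (e i b0)"
    have v: "?v = \<phi> (s b0 ?z)" using lin[OF b0 b0V z] by simp
    then have "?\<kappa> ?v = s b0 ?z" using htriv_inv_into(4)[OF t b0 sK(2)[OF b0V z]] by simp
    then have "cmod (c i) = norm (\<tau> (?\<kappa> ?v) i)" using sK(3)[OF b0V z] i by simp
    also have "\<dots> \<le> M i * norm ?v" using M(2) v sK(1)[OF b0V z] by blast
    also have "\<dots> \<le> ((\<Sum>i<n. M i) + 1) * norm ?v"
      using M(1) i by (intro mult_right_mono) (auto intro!: member_le_sum add_increasing2 simp: less_imp_le)
    finally show "cmod (c i) \<le> ((\<Sum>i<n. M i) + 1) * norm ?v" .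
  qed
qed


section \<open>Fredholm families in trivializations\<close>

lemma orthogonal_comp_iff: "x \<in> W\<^sup>\<bottom> \<longleftrightarrow> (\<forall>y\<in>W. inner x y = 0)"
  by (auto simp: orthogonal_comp_def orthogonal_def inner_commute)

lemma closed_orthogonal_comp: "closed (W\<^sup>\<bottom> :: 'a::real_inner set)"
proof -
  have "W\<^sup>\<bottom> = (\<Inter>y\<in>W. {x. inner x y = 0})" by (auto simp: orthogonal_comp_iff)
  moreover have "closed {x. inner x y = 0}" for y :: 'a
    by (intro closed_Collect_eq continuous_intros)
  ultimately show ?thesis by auto
qed

lemma bounded_below_split:
  fixes A :: "'v::{real_inner, complete_space} \<Rightarrow> 'w::{real_inner, complete_space}"
  assumes A: "bounded_linear A" and P: "subspace P" "closed P"
    and m: "m > 0" "\<And>y. y \<in> P \<Longrightarrow> m * norm y \<le> norm (A y)"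
  obtains z e where "z \<in> P" "e \<in> (A ` P)\<^sup>\<bottom>" "A z = w + e"
proof -
  have "complete (A ` P)"
    using complete_isometric_image[OF m(1) P(1) A] m(2) P(2) by (auto simp: complete_eq_closed mult.commute)
  then have cl: "closed (A ` P)" by (simp add: complete_eq_closed)
  have sub: "subspace (A ` P)"
    using A P(1) by (simp add: bounded_linear.linear linear_subspace_image)
  obtain p where p: "p \<in> A ` P" "\<And>s. s \<in> A ` P \<Longrightarrow> inner (w - p) s = 0"
    using closed_subspace_is_proj[OF sub cl, of w] by (auto simp: is_proj_def)
  then obtain z where z: "z \<in> P" "p = A z" by blast
  show ?thesis
  proof (rule that[OF z(1), of "A z - w"])
    show "A z - w \<in> (A ` P)\<^sup>\<bottom>"
      unfolding orthogonal_comp_iff using p(2) z(2) by (metis inner_minus_left minus_diff_eq neg_equal_0_iff_equal)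
  qed simp
qed

lemma cinner_diff_left: "cinner (x - y) (z::'v::complex_hilbert) = cinner x z - cinner y z"
  using cinner_add_left[of "x - y" y z] by simp

lemma cinner_0_left: "cinner 0 (z::'v::complex_hilbert) = 0"
  using cinner_diff_left[of 0 0 z] by simp

text \<open>Two vectors with the same inner products against \<open>S\<close> have the same
  projection to \<open>S\<close>. The difference is formed in the chart, as the bundle record
  provides no subtraction.\<close>

lemma htriv_hinner_eq_iff:
  assumes t: "htriv H U \<phi>" and b: "b \<in> U" and S: "S \<subseteq> vfibre H b"
    and sc: "\<And>c y. y \<in> S \<Longrightarrow> vscale H c y \<in> S" and x: "x \<in> vfibre H b" and k: "k \<in> vfibre H b"
  shows "(\<forall>y\<in>S. hinner H x y = hinner H k y) \<longleftrightarrow> \<phi> x - \<phi> k \<in> (\<phi> ` S)\<^sup>\<bottom>"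
proof -
  have "(\<forall>y\<in>S. hinner H x y = hinner H k y) \<longleftrightarrow> (\<forall>v\<in>\<phi> ` S. cinner (\<phi> x - \<phi> k) v = 0)"
    using htriv_linear(2)[OF t b x] htriv_linear(2)[OF t b k] S by (auto simp: cinner_diff_left subset_iff)
  also have "\<dots> \<longleftrightarrow> (\<forall>v\<in>\<phi> ` S. inner (\<phi> x - \<phi> k) v = 0)"
  proof (rule cinner_eq_0_iff_inner)
    fix c v assume "v \<in> \<phi> ` S"
    then obtain y where "v = \<phi> y" "y \<in> S" by blast
    then show "cscale c v \<in> \<phi> ` S" using htriv_linear(3)[OF t b, of y c] sc[of y c] S by (metis imageI subsetD)
  qed
  finally show ?thesis by (simp add: orthogonal_comp_iff)
qed

lemma htriv_fibre_perp:
  assumes t: "htriv H U \<phi>" and b: "b \<in> U" and S: "S \<subseteq> vfibre H b"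
    and sc: "\<And>c y. y \<in> S \<Longrightarrow> vscale H c y \<in> S"
  shows "x \<in> fibre_perp H b S \<longleftrightarrow> x \<in> vfibre H b \<and> \<phi> x \<in> (\<phi> ` S)\<^sup>\<bottom>"
    and "\<phi> ` fibre_perp H b S = (\<phi> ` S)\<^sup>\<bottom>"
proof -
  \<comment> \<open>The zero vector of the fibre, obtained from the chart; comparing
    \<open>x\<close> with it turns \<open>fibre_perp\<close> into an instance of
    \<open>htriv_hinner_eq_iff\<close>.\<close>
  let ?o = "inv_into (vfibre H b) \<phi> 0"
  have o: "?o \<in> vfibre H b" "\<phi> ?o = 0" using htriv_inv_into[OF t] b by auto
  have "hinner H ?o y = 0" if "y \<in> S" for y
    using htriv_linear(2)[OF t b o(1), of y] S that by (auto simp: o(2) cinner_0_left)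
  then have *: "x \<in> fibre_perp H b S \<longleftrightarrow> x \<in> vfibre H b \<and> \<phi> x \<in> (\<phi> ` S)\<^sup>\<bottom>" for x
    using htriv_hinner_eq_iff[OF t b S sc _ o(1), of x] by (auto simp: fibre_perp_def o(2))
  then show "x \<in> fibre_perp H b S \<longleftrightarrow> x \<in> vfibre H b \<and> \<phi> x \<in> (\<phi> ` S)\<^sup>\<bottom>" .
  show "\<phi> ` fibre_perp H b S = (\<phi> ` S)\<^sup>\<bottom>"
  proof
    show "\<phi> ` fibre_perp H b S \<subseteq> (\<phi> ` S)\<^sup>\<bottom>" using * by blast
    show "(\<phi> ` S)\<^sup>\<bottom> \<subseteq> \<phi> ` fibre_perp H b S"
    proof
      fix v assume v: "v \<in> (\<phi> ` S)\<^sup>\<bottom>"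
      then have "inv_into (vfibre H b) \<phi> v \<in> fibre_perp H b S"
        using * htriv_inv_into(2,3)[OF t b] by simp
      then show "v \<in> \<phi> ` fibre_perp H b S" using htriv_inv_into(3)[OF t b, of v] by (metis imageI)
    qed
  qed
qed

definition local_op ::
  "('b, 'g, 'e, 'v::complex_hilbert) hbundle \<Rightarrow> ('e \<Rightarrow> 'f) \<Rightarrow> ('e \<Rightarrow> 'v) \<Rightarrow>
   ('f \<Rightarrow> 'w::complex_hilbert) \<Rightarrow> 'b \<Rightarrow> 'v \<Rightarrow>\<^sub>L 'w" where
  "local_op H F \<phi> \<psi> b = Blinfun (\<lambda>v. \<psi> (F (inv_into (vfibre H b) \<phi> v)))"

text \<open>
  The triples (x, d, e) with F x = d + e, viewed as a correspondence from the sum of K and the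
  cokernel of K' (the pair p = (projection of x to K, d)) to the sum of K' and the cokernel of K
  (the pair q = (projection of x to K', e)). The last two clauses say that x has the projections
  fst p and fst q, without subtracting in the fibre.
\<close>

definition swap_rel ::
  "('b, 'g, 'e, 'v) hbundle \<Rightarrow> ('b, 'g, 'f, 'w) hbundle \<Rightarrow> ('e \<Rightarrow> 'f) \<Rightarrow> 'e set \<Rightarrow> 'e set \<Rightarrow>
   'b \<Rightarrow> 'e \<times> 'f \<Rightarrow> 'e \<times> 'f \<Rightarrow> bool" where
  "swap_rel H H' F K K' b p q \<longleftrightarrow>
     p \<in> (K \<inter> vfibre H b) \<times> (COK H H' F K' \<inter> vfibre H' b) \<and>
     q \<in> (K' \<inter> vfibre H b) \<times> (COK H H' F K \<inter> vfibre H' b) \<and>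
     (\<exists>x\<in>vfibre H b. F x = vadd H' (snd p) (snd q) \<and>
        (\<forall>y\<in>K \<inter> vfibre H b. hinner H x y = hinner H (fst p) y) \<and>
        (\<forall>y\<in>K' \<inter> vfibre H b. hinner H x y = hinner H (fst q) y))"

locale fredholm_bundle_map =
  fixes G :: "'k monoid" and T :: "'k topology"
    and \<G> :: "('b::topological_space, 'g) group_family"
    and H :: "('b, 'g, 'e, 'v::complex_hilbert) hbundle"
    and H' :: "('b, 'g, 'f, 'w::complex_hilbert) hbundle"
    and F :: "'e \<Rightarrow> 'f"
  assumes group_bundle: "group_bundle G T \<G>"
    and hilbert_bundle: "hilbert_bundle G T \<G> H"
    and hilbert_bundle': "hilbert_bundle G T \<G> H'"
    and fredholm: "fredholm_family \<G> H H' F"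
begin

lemma fibred_groups: "fibred_groups \<G>"
  using group_bundle by (simp add: group_bundle_def fibred_groups_def)

lemma chart:
  obtains U \<phi> V \<psi> where "(U, \<phi>) \<in> hatlas H" "(V, \<psi>) \<in> hatlas H'" "htriv H U \<phi>" "htriv H' V \<psi>" "b \<in> U" "b \<in> V"
proof -
  have "b \<in> (\<Union>(U, \<phi>)\<in>hatlas H. U)" "b \<in> (\<Union>(U, \<phi>)\<in>hatlas H'. U)"
    using hilbert_bundle hilbert_bundle' by (simp_all add: hilbert_bundle_def)
  then obtain U \<phi> V \<psi> where *: "(U, \<phi>) \<in> hatlas H" "b \<in> U" "(V, \<psi>) \<in> hatlas H'" "b \<in> V" by auto
  moreover have "htriv H U \<phi>" "htriv H' V \<psi>"
    using * hilbert_bundle hilbert_bundle' by (auto simp: hilbert_bundle_def)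
  ultimately show ?thesis using that by blast
qed

lemma F_fibre: "x \<in> vfibre H b \<Longrightarrow> F x \<in> vfibre H' b"
  using fredholm by (auto simp: fredholm_family_def)

lemma F_act: "g \<in> carrier (gfibre \<G> b) \<Longrightarrow> x \<in> vfibre H b \<Longrightarrow> F (vact H g x) = vact H' g (F x)"
  using fredholm by (simp add: fredholm_family_def)

lemma fla: "fibrewise_linear_action \<G> H" "fibrewise_linear_action \<G> H'"
  using hilbert_bundle hilbert_bundle' by (simp_all add: hilbert_bundle_def)

lemma vproj_cont: "continuous_map (vtotal H) euclidean (vproj H)" "continuous_map (vtotal H') euclidean (vproj H')"
  using hilbert_bundle hilbert_bundle' by (simp_all add: hilbert_bundle_def)

lemma local_op:
  assumes "(U, \<phi>) \<in> hatlas H" "(V, \<psi>) \<in> hatlas H'" "htriv H U \<phi>"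
  shows "b \<in> U \<Longrightarrow> b \<in> V \<Longrightarrow> x \<in> vfibre H b \<Longrightarrow> local_op H F \<phi> \<psi> b (\<phi> x) = \<psi> (F x)"
    and "b \<in> U \<Longrightarrow> b \<in> V \<Longrightarrow> local_op H F \<phi> \<psi> b (cscale c v) = cscale c (local_op H F \<phi> \<psi> b v)"
    and "continuous_on (U \<inter> V) (local_op H F \<phi> \<psi>)"
proof -
  have F: "\<forall>b\<in>U \<inter> V. fredholm (\<lambda>v. \<psi> (F (inv_into (vfibre H b) \<phi> v)))"
    "continuous_on (U \<inter> V) (\<lambda>b. Blinfun (\<lambda>v. \<psi> (F (inv_into (vfibre H b) \<phi> v))))"
    using fredholm assms(1,2) unfolding fredholm_family_def by blast+
  show "continuous_on (U \<inter> V) (local_op H F \<phi> \<psi>)" using F(2) by (simp add: local_op_def[abs_def])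
  assume b: "b \<in> U" "b \<in> V"
  then have *: "fredholm (\<lambda>v. \<psi> (F (inv_into (vfibre H b) \<phi> v)))" using F(1) by blast
  then have ap: "local_op H F \<phi> \<psi> b v = \<psi> (F (inv_into (vfibre H b) \<phi> v))" for v
    unfolding local_op_def fredholm_def by (simp add: bounded_linear_Blinfun_apply)
  show "local_op H F \<phi> \<psi> b (cscale c v) = cscale c (local_op H F \<phi> \<psi> b v)"
    using * unfolding ap fredholm_def by blast
  assume "x \<in> vfibre H b"
  then show "local_op H F \<phi> \<psi> b (\<phi> x) = \<psi> (F x)"
    unfolding ap using htriv_inv_into(4)[OF assms(3) b(1)] by simp
qed

text \<open>\<open>fredholm_family\<close> states linearity for the chart representatives of
  \<open>F\<close>; injectivity of the charts brings it back to the fibres.\<close>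

lemma F_linear:
  assumes x: "x \<in> vfibre H b"
  shows "y \<in> vfibre H b \<Longrightarrow> F (vadd H x y) = vadd H' (F x) (F y)"
    and "F (vscale H c x) = vscale H' c (F x)"
proof -
  obtain U \<phi> V \<psi> where c: "(U, \<phi>) \<in> hatlas H" "(V, \<psi>) \<in> hatlas H'" "htriv H U \<phi>" "htriv H' V \<psi>" "b \<in> U" "b \<in> V"
    by (rule chart) (rule that)
  note A = local_op(1)[OF c(1-3) c(5,6)] and cl = fibrewise_linear_actionD(1,2)[OF fla(1)]
    and cl' = fibrewise_linear_actionD(1,2)[OF fla(2)]
  show "F (vscale H c x) = vscale H' c (F x)"
    by (rule htriv_inj[OF c(4,6)])
      (use x cl[OF x] cl'[OF F_fibre[OF x]] A[of x] A[of "vscale H c x"] local_op(2)[OF c(1-3) c(5,6)]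
        htriv_linear(3)[OF c(3,5) x] htriv_linear(3)[OF c(4,6) F_fibre[OF x]] in \<open>auto intro: F_fibre\<close>)
  assume y: "y \<in> vfibre H b"
  show "F (vadd H x y) = vadd H' (F x) (F y)"
    by (rule htriv_inj[OF c(4,6)])
      (use x y cl(1)[OF x y] cl'(1)[OF F_fibre[OF x] F_fibre[OF y]] A[of x] A[of y] A[of "vadd H x y"]
        htriv_linear(1)[OF c(3,5) x y] htriv_linear(1)[OF c(4,6) F_fibre[OF x] F_fibre[OF y]]
        in \<open>auto intro: F_fibre simp: blinfun.add_right\<close>)
qed

end

section \<open>The correspondence over one point, in a fixed pair of charts\<close>

text \<open>The point \<open>b\<close> is a parameter apart from the charts, so that a limit
  argument at \<open>b\<close> can use the same charts at all nearby points.\<close>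

locale index_chart = fredholm_bundle_map G T \<G> H H' F
  for G :: "'k monoid" and T :: "'k topology"
    and \<G> :: "('b::topological_space, 'g) group_family"
    and H :: "('b, 'g, 'e, 'v::complex_hilbert) hbundle"
    and H' :: "('b, 'g, 'f, 'w::complex_hilbert) hbundle"
    and F :: "'e \<Rightarrow> 'f" +
  fixes U :: "'b set" and \<phi> :: "'e \<Rightarrow> 'v" and V :: "'b set" and \<psi> :: "'f \<Rightarrow> 'w" and b :: 'b
  assumes atlas: "(U, \<phi>) \<in> hatlas H" "(V, \<psi>) \<in> hatlas H'"
    and triv: "htriv H U \<phi>" and triv': "htriv H' V \<psi>" and bU: "b \<in> U" and bV: "b \<in> V"
begin

abbreviation A where "A \<equiv> local_op H F \<phi> \<psi>"
abbreviation khat where "khat K a \<equiv> \<phi> ` (K \<inter> vfibre H a)"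
abbreviation chat where "chat K a \<equiv> \<psi> ` (COK H H' F K \<inter> vfibre H' a)"

lemmas A_apply = local_op(1)[OF atlas triv bU bV]

lemma COK_fibre: "COK H H' F K \<inter> vfibre H' b = fibre_perp H' b (F ` ker_perp H K b)"
  by (auto simp: COK_def fibre_perp_def vfibre_def)

lemma ker_perp_iff:
  assumes "invariant_subbundle \<G> H K"
  shows "x \<in> ker_perp H K b \<longleftrightarrow> x \<in> vfibre H b \<and> \<phi> x \<in> (khat K b)\<^sup>\<bottom>"
    and "\<phi> ` ker_perp H K b = (khat K b)\<^sup>\<bottom>"
  unfolding ker_perp_def
  by (rule htriv_fibre_perp[OF triv bU _ invariant_subbundle_closed(2)[OF assms]]; simp)+

lemma ker_perp_scale:
  assumes K: "invariant_subbundle \<G> H K" and x: "x \<in> ker_perp H K b"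
  shows "vscale H c x \<in> ker_perp H K b"
proof -
  have xf: "x \<in> vfibre H b" using x by (simp add: ker_perp_def fibre_perp_def)
  have "hinner H (vscale H c x) y = 0" if "y \<in> K \<inter> vfibre H b" for y
    using that x htriv_linear(2)[OF triv bU fibrewise_linear_actionD(2)[OF fla(1) xf], of y c]
      htriv_linear(2)[OF triv bU xf, of y] htriv_linear(3)[OF triv bU xf, of c]
    by (auto simp: ker_perp_def fibre_perp_def cinner_cscale_left)
  then show ?thesis using fibrewise_linear_actionD(2)[OF fla(1) xf]
    by (auto simp: ker_perp_def fibre_perp_def)
qed

lemma ker_perp_fibre: "x \<in> ker_perp H K b \<Longrightarrow> x \<in> vfibre H b"
  by (auto simp: ker_perp_def fibre_perp_def)

lemma image_ker_perp:
  assumes K: "invariant_subbundle \<G> H K"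
  shows "\<psi> ` F ` ker_perp H K b = A b ` ((khat K b)\<^sup>\<bottom>)"
proof -
  have "\<psi> ` F ` ker_perp H K b = A b ` \<phi> ` ker_perp H K b"
    unfolding image_image using A_apply[OF ker_perp_fibre] by (intro image_cong) auto
  then show ?thesis by (simp add: ker_perp_iff(2)[OF K])
qed

lemma chat_eq:
  assumes K: "invariant_subbundle \<G> H K"
  shows "chat K b = (A b ` ((khat K b)\<^sup>\<bottom>))\<^sup>\<bottom>"
proof -
  have "chat K b = (\<psi> ` F ` ker_perp H K b)\<^sup>\<bottom>"
    unfolding COK_fibre
  proof (rule htriv_fibre_perp(2)[OF triv' bV])
    show "F ` ker_perp H K b \<subseteq> vfibre H' b" using F_fibre[OF ker_perp_fibre] by blast
    fix c y assume "y \<in> F ` ker_perp H K b"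
    then obtain x where x: "y = F x" "x \<in> ker_perp H K b" by blast
    then have "vscale H' c y = F (vscale H c x)" using F_linear(2)[OF ker_perp_fibre, of x K c] by simp
    then show "vscale H' c y \<in> F ` ker_perp H K b" using ker_perp_scale[OF K x(2)] by blast
  qed
  then show ?thesis by (simp add: image_ker_perp[OF K])
qed

lemma subspace_khat:
  assumes K: "invariant_subbundle \<G> H K"
  shows "subspace (khat K b)" and "\<exists>p. is_proj (khat K b) v p"
  using continuous_subspaces_at_subbundle[OF triv K bU] unfolding continuous_subspaces_at_def
  by (auto dest: eventually_nhds_x_imp_x)

text \<open>Condition (1) contains the continuity of the inverse of \<open>F\<close> on the image of
  the complement; being homogeneous, the inverse is bounded.\<close>

lemma bounded_below:
  assumes adm: "admissible_KER \<G> H H' F K"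
  obtains m where "m > 0" "\<And>y. y \<in> (khat K b)\<^sup>\<bottom> \<Longrightarrow> m * norm y \<le> norm (A b y)"
proof -
  let ?P = "ker_perp H K b"
  let ?D = "A b ` ((khat K b)\<^sup>\<bottom>)"
  have K: "invariant_subbundle \<G> H K" using adm by (simp add: admissible_KER_def)
  have "homeomorphic_map (subtopology (vtotal H) ?P) (subtopology (vtotal H') (F ` ?P)) F"
    using adm by (simp add: admissible_KER_def fibre_iso_def)
  then obtain g where g: "homeomorphic_maps (subtopology (vtotal H) ?P) (subtopology (vtotal H') (F ` ?P)) F g"
    unfolding homeomorphic_map_maps by blast
  have Ptop: "x \<in> topspace (vtotal H)" if "x \<in> ?P" for x
    using ker_perp_fibre[OF that] by (simp add: vfibre_def)
  have gF: "g (F x) = x" if "x \<in> ?P" for x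
    using g that Ptop by (auto simp: homeomorphic_maps_def)
  have gc: "continuous_map (subtopology (vtotal H') (F ` ?P)) (subtopology (vtotal H) ?P) g"
    using g by (simp add: homeomorphic_maps_def)
  let ?j = "inv_into (vfibre H' b) \<psi>"
  \<comment> \<open>The inverse of \<open>F\<close> in coordinates; it is meaningful only on
    \<open>?D\<close>, where \<open>?j\<close> lands in the domain of \<open>g\<close>.\<close>
  define f where "f w = \<phi> (g (?j w))" for w
  have fA: "f (A b y) = y" "?j (A b y) \<in> F ` ?P" if y: "y \<in> (khat K b)\<^sup>\<bottom>" for y
  proof -
    obtain x where x: "x \<in> ?P" "y = \<phi> x" using y unfolding ker_perp_iff(2)[OF K, symmetric] by blast
    then have xf: "x \<in> vfibre H b" using ker_perp_fibre by blast
    have "?j (A b y) = F x"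
      using A_apply[OF xf] htriv_inv_into(4)[OF triv' bV F_fibre[OF xf]] by (simp add: x(2))
    then show "f (A b y) = y" "?j (A b y) \<in> F ` ?P" using x gF by (auto simp: f_def)
  qed
  have D: "subspace ?D"
    by (intro linear_subspace_image subspace_orthogonal_comp bounded_linear.linear blinfun.bounded_linear_right)
  have "continuous_map (top_of_set ?D) (prod_topology (top_of_set V) euclidean) (\<lambda>w. (b, w))"
    using bV unfolding continuous_map_paired by (auto simp: continuous_map_in_subtopology)
  from continuous_map_compose[OF this htriv_inv_into(5)[OF triv']]
  have "continuous_map (top_of_set ?D) (vtotal H') ?j" by (simp only: comp_def prod.case)
  moreover have "?j \<in> topspace (top_of_set ?D) \<rightarrow> F ` ?P" using fA(2) by auto
  ultimately have "continuous_map (top_of_set ?D) (subtopology (vtotal H') (F ` ?P)) ?j"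
    by (rule continuous_map_into_subtopology)
  from continuous_map_compose[OF this gc]
  have gj: "continuous_map (top_of_set ?D) (subtopology (vtotal H) ?P) (g \<circ> ?j)" .
  have "continuous_map (subtopology (vtotal H) ?P) euclidean \<phi>"
  proof -
    have "?P \<subseteq> {x. vproj H x \<in> U}" using ker_perp_fibre bU by (auto simp: vfibre_def)
    then show ?thesis by (rule continuous_map_from_subtopology_mono[OF htriv_inv_into(6)[OF triv]])
  qed
  from continuous_map_compose[OF gj this]
  have "continuous_on ?D f" by (simp add: comp_def f_def[abs_def])
  moreover have "f (r *\<^sub>R x) = r *\<^sub>R f x" if "x \<in> ?D" for r x
  proof -
    obtain y where y: "y \<in> (khat K b)\<^sup>\<bottom>" "x = A b y" using \<open>x \<in> ?D\<close> by blast
    have "r *\<^sub>R x = A b (r *\<^sub>R y)" by (simp add: y(2) blinfun.scaleR_right)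
    then show ?thesis
      using fA(1)[OF y(1)] fA(1)[of "r *\<^sub>R y"] y subspace_scale[OF subspace_orthogonal_comp y(1)] by simp
  qed
  ultimately obtain M where M: "M > 0" "\<And>x. x \<in> ?D \<Longrightarrow> norm (f x) \<le> M * norm x"
    using continuous_homogeneous_bound[OF _ D] by metis
  show ?thesis
  proof (rule that[of "1 / M"])
    fix y assume "y \<in> (khat K b)\<^sup>\<bottom>"
    then have "norm y \<le> M * norm (A b y)" using M(2)[of "A b y"] fA(1) by auto
    then show "1 / M * norm y \<le> norm (A b y)" using M(1) by (simp add: field_simps)
  qed (use M(1) in simp)
qed

text \<open>The triangular form of the correspondence. Since \<open>A b z\<close> is orthogonal to
  the cokernel fibre, \<open>\<psi> (snd q)\<close> is a projection of data from \<open>p\<close>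
  alone. It then determines \<open>A b z\<close>, hence \<open>z\<close> by the lower bound, and
  \<open>z\<close> determines \<open>\<phi> (fst q)\<close> as a projection.\<close>

lemma swap_rel_chart:
  assumes K: "invariant_subbundle \<G> H K" and K': "invariant_subbundle \<G> H K'"
    and r: "swap_rel H H' F K K' b p q"
  shows "\<exists>z. z \<in> (khat K b)\<^sup>\<bottom> \<and> A b z = \<psi> (snd p) + \<psi> (snd q) - A b (\<phi> (fst p)) \<and>
     is_proj (khat K' b) (\<phi> (fst p) + z) (\<phi> (fst q)) \<and>
     is_proj (chat K b) (A b (\<phi> (fst p)) - \<psi> (snd p)) (\<psi> (snd q))"
proof -
  obtain x where x: "x \<in> vfibre H b" "F x = vadd H' (snd p) (snd q)"
    and xp: "\<forall>y\<in>K \<inter> vfibre H b. hinner H x y = hinner H (fst p) y"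
    and xq: "\<forall>y\<in>K' \<inter> vfibre H b. hinner H x y = hinner H (fst q) y"
    using r unfolding swap_rel_def by blast
  have p: "fst p \<in> K \<inter> vfibre H b" "snd p \<in> COK H H' F K' \<inter> vfibre H' b"
    and q: "fst q \<in> K' \<inter> vfibre H b" "snd q \<in> COK H H' F K \<inter> vfibre H' b"
    using r unfolding swap_rel_def by auto
  define z where "z = \<phi> x - \<phi> (fst p)"
  have z: "z \<in> (khat K b)\<^sup>\<bottom>"
    using htriv_hinner_eq_iff[OF triv bU _ invariant_subbundle_closed(2)[OF K] x(1), where k="fst p"] p(1) xp
    by (auto simp: z_def)
  have q': "\<phi> x - \<phi> (fst q) \<in> (khat K' b)\<^sup>\<bottom>"
    using htriv_hinner_eq_iff[OF triv bU _ invariant_subbundle_closed(2)[OF K'] x(1), where k="fst q"] q(1) xq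
    by auto
  have Ax: "A b (\<phi> x) = \<psi> (snd p) + \<psi> (snd q)"
    using A_apply[OF x(1)] x(2) htriv_linear(1)[OF triv' bV, of "snd p" "snd q"] p(2) q(2) by simp
  have Az: "A b z = \<psi> (snd p) + \<psi> (snd q) - A b (\<phi> (fst p))"
    by (simp add: z_def blinfun.diff_right Ax)
  have "is_proj (khat K' b) (\<phi> (fst p) + z) (\<phi> (fst q))"
    using q' q(1) by (auto simp: is_proj_def z_def orthogonal_comp_iff)
  moreover have "is_proj (chat K b) (A b (\<phi> (fst p)) - \<psi> (snd p)) (\<psi> (snd q))"
    unfolding is_proj_def
  proof (intro conjI ballI)
    show "\<psi> (snd q) \<in> chat K b" using q(2) by blast
    fix s assume "s \<in> chat K b"
    then have "inner (A b z) s = 0"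
      unfolding chat_eq[OF K] using z by (auto simp: orthogonal_comp_iff inner_commute)
    moreover have "A b (\<phi> (fst p)) - \<psi> (snd p) - \<psi> (snd q) = - A b z" using Az by simp
    ultimately show "inner (A b (\<phi> (fst p)) - \<psi> (snd p) - \<psi> (snd q)) s = 0"
      by (simp only: inner_minus_left)
  qed
  ultimately show ?thesis using z Az by blast
qed

lemma swap_rel_unique:
  assumes adm: "admissible_KER \<G> H H' F K" and adm': "admissible_KER \<G> H H' F K'"
    and r: "swap_rel H H' F K K' b p q1" "swap_rel H H' F K K' b p q2"
  shows "q1 = q2"
proof -
  have K: "invariant_subbundle \<G> H K" and K': "invariant_subbundle \<G> H K'"
    using adm adm' by (simp_all add: admissible_KER_def)
  obtain z1 where z1: "z1 \<in> (khat K b)\<^sup>\<bottom>" "A b z1 = \<psi> (snd p) + \<psi> (snd q1) - A b (\<phi> (fst p))"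
     "is_proj (khat K' b) (\<phi> (fst p) + z1) (\<phi> (fst q1))"
     "is_proj (chat K b) (A b (\<phi> (fst p)) - \<psi> (snd p)) (\<psi> (snd q1))"
    using swap_rel_chart[OF K K' r(1)] by blast
  obtain z2 where z2: "z2 \<in> (khat K b)\<^sup>\<bottom>" "A b z2 = \<psi> (snd p) + \<psi> (snd q2) - A b (\<phi> (fst p))"
     "is_proj (khat K' b) (\<phi> (fst p) + z2) (\<phi> (fst q2))"
     "is_proj (chat K b) (A b (\<phi> (fst p)) - \<psi> (snd p)) (\<psi> (snd q2))"
    using swap_rel_chart[OF K K' r(2)] by blast
  have "subspace (chat K b)" unfolding chat_eq[OF K] by (rule subspace_orthogonal_comp)
  then have e: "\<psi> (snd q1) = \<psi> (snd q2)" using z1(4) z2(4) is_proj_unique by blast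
  obtain m where m: "m > 0" "\<And>y. y \<in> (khat K b)\<^sup>\<bottom> \<Longrightarrow> m * norm y \<le> norm (A b y)"
    using bounded_below[OF adm] by blast
  have "A b (z1 - z2) = 0" using z1(2) z2(2) e by (simp add: blinfun.diff_right)
  moreover have "z1 - z2 \<in> (khat K b)\<^sup>\<bottom>" using z1(1) z2(1) subspace_diff subspace_orthogonal_comp by blast
  ultimately have "m * norm (z1 - z2) \<le> 0" using m(2) by fastforce
  then have "z1 = z2" using m(1) by (simp add: mult_le_0_iff)
  then have "\<phi> (fst q1) = \<phi> (fst q2)" using z1(3) z2(3) is_proj_unique subspace_khat(1)[OF K'] by blast
  then have "fst q1 = fst q2" "snd q1 = snd q2"
    using e r htriv_inj[OF triv bU, of "fst q1" "fst q2"] htriv_inj[OF triv' bV, of "snd q1" "snd q2"]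
    unfolding swap_rel_def by auto
  then show ?thesis by (simp add: prod_eq_iff)
qed

lemma swap_rel_ex:
  assumes adm: "admissible_KER \<G> H H' F K" and adm': "admissible_KER \<G> H H' F K'"
    and p: "p \<in> (K \<inter> vfibre H b) \<times> (COK H H' F K' \<inter> vfibre H' b)"
  shows "\<exists>q. swap_rel H H' F K K' b p q"
proof -
  have K: "invariant_subbundle \<G> H K" and K': "invariant_subbundle \<G> H K'"
    using adm adm' by (simp_all add: admissible_KER_def)
  obtain m where m: "m > 0" "\<And>y. y \<in> (khat K b)\<^sup>\<bottom> \<Longrightarrow> m * norm y \<le> norm (A b y)"
    using bounded_below[OF adm] by blast
  \<comment> \<open>The split is applied to
    \<open>w = \<psi> (snd p) - A b (\<phi> (fst p))\<close>, the defect of F x = d + e for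
    \<open>x = fst p\<close> and \<open>e = 0\<close>.\<close>
  obtain z e where z: "z \<in> (khat K b)\<^sup>\<bottom>" and e: "e \<in> chat K b"
    and Az: "A b z = (\<psi> (snd p) - A b (\<phi> (fst p))) + e"
    using bounded_below_split[OF blinfun.bounded_linear_right subspace_orthogonal_comp closed_orthogonal_comp m]
    unfolding chat_eq[OF K] by metis
  obtain e' where e': "e = \<psi> e'" "e' \<in> COK H H' F K \<inter> vfibre H' b" using e by blast
  define x where "x = inv_into (vfibre H b) \<phi> (\<phi> (fst p) + z)"
  have x: "x \<in> vfibre H b" "\<phi> x = \<phi> (fst p) + z" using htriv_inv_into(2,3)[OF triv bU] by (auto simp: x_def)
  obtain k' where k': "k' \<in> K' \<inter> vfibre H b" "is_proj (khat K' b) (\<phi> x) (\<phi> k')"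
    using subspace_khat(2)[OF K', of "\<phi> x"] unfolding is_proj_def by blast
  have pf: "fst p \<in> vfibre H b" "snd p \<in> vfibre H' b" using p by auto
  have "F x = vadd H' (snd p) e'"
  proof (rule htriv_inj[OF triv' bV F_fibre[OF x(1)]])
    show "vadd H' (snd p) e' \<in> vfibre H' b" using fibrewise_linear_actionD(1)[OF fla(2)] pf e'(2) by blast
    show "\<psi> (F x) = \<psi> (vadd H' (snd p) e')"
      using A_apply[OF x(1)] x(2) Az e'(1) htriv_linear(1)[OF triv' bV pf(2), of e'] e'(2)
      by (simp add: blinfun.add_right)
  qed
  moreover have "\<forall>y\<in>K \<inter> vfibre H b. hinner H x y = hinner H (fst p) y"
    using htriv_hinner_eq_iff[OF triv bU _ invariant_subbundle_closed(2)[OF K] x(1) pf(1)] z x(2) by auto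
  moreover have "\<forall>y\<in>K' \<inter> vfibre H b. hinner H x y = hinner H k' y"
    using htriv_hinner_eq_iff[OF triv bU _ invariant_subbundle_closed(2)[OF K'] x(1), where k=k'] k'
    by (auto simp: is_proj_def orthogonal_comp_iff)
  ultimately have "swap_rel H H' F K K' b p (k', e')"
    unfolding swap_rel_def using p k'(1) e'(2) x(1) by auto
  then show ?thesis by blast
qed

text \<open>The three unknowns converge in triangular order: \<open>e\<close> by
  \<open>tendsto_is_proj\<close>, \<open>z\<close> by \<open>tendsto_solution\<close>, and the
  component in \<open>K'\<close> again by \<open>tendsto_is_proj\<close>.\<close>

lemma tendsto_swap:
  assumes adm: "admissible_KER \<G> H H' F K" and adm': "admissible_KER \<G> H H' F K'"
    and r0: "swap_rel H H' F K K' b p0 (f p0)"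
    and r: "\<forall>\<^sub>F p in Fl. swap_rel H H' F K K' (vproj H (fst p)) p (f p)"
    and lim: "limitin (vtotal H) fst (fst p0) Fl" "limitin (vtotal H') snd (snd p0) Fl"
  shows "limitin (vtotal H) (\<lambda>p. fst (f p)) (fst (f p0)) Fl"
    and "limitin (vtotal H') (\<lambda>p. snd (f p)) (snd (f p0)) Fl"
proof -
  have K: "invariant_subbundle \<G> H K" and K': "invariant_subbundle \<G> H K'"
    and C: "invariant_subbundle \<G> H' (COK H H' F K)"
    using adm adm' by (simp_all add: admissible_KER_def)
  define \<beta> where "\<beta> p = vproj H (fst p)" for p :: "'e \<times> 'f"
  have b: "vproj H (fst p0) = b" "vproj H' (snd p0) = b"
    and q0: "fst (f p0) \<in> vfibre H b" "snd (f p0) \<in> vfibre H' b"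
    using r0 by (auto simp: swap_rel_def vfibre_def)
  have \<beta>: "(\<beta> \<longlongrightarrow> b) Fl"
    using continuous_map_limit[OF vproj_cont(1) lim(1)] by (simp add: comp_def \<beta>_def[abs_def] b)
  have UV: "open (U \<inter> V)" using htriv_inv_into(1)[OF triv] htriv_inv_into(1)[OF triv'] by blast
  have evUV: "\<forall>\<^sub>F p in Fl. \<beta> p \<in> U \<inter> V"
    using topological_tendstoD[OF \<beta> UV] bU bV by blast
  have Alim: "((\<lambda>p. A (\<beta> p)) \<longlongrightarrow> A b) Fl"
    using continuous_on_tendsto_compose[OF local_op(3)[OF atlas triv] \<beta>] bU bV evUV by blast
  have k: "((\<lambda>p. \<phi> (fst p)) \<longlongrightarrow> \<phi> (fst p0)) Fl"
    using htriv_tendsto[OF triv vproj_cont(1) lim(1)] b bU by simp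
  have d: "((\<lambda>p. \<psi> (snd p)) \<longlongrightarrow> \<psi> (snd p0)) Fl"
    using htriv_tendsto[OF triv' vproj_cont(2) lim(2)] b bV by simp
  \<comment> \<open>The charts stay fixed while the base point varies; this gives the equations at
    all points near \<open>b\<close>.\<close>
  have chart: "index_chart G T \<G> H H' F U \<phi> V \<psi> b'" if "b' \<in> U \<inter> V" for b'
    using that atlas triv triv' by unfold_locales auto
  define ok where "ok p z \<longleftrightarrow> z \<in> (khat K (\<beta> p))\<^sup>\<bottom> \<and>
     A (\<beta> p) z = \<psi> (snd p) + \<psi> (snd (f p)) - A (\<beta> p) (\<phi> (fst p)) \<and>
     is_proj (khat K' (\<beta> p)) (\<phi> (fst p) + z) (\<phi> (fst (f p))) \<and>
     is_proj (chat K (\<beta> p)) (A (\<beta> p) (\<phi> (fst p)) - \<psi> (snd p)) (\<psi> (snd (f p)))" for p z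
  have ok_ex: "\<exists>z. ok p z" if "\<beta> p \<in> U \<inter> V" "swap_rel H H' F K K' (\<beta> p) p (f p)" for p
    unfolding ok_def using index_chart.swap_rel_chart[OF chart[OF that(1)] K K' that(2)] .
  \<comment> \<open>\<open>z\<close> depends on the whole point \<open>p\<close>, not only on its
    base point; where no solution exists its value is arbitrary, which the filter ignores.\<close>
  define z where "z p = (SOME z. ok p z)" for p
  have ok: "ok p (z p)" if "\<beta> p \<in> U \<inter> V" "swap_rel H H' F K K' (\<beta> p) p (f p)" for p
    unfolding z_def using ok_ex[OF that] by (rule someI_ex)
  have ev: "\<forall>\<^sub>F p in Fl. ok p (z p) \<and> \<beta> p \<in> U \<inter> V \<and> swap_rel H H' F K K' (\<beta> p) p (f p)"
    using evUV r by eventually_elim (use ok in \<open>auto simp: \<beta>_def\<close>)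
  have b0: "\<beta> p0 = b" by (simp add: \<beta>_def b)
  have ok0: "ok p0 (z p0)" using ok[of p0] r0 bU bV by (simp add: b0)
  have Ak: "((\<lambda>p. A (\<beta> p) (\<phi> (fst p))) \<longlongrightarrow> A b (\<phi> (fst p0))) Fl"
    by (intro tendsto_intros Alim k)
  have e: "((\<lambda>p. \<psi> (snd (f p))) \<longlongrightarrow> \<psi> (snd (f p0))) Fl"
  proof (rule tendsto_is_proj[OF continuous_subspaces_at_subbundle[OF triv' C bV] \<beta>])
    show "((\<lambda>p. A (\<beta> p) (\<phi> (fst p)) - \<psi> (snd p)) \<longlongrightarrow> A b (\<phi> (fst p0)) - \<psi> (snd p0)) Fl"
      by (intro tendsto_intros Ak d)
    show "\<forall>\<^sub>F p in Fl. is_proj (chat K (\<beta> p)) (A (\<beta> p) (\<phi> (fst p)) - \<psi> (snd p)) (\<psi> (snd (f p)))"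
      using ev by eventually_elim (simp add: ok_def)
    show "is_proj (chat K b) (A b (\<phi> (fst p0)) - \<psi> (snd p0)) (\<psi> (snd (f p0)))"
      using ok0 by (simp add: ok_def b0)
  qed
  obtain m where m: "m > 0" "\<And>y. y \<in> (khat K b)\<^sup>\<bottom> \<Longrightarrow> m * norm y \<le> norm (A b y)"
    using bounded_below[OF adm] by blast
  have z: "(z \<longlongrightarrow> z p0) Fl"
  proof (rule tendsto_solution[OF continuous_subspaces_at_subbundle[OF triv K bU] \<beta> Alim m])
    show "\<forall>\<^sub>F p in Fl. z p \<in> (khat K (\<beta> p))\<^sup>\<bottom>" using ev by eventually_elim (simp add: ok_def)
    show "z p0 \<in> (khat K b)\<^sup>\<bottom>" using ok0 by (simp add: ok_def b0)
    have "((\<lambda>p. \<psi> (snd p) + \<psi> (snd (f p)) - A (\<beta> p) (\<phi> (fst p))) \<longlongrightarrow>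
        \<psi> (snd p0) + \<psi> (snd (f p0)) - A b (\<phi> (fst p0))) Fl"
      by (intro tendsto_diff tendsto_add d e Ak)
    moreover have "\<psi> (snd p0) + \<psi> (snd (f p0)) - A b (\<phi> (fst p0)) = A b (z p0)"
      using ok0 by (simp add: ok_def b0)
    ultimately have "((\<lambda>p. \<psi> (snd p) + \<psi> (snd (f p)) - A (\<beta> p) (\<phi> (fst p))) \<longlongrightarrow> A b (z p0)) Fl" by simp
    then show "((\<lambda>p. A (\<beta> p) (z p)) \<longlongrightarrow> A b (z p0)) Fl"
      by (rule Lim_transform_eventually) (use ev in eventually_elim, simp add: ok_def)
  qed auto
  have k': "((\<lambda>p. \<phi> (fst (f p))) \<longlongrightarrow> \<phi> (fst (f p0))) Fl"
  proof (rule tendsto_is_proj[OF continuous_subspaces_at_subbundle[OF triv K' bU] \<beta>])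
    show "((\<lambda>p. \<phi> (fst p) + z p) \<longlongrightarrow> \<phi> (fst p0) + z p0) Fl" by (intro tendsto_add k z)
    show "\<forall>\<^sub>F p in Fl. is_proj (khat K' (\<beta> p)) (\<phi> (fst p) + z p) (\<phi> (fst (f p)))"
      using ev by eventually_elim (simp add: ok_def)
    show "is_proj (khat K' b) (\<phi> (fst p0) + z p0) (\<phi> (fst (f p0)))"
      using ok0 by (simp add: ok_def b0)
  qed
  show "limitin (vtotal H) (\<lambda>p. fst (f p)) (fst (f p0)) Fl"
    by (rule limitin_htrivI[OF triv bU q0(1) \<beta> k']) (use ev in eventually_elim, auto simp: swap_rel_def)
  show "limitin (vtotal H') (\<lambda>p. snd (f p)) (snd (f p0)) Fl"
    by (rule limitin_htrivI[OF triv' bV q0(2) \<beta> e]) (use ev in eventually_elim, auto simp: swap_rel_def)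
qed

end


section \<open>The index does not depend on the kernel bundle\<close>

context fredholm_bundle_map
begin

lemma index_chart:
  obtains U \<phi> V \<psi> where "index_chart G T \<G> H H' F U \<phi> V \<psi> b"
proof -
  obtain U \<phi> V \<psi> where "(U, \<phi>) \<in> hatlas H" "(V, \<psi>) \<in> hatlas H'" "htriv H U \<phi>" "htriv H' V \<psi>" "b \<in> U" "b \<in> V"
    by (rule chart) (rule that)
  then show ?thesis by (intro that index_chart.intro index_chart_axioms.intro fredholm_bundle_map_axioms)
qed

text \<open>The bundle record carries no vector space axioms; these laws are pulled back from the
  Hilbert space through a chart.\<close>

lemma vadd_interchange:
  assumes "d \<in> vfibre H' b" "e \<in> vfibre H' b" "d' \<in> vfibre H' b" "e' \<in> vfibre H' b"
  shows "vadd H' (vadd H' d e) (vadd H' d' e') = vadd H' (vadd H' d d') (vadd H' e e')"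
    and "vadd H' d e = vadd H' e d"
    and "vscale H' c (vadd H' d e) = vadd H' (vscale H' c d) (vscale H' c e)"
proof -
  obtain U \<phi> V \<psi> where "htriv H' V \<psi>" "b \<in> V"
    by (rule chart) (rule that)
  note t = htriv_inj[OF this] htriv_linear(1,3)[OF this]
  note cl = fibrewise_linear_actionD(1,2)[OF fla(2)]
  show "vadd H' (vadd H' d e) (vadd H' d' e') = vadd H' (vadd H' d d') (vadd H' e e')"
    by (rule t(1)) (simp_all add: assms cl t(2))
  show "vadd H' d e = vadd H' e d"
    by (rule t(1)) (simp_all add: assms cl t(2))
  show "vscale H' c (vadd H' d e) = vadd H' (vscale H' c d) (vscale H' c e)"
    by (rule t(1)) (simp_all add: assms cl t(2,3) cscale_add_right)
qed

lemma hinner_linear: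
  assumes "x \<in> vfibre H b" "x' \<in> vfibre H b" "y \<in> vfibre H b"
  shows "hinner H (vadd H x x') y = hinner H x y + hinner H x' y"
    and "hinner H (vscale H c x) y = c * hinner H x y"
proof -
  obtain U \<phi> V \<psi> where "htriv H U \<phi>" "b \<in> U"
    by (rule chart) (rule that)
  note t = htriv_linear[OF this]
  note cl = fibrewise_linear_actionD(1,2)[OF fla(1)]
  show "hinner H (vadd H x x') y = hinner H x y + hinner H x' y"
    "hinner H (vscale H c x) y = c * hinner H x y"
    by (simp_all add: assms cl t cinner_add_left cinner_cscale_left)
qed

text \<open>Unitarity moves \<open>g\<close> to the other argument as its inverse, and the inverse
  preserves \<open>K\<close>. Hence projection to \<open>K\<close> commutes with the action.\<close>

lemma hinner_act:
  assumes g: "g \<in> carrier (gfibre \<G> b)" and K: "invariant_subbundle \<G> H K"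
    and x: "x \<in> vfibre H b" and k: "k \<in> vfibre H b"
    and eq: "\<forall>y\<in>K \<inter> vfibre H b. hinner H x y = hinner H k y"
  shows "\<forall>y\<in>K \<inter> vfibre H b. hinner H (vact H g x) y = hinner H (vact H g k) y"
proof
  fix y assume y: "y \<in> K \<inter> vfibre H b"
  interpret group "gfibre \<G> b" using fibred_groups by (simp add: fibred_groups_def)
  define y' where "y' = vact H (inv\<^bsub>gfibre \<G> b\<^esub> g) y"
  have y': "y' \<in> K \<inter> vfibre H b"
    unfolding y'_def using invariant_subbundle_closed(3)[OF K y] g by blast
  have "vact H g y' = y"
    using fibrewise_linear_actionD(5)[OF fla(1), of y b g "inv\<^bsub>gfibre \<G> b\<^esub> g"]
      fibrewise_linear_actionD(4)[OF fla(1), of y b] y g by (simp add: y'_def)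
  moreover have "hinner H (vact H g v) (vact H g y') = hinner H v y'" if "v \<in> vfibre H b" for v
    using hilbert_bundle g that y' by (simp add: hilbert_bundle_def)
  ultimately show "hinner H (vact H g x) y = hinner H (vact H g k) y"
    using x k eq y' by metis
qed

lemma swap_rel_sym:
  assumes "swap_rel H H' F K K' b p q"
  shows "swap_rel H H' F K' K b q p"
proof -
  have "vadd H' (snd p) (snd q) = vadd H' (snd q) (snd p)"
    using assms vadd_interchange(2)[of "snd p" b "snd q" "snd p" "snd q"] by (auto simp: swap_rel_def)
  then show ?thesis using assms unfolding swap_rel_def by auto
qed

text \<open>The witness \<open>x\<close> is added, scaled and acted upon along with the pairs.
  Together with uniqueness this makes every function selecting from the relation linear and
  equivariant.\<close>

lemma swap_rel_linear:
  assumes K: "invariant_subbundle \<G> H K" and K': "invariant_subbundle \<G> H K'"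
    and C: "invariant_subbundle \<G> H' (COK H H' F K)" and C': "invariant_subbundle \<G> H' (COK H H' F K')"
    and r: "swap_rel H H' F K K' b p q"
  shows "swap_rel H H' F K K' b p' q' \<Longrightarrow> swap_rel H H' F K K' b
      (vadd H (fst p) (fst p'), vadd H' (snd p) (snd p')) (vadd H (fst q) (fst q'), vadd H' (snd q) (snd q'))"
    and "swap_rel H H' F K K' b
      (vscale H c (fst p), vscale H' c (snd p)) (vscale H c (fst q), vscale H' c (snd q))"
    and "g \<in> carrier (gfibre \<G> b) \<Longrightarrow> swap_rel H H' F K K' b
      (vact H g (fst p), vact H' g (snd p)) (vact H g (fst q), vact H' g (snd q))"
proof -
  obtain x where x: "x \<in> vfibre H b" "F x = vadd H' (snd p) (snd q)"
    and xp: "\<forall>y\<in>K \<inter> vfibre H b. hinner H x y = hinner H (fst p) y"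
    and xq: "\<forall>y\<in>K' \<inter> vfibre H b. hinner H x y = hinner H (fst q) y"
    using r unfolding swap_rel_def by blast
  have p: "fst p \<in> K \<inter> vfibre H b" "snd p \<in> COK H H' F K' \<inter> vfibre H' b"
    and q: "fst q \<in> K' \<inter> vfibre H b" "snd q \<in> COK H H' F K \<inter> vfibre H' b"
    using r unfolding swap_rel_def by auto
  have pf: "fst p \<in> vfibre H b" "snd p \<in> vfibre H' b" "fst q \<in> vfibre H b" "snd q \<in> vfibre H' b"
    using p q by auto
  note cl = fibrewise_linear_actionD(1-3)[OF fla(1)]
  show "swap_rel H H' F K K' b
      (vscale H c (fst p), vscale H' c (snd p)) (vscale H c (fst q), vscale H' c (snd q))"
    unfolding swap_rel_def
  proof (intro conjI bexI[of _ "vscale H c x"])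
    show "F (vscale H c x) = vadd H' (snd (vscale H c (fst p), vscale H' c (snd p)))
        (snd (vscale H c (fst q), vscale H' c (snd q)))"
      using F_linear(2)[OF x(1)] x(2) vadd_interchange(3)[OF pf(2,4) pf(2,4)] by simp
  qed (use x(1) xp xq pf cl hinner_linear(2)[OF x(1) x(1)] hinner_linear(2)[OF pf(1) pf(1)]
      hinner_linear(2)[OF pf(3) pf(3)] invariant_subbundle_closed(2)[OF K p(1)]
      invariant_subbundle_closed(2)[OF K' q(1)] invariant_subbundle_closed(2)[OF C' p(2)]
      invariant_subbundle_closed(2)[OF C q(2)] in auto)
  show "swap_rel H H' F K K' b
      (vact H g (fst p), vact H' g (snd p)) (vact H g (fst q), vact H' g (snd q))"
    if g: "g \<in> carrier (gfibre \<G> b)"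
    unfolding swap_rel_def
  proof (intro conjI bexI[of _ "vact H g x"])
    show "F (vact H g x) = vadd H' (snd (vact H g (fst p), vact H' g (snd p)))
        (snd (vact H g (fst q), vact H' g (snd q)))"
      using F_act[OF g x(1)] x(2) fibrewise_linear_actionD(6)[OF fla(2) pf(2) g pf(4)] by simp
  qed (use cl(3)[OF x(1) g] hinner_act[OF g K x(1) pf(1) xp] hinner_act[OF g K' x(1) pf(3) xq]
      invariant_subbundle_closed(3)[OF K p(1) g]
      invariant_subbundle_closed(3)[OF K' q(1) g] invariant_subbundle_closed(3)[OF C' p(2) g]
      invariant_subbundle_closed(3)[OF C q(2) g] in auto)
  assume r': "swap_rel H H' F K K' b p' q'"
  obtain x' where x': "x' \<in> vfibre H b" "F x' = vadd H' (snd p') (snd q')"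
    and xp': "\<forall>y\<in>K \<inter> vfibre H b. hinner H x' y = hinner H (fst p') y"
    and xq': "\<forall>y\<in>K' \<inter> vfibre H b. hinner H x' y = hinner H (fst q') y"
    using r' unfolding swap_rel_def by blast
  have p': "fst p' \<in> K \<inter> vfibre H b" "snd p' \<in> COK H H' F K' \<inter> vfibre H' b"
    and q': "fst q' \<in> K' \<inter> vfibre H b" "snd q' \<in> COK H H' F K \<inter> vfibre H' b"
    using r' unfolding swap_rel_def by auto
  have pf': "fst p' \<in> vfibre H b" "snd p' \<in> vfibre H' b" "fst q' \<in> vfibre H b" "snd q' \<in> vfibre H' b"
    using p' q' by auto
  show "swap_rel H H' F K K' b
      (vadd H (fst p) (fst p'), vadd H' (snd p) (snd p')) (vadd H (fst q) (fst q'), vadd H' (snd q) (snd q'))"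
    unfolding swap_rel_def
  proof (intro conjI bexI[of _ "vadd H x x'"])
    show "F (vadd H x x') = vadd H' (snd (vadd H (fst p) (fst p'), vadd H' (snd p) (snd p')))
        (snd (vadd H (fst q) (fst q'), vadd H' (snd q) (snd q')))"
      using F_linear(1)[OF x(1) x'(1)] x(2) x'(2) vadd_interchange(1)[OF pf(2,4) pf'(2,4)] by simp
  qed (use cl(1)[OF x(1) x'(1)] xp xq xp' xq' hinner_linear(1)[OF x(1) x'(1)] hinner_linear(1)[OF pf(1) pf'(1)]
      hinner_linear(1)[OF pf(3) pf'(3)] invariant_subbundle_closed(1)[OF K p(1) p'(1)]
      invariant_subbundle_closed(1)[OF K' q(1) q'(1)] invariant_subbundle_closed(1)[OF C' p(2) p'(2)]
      invariant_subbundle_closed(1)[OF C q(2) q'(2)] in auto)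
qed

text \<open>Continuity is checked point by point along the filter \<open>atin\<close>, since
  suitable charts exist only locally around each base point.\<close>

lemma continuous_map_swap:
  assumes adm: "admissible_KER \<G> H H' F K" and adm': "admissible_KER \<G> H H' F K'"
    and f: "\<And>b p. p \<in> (K \<inter> vfibre H b) \<times> (COK H H' F K' \<inter> vfibre H' b) \<Longrightarrow> swap_rel H H' F K K' b p (f p)"
  shows "continuous_map (vtotal (vsum (subbundle H K) (subbundle H' (COK H H' F K'))))
     (vtotal (vsum (subbundle H K') (subbundle H' (COK H H' F K)))) f"
proof -
  let ?E = "vsum (subbundle H K) (subbundle H' (COK H H' F K'))"
  let ?E' = "vsum (subbundle H K') (subbundle H' (COK H H' F K))"
  have fb: "swap_rel H H' F K K' (vproj H (fst p)) p (f p)" if "p \<in> topspace (vtotal ?E)" for p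
    using that by (intro f) (auto simp: vfibre_def)
  have q: "fst (f p) \<in> K'" "snd (f p) \<in> COK H H' F K" "vproj H (fst (f p)) = vproj H' (snd (f p))"
    if "p \<in> topspace (vtotal ?E)" for p
    using fb[OF that] by (auto simp: swap_rel_def vfibre_def)
  have lim: "limitin (vtotal H) (\<lambda>p. fst (f p)) (fst (f p0)) (atin (vtotal ?E) p0)"
    "limitin (vtotal H') (\<lambda>p. snd (f p)) (snd (f p0)) (atin (vtotal ?E) p0)"
    if p0: "p0 \<in> topspace (vtotal ?E)" for p0
  proof -
    obtain U \<phi> V \<psi> where "index_chart G T \<G> H H' F U \<phi> V \<psi> (vproj H (fst p0))"
      by (rule index_chart) (rule that)
    then interpret index_chart G T \<G> H H' F U \<phi> V \<psi> "vproj H (fst p0)" .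
    have ev: "\<forall>\<^sub>F p in atin (vtotal ?E) p0. swap_rel H H' F K K' (vproj H (fst p)) p (f p)"
      unfolding eventually_atin using fb openin_topspace p0 by blast
    have "continuous_map (vtotal ?E) (vtotal H) fst" "continuous_map (vtotal ?E) (vtotal H') snd"
      using continuous_map_vsum_fst[of "subbundle H K" "subbundle H' (COK H H' F K')"]
        continuous_map_vsum_snd[of "subbundle H K" "subbundle H' (COK H H' F K')"]
      by (simp_all add: continuous_map_in_subtopology del: vsum_simps)
    then have l: "limitin (vtotal H) fst (fst p0) (atin (vtotal ?E) p0)"
      "limitin (vtotal H') snd (snd p0) (atin (vtotal ?E) p0)"
      using p0 by (simp_all add: continuous_map_atin del: vsum_simps)
    show "limitin (vtotal H) (\<lambda>p. fst (f p)) (fst (f p0)) (atin (vtotal ?E) p0)"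
      "limitin (vtotal H') (\<lambda>p. snd (f p)) (snd (f p0)) (atin (vtotal ?E) p0)"
      using tendsto_swap[OF adm adm' fb[OF p0] ev l] .
  qed
  have "continuous_map (vtotal ?E) (vtotal H) (\<lambda>p. fst (f p))"
    "continuous_map (vtotal ?E) (vtotal H') (\<lambda>p. snd (f p))"
    unfolding continuous_map_atin using lim by blast+
  then show ?thesis
    unfolding continuous_map_vsum
    using q by (auto simp: continuous_map_in_subtopology simp del: vsum_simps(1))
qed

lemma kernel_cokernel_iso:
  assumes adm: "admissible_KER \<G> H H' F K" and adm': "admissible_KER \<G> H H' F K'"
  shows "vbundle_iso \<G> (vsum (subbundle H K) (subbundle H' (COK H H' F K')))
     (vsum (subbundle H K') (subbundle H' (COK H H' F K)))"
proof -
  have inv: "invariant_subbundle \<G> H K" "invariant_subbundle \<G> H K'"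
    "invariant_subbundle \<G> H' (COK H H' F K)" "invariant_subbundle \<G> H' (COK H H' F K')"
    using adm adm' by (simp_all add: admissible_KER_def)
  \<comment> \<open>Both bundles are parameters, so that the inverse is the same function with
    exchanged arguments: symmetry of the relation and uniqueness give \<open>ff\<close>.\<close>
  define f where "f K K' p = (SOME q. swap_rel H H' F K K' (vproj H (fst p)) p q)" for K K' p
  have f: "swap_rel H H' F K K' b p (f K K' p)"
    if "admissible_KER \<G> H H' F K" "admissible_KER \<G> H H' F K'"
      and p: "p \<in> (K \<inter> vfibre H b) \<times> (COK H H' F K' \<inter> vfibre H' b)" for K K' b p
  proof -
    obtain U \<phi> V \<psi> where "index_chart G T \<G> H H' F U \<phi> V \<psi> b" by (rule index_chart) (rule that)
    then interpret index_chart G T \<G> H H' F U \<phi> V \<psi> b .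
    have "vproj H (fst p) = b" using p by (auto simp: vfibre_def)
    then show ?thesis
      using someI_ex[OF swap_rel_ex[OF \<open>admissible_KER \<G> H H' F K\<close> \<open>admissible_KER \<G> H H' F K'\<close> p]]
      by (simp add: f_def)
  qed
  have f_eq: "f K K' p = q"
    if a: "admissible_KER \<G> H H' F K" "admissible_KER \<G> H H' F K'"
      and r: "swap_rel H H' F K K' b p q" for K K' b p q
  proof -
    obtain U \<phi> V \<psi> where "index_chart G T \<G> H H' F U \<phi> V \<psi> b" by (rule index_chart) (rule that)
    then interpret index_chart G T \<G> H H' F U \<phi> V \<psi> b .
    have "p \<in> (K \<inter> vfibre H b) \<times> (COK H H' F K' \<inter> vfibre H' b)" using r by (simp add: swap_rel_def)
    then show ?thesis using swap_rel_unique[OF a f[OF a] r] by blast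
  qed
  have ff: "f K' K (f K K' p) = p"
    if a: "admissible_KER \<G> H H' F K" "admissible_KER \<G> H H' F K'"
      and p: "p \<in> topspace (vtotal (vsum (subbundle H K) (subbundle H' (COK H H' F K'))))" for K K' p
  proof -
    have "p \<in> (K \<inter> vfibre H (vproj H (fst p))) \<times> (COK H H' F K' \<inter> vfibre H' (vproj H (fst p)))"
      using p by (auto simp: vfibre_def)
    from swap_rel_sym[OF f[OF a this]] show ?thesis by (rule f_eq[OF a(2,1)])
  qed
  note lin = swap_rel_linear[OF inv f[OF adm adm']]
  show ?thesis
  proof (rule vbundle_isoI[where f="f K K'" and g="f K' K"])
    show "homeomorphic_maps (vtotal (vsum (subbundle H K) (subbundle H' (COK H H' F K'))))
        (vtotal (vsum (subbundle H K') (subbundle H' (COK H H' F K)))) (f K K') (f K' K)"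
      unfolding homeomorphic_maps_def
      using continuous_map_swap[OF adm adm' f[OF adm adm']] continuous_map_swap[OF adm' adm f[OF adm' adm]]
        ff[OF adm adm'] ff[OF adm' adm] by blast
  next
    fix p assume "p \<in> topspace (vtotal (vsum (subbundle H K) (subbundle H' (COK H H' F K'))))"
    then have "p \<in> (K \<inter> vfibre H (vproj H (fst p))) \<times> (COK H H' F K' \<inter> vfibre H' (vproj H (fst p)))"
      by (auto simp: vfibre_def)
    from f[OF adm adm' this]
    show "vproj (vsum (subbundle H K') (subbundle H' (COK H H' F K))) (f K K' p) =
        vproj (vsum (subbundle H K) (subbundle H' (COK H H' F K'))) p"
      by (auto simp: swap_rel_def vfibre_def)
  next
    fix b p p'
    assume "p \<in> vfibre (vsum (subbundle H K) (subbundle H' (COK H H' F K'))) b"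
      "p' \<in> vfibre (vsum (subbundle H K) (subbundle H' (COK H H' F K'))) b"
    then have p: "p \<in> (K \<inter> vfibre H b) \<times> (COK H H' F K' \<inter> vfibre H' b)"
      "p' \<in> (K \<inter> vfibre H b) \<times> (COK H H' F K' \<inter> vfibre H' b)" by simp_all
    from f_eq[OF adm adm' lin(1)[OF p(1) f[OF adm adm' p(2)]]]
    show "f K K' (vadd (vsum (subbundle H K) (subbundle H' (COK H H' F K'))) p p') =
        vadd (vsum (subbundle H K') (subbundle H' (COK H H' F K))) (f K K' p) (f K K' p')" by simp
  next
    fix b c p
    assume "p \<in> vfibre (vsum (subbundle H K) (subbundle H' (COK H H' F K'))) b"
    then have p: "p \<in> (K \<inter> vfibre H b) \<times> (COK H H' F K' \<inter> vfibre H' b)" by simp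
    from f_eq[OF adm adm' lin(2)[OF p]]
    show "f K K' (vscale (vsum (subbundle H K) (subbundle H' (COK H H' F K'))) c p) =
        vscale (vsum (subbundle H K') (subbundle H' (COK H H' F K))) c (f K K' p)" by simp
  next
    fix b g p
    assume g: "g \<in> carrier (gfibre \<G> b)"
      and "p \<in> vfibre (vsum (subbundle H K) (subbundle H' (COK H H' F K'))) b"
    then have p: "p \<in> (K \<inter> vfibre H b) \<times> (COK H H' F K' \<inter> vfibre H' b)" by simp
    from f_eq[OF adm adm' lin(3)[OF p g]]
    show "f K K' (vact (vsum (subbundle H K) (subbundle H' (COK H H' F K'))) g p) =
        vact (vsum (subbundle H K') (subbundle H' (COK H H' F K))) g (f K K' p)" by simp
  qed
qed

lemma gauge_index_independent:
  assumes adm: "admissible_KER \<G> H H' F K" and adm': "admissible_KER \<G> H H' F K'"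
  shows "gauge_index \<G> H H' F K \<in> carrier (K0 \<G>)"
    and "gauge_index \<G> H H' F K = gauge_index \<G> H H' F K'"
proof -
  interpret M: comm_monoid "vbundle_monoid \<G>"
    by (rule comm_monoid_vbundle_monoid[OF fibred_groups])
  have ev: "equivariant_vbundle \<G> (subbundle H K)" "equivariant_vbundle \<G> (subbundle H K')"
    "equivariant_vbundle \<G> (subbundle H' (COK H H' F K))" "equivariant_vbundle \<G> (subbundle H' (COK H H' F K'))"
    using adm adm' by (simp_all add: admissible_KER_def invariant_subbundle_def)
  note car = ev[THEN vbundle_class_in_carrier[OF fibred_groups]]
  have idx: "gauge_index \<G> H H' F K =
      M.diff_class (vbundle_class \<G> (subbundle H K)) (vbundle_class \<G> (subbundle H' (COK H H' F K)))"
    unfolding gauge_index_def K0_def K0_class_def by (rule M.completion_map_diff[OF car(1,3)])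
  have idx': "gauge_index \<G> H H' F K' =
      M.diff_class (vbundle_class \<G> (subbundle H K')) (vbundle_class \<G> (subbundle H' (COK H H' F K')))"
    unfolding gauge_index_def K0_def K0_class_def by (rule M.completion_map_diff[OF car(2,4)])
  show "gauge_index \<G> H H' F K \<in> carrier (K0 \<G>)"
    unfolding idx K0_def M.carrier_group_completion using car by blast
  have "vbundle_class \<G> (vsum (subbundle H K) (subbundle H' (COK H H' F K'))) =
      vbundle_class \<G> (vsum (subbundle H K') (subbundle H' (COK H H' F K)))"
    using ev by (intro vbundle_class_eq kernel_cokernel_iso[OF adm adm'] fibrewise_linear_action_vsum)
      (simp_all add: equivariant_vbundle_def)
  then show "gauge_index \<G> H H' F K = gauge_index \<G> H H' F K'"
    unfolding idx idx' using car ev fibred_groups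
    by (intro M.diff_class_eqI) (simp_all add: mult_vbundle_class)
qed

end

theorem lemma4p4:
  fixes G :: "'k monoid"
    and T :: "'k topology"
    and \<G> :: "('b::t2_space, 'g) group_family"
    and H\<^sub>0 :: "('b, 'g, 'e, 'v::complex_hilbert) hbundle"
    and H\<^sub>1 :: "('b, 'g, 'f, 'w::complex_hilbert) hbundle"
    and F :: "'e \<Rightarrow> 'f"
    and KER KER' :: "'e set"
  assumes "compact (UNIV :: 'b set)"
    and "path_connected (UNIV :: 'b set)"
    and "locally simply_connected (UNIV :: 'b set)"
    and "compact_lie_group G T"
    and "group_bundle G T \<G>"
    and "finite_holonomy G T \<G>"
    and "hilbert_bundle G T \<G> H\<^sub>0"
    and "hilbert_bundle G T \<G> H\<^sub>1"
    and "fredholm_family \<G> H\<^sub>0 H\<^sub>1 F"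
    and "admissible_KER \<G> H\<^sub>0 H\<^sub>1 F KER"
    and "admissible_KER \<G> H\<^sub>0 H\<^sub>1 F KER'"
  shows "gauge_index \<G> H\<^sub>0 H\<^sub>1 F KER \<in> carrier (K0 \<G>) \<and>
         gauge_index \<G> H\<^sub>0 H\<^sub>1 F KER = gauge_index \<G> H\<^sub>0 H\<^sub>1 F KER'"
proof -
  interpret fredholm_bundle_map G T \<G> H\<^sub>0 H\<^sub>1 F
    using assms by unfold_locales
  show ?thesis using gauge_index_independent assms by blast
qed

end
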